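(* Let $1\le q<\infty$ and $C\subseteq L^q$. Then $$C\text{ compact}\iff\exists\,g\in\mathcal{C}_0\ \exists\,h\in L^1:\ C\subseteq g\,(h*B_{1,q}),$$ where $g\,(h*B_{1,q})=\{g\cdot(h*f):f\in B_{1,q}\}$.
   Context: $L^q=L^q(\mathbb{R}^n)$ and $L^1=L^1(\mathbb{R}^n)$ are the usual Lebesgue spaces; compactness refers to the norm topology of $L^q$. $B_{1,q}$ is the unit ball of $L^q$, $\mathcal{C}_0$ is the space of continuous functions on $\mathbb{R}^n$ vanishing at infinity, and $*$ is convolution on $\mathbb{R}^n$.
   Formalization: "C compact" is read as "C relatively compact" (its closure in L^q is compact); with literal compactness the implication from right to left fails, e.g. for C = {u/n : n ≥ 1} with u ≠ 0 in g(h*B_{1,q}), which omits its limit 0. For closed C nothing changes. *)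

theory Defs
  imports "HOL-Analysis.Analysis"
begin

text \<open>
  Scalars range over a type of sort \<open>{real_normed_field, euclidean_space}\<close>, which covers
  both \<^typ>\<open>real\<close> and \<^typ>\<open>complex\<close>. Functions are Borel measurable; every Lebesgue
  measurable function agrees almost everywhere with a Borel measurable one, so the space of
  classes \<open>Lp q\<close> below is the usual one.
\<close>

definition Lp_fun :: "real \<Rightarrow> ('a::euclidean_space \<Rightarrow> 'b::{real_normed_field,euclidean_space}) set"
  where "Lp_fun q =
    {f \<in> borel_measurable lborel. integrable lborel (\<lambda>x. norm (f x) powr q)}"

definition Lp_norm :: "real \<Rightarrow> ('a::euclidean_space \<Rightarrow> 'b::{real_normed_field,euclidean_space}) \<Rightarrow> real"
  where "Lp_norm q f = (LINT x|lborel. norm (f x) powr q) powr (1 / q)"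

definition ae_rel ::
    "real \<Rightarrow> (('a::euclidean_space \<Rightarrow> 'b::{real_normed_field,euclidean_space}) \<times> ('a \<Rightarrow> 'b)) set"
  where "ae_rel q = {(f, f'). f \<in> Lp_fun q \<and> f' \<in> Lp_fun q \<and> (AE x in lborel. f x = f' x)}"

definition Lp :: "real \<Rightarrow> ('a::euclidean_space \<Rightarrow> 'b::{real_normed_field,euclidean_space}) set set"
  where "Lp q = Lp_fun q // ae_rel q"

text \<open>The choice of representatives is immaterial, since the norm depends only on the class.\<close>

definition Lp_dist ::
    "real \<Rightarrow> ('a::euclidean_space \<Rightarrow> 'b::{real_normed_field,euclidean_space}) set \<Rightarrow> ('a \<Rightarrow> 'b) set \<Rightarrow> real"
  where "Lp_dist q F G = Lp_norm q (\<lambda>x. (SOME f. f \<in> F) x - (SOME g. g \<in> G) x)"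

definition Lp_topology ::
    "real \<Rightarrow> ('a::euclidean_space \<Rightarrow> 'b::{real_normed_field,euclidean_space}) set topology"
  where "Lp_topology q = Metric_space.mtopology (Lp q) (Lp_dist q)"

definition Lp_ball :: "real \<Rightarrow> ('a::euclidean_space \<Rightarrow> 'b::{real_normed_field,euclidean_space}) set"
  where "Lp_ball q = {f \<in> Lp_fun q. Lp_norm q f \<le> 1}"

definition C0 :: "('a::euclidean_space \<Rightarrow> 'b::{real_normed_field,euclidean_space}) set"
  where "C0 = {g. continuous_on UNIV g \<and> (g \<longlongrightarrow> 0) at_infinity}"

text \<open>
  For integrable \<open>h\<close> and \<open>f \<in> Lp_fun q\<close> the integrand is integrable for almost every \<open>x\<close>
  (Young); at the remaining points the Bochner integral is 0 by convention.
\<close>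

definition convolution ::
    "('a::euclidean_space \<Rightarrow> 'b::{real_normed_field,euclidean_space}) \<Rightarrow> ('a \<Rightarrow> 'b) \<Rightarrow> 'a \<Rightarrow> 'b"
  where "convolution h f x = (LINT y|lborel. h (x - y) * f y)"

end

theory Submission
  imports Defs "HOL-Complex_Analysis.Great_Picard"
begin

text \<open>
  The metric space \<open>L\<^sup>q\<close> is complete, so a set has compact closure if and only if it is totally
  bounded; both directions are proved for totally bounded sets of functions.

  A set \<open>g (h * B)\<close> is totally bounded because the operator \<open>f \<mapsto> g (h * f)\<close> is a norm limit of
  operators \<open>f \<mapsto> 1\<^bsub>K\<^esub> g (\<phi> * f)\<close> with \<open>K\<close> a closed ball and \<open>\<phi>\<close> continuous of compact support: cutting
  \<open>g\<close> off costs little since \<open>g\<close> vanishes at infinity, and replacing \<open>h\<close> by \<open>\<phi>\<close> costs little by the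
  inequality of Young. The functions \<open>\<phi> * f\<close> with \<open>f\<close> in the unit ball are uniformly bounded and
  equicontinuous, so the theorem of Arzela and Ascoli gives uniformly convergent subsequences on \<open>K\<close>
  (\<open>Lp_totally_bounded_multiplier_convolution\<close>).

  Conversely, let \<open>A\<close> be totally bounded. It is uniformly small near infinity, so there are radii \<open>R\<^sub>k\<close>
  beyond which all its members have norm at most \<open>4\<^sup>-\<^sup>k\<close>. A positive function \<open>g\<close> in \<open>C\<^sub>0\<close> that is at
  least \<open>2\<^sup>-\<^sup>k\<close> on the ball of radius \<open>R\<^sub>k\<close> can then be divided out, and the quotients \<open>f / g\<close> still form
  a totally bounded set (\<open>C0_factor\<close>).

  It remains to write the members of a totally bounded set as \<open>h * u\<close> with one \<open>h\<close> and bounded \<open>u\<close>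
  (\<open>L1_factor\<close>). This is a factorization in the spirit of Cohen, carried out by an infinite product.
  Choose averaging kernels \<open>e\<^sub>1, e\<^sub>2, \<dots>\<close> one after the other, supported in small balls, and put
  \<open>u\<^sub>n = (2 - e\<^sub>n) * \<dots> * (2 - e\<^sub>1) * f\<close>. Since averaging over a small ball moves the members of a totally
  bounded set only a little, \<open>u\<^sub>n\<^sub>+\<^sub>1 - u\<^sub>n = u\<^sub>n - e\<^sub>n\<^sub>+\<^sub>1 * u\<^sub>n\<close> is as small as desired, uniformly in \<open>f\<close>, and
  \<open>u\<^sub>n\<close> converges. The inverse of \<open>2 - e\<close> is \<open>1/2 + r\<close> with a kernel \<open>r\<close> of norm at most \<open>1/2\<close>, given by a
  geometric series. The product of the first \<open>n\<close> inverses is therefore \<open>2\<^sup>-\<^sup>n + h\<^sub>n\<close> with an integrable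
  function \<open>h\<^sub>n\<close>, that is, \<open>f = 2\<^sup>-\<^sup>n u\<^sub>n + h\<^sub>n * u\<^sub>n\<close>. If the kernel \<open>e\<^sub>n\<^sub>+\<^sub>1\<close> is also chosen to move \<open>h\<^sub>n\<close>
  only a little in \<open>L\<^sup>1\<close>, then \<open>h\<^sub>n\<close> converges as well. The multiples of the identity die out in the limit,
  and \<open>f = h * u\<close> remains.
\<close>

section \<open>Norms and completeness of \<open>L\<^sup>q\<close>\<close>

lemma Lp_fun_borel [measurable_dest]:
  "f \<in> Lp_fun q \<Longrightarrow> f \<in> borel_measurable borel"
  by (simp add: Lp_fun_def)

lemma Lp_norm_nonneg [simp]: "0 \<le> Lp_norm q f"
  by (simp add: Lp_norm_def)

lemma Lp_norm_powr:
  assumes "1 \<le> q"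
  shows "Lp_norm q f powr q = (LINT x|lborel. norm (f x) powr q)"
  using assms by (simp add: Lp_norm_def powr_powr)

lemma nn_integral_Lp_norm:
  assumes "1 \<le> q" "f \<in> Lp_fun q"
  shows "(\<integral>\<^sup>+x. ennreal (norm (f x) powr q) \<partial>lborel) = ennreal (Lp_norm q f powr q)"
  using assms by (subst nn_integral_eq_integral) (auto simp: Lp_fun_def Lp_norm_powr)

text \<open>
  The bridge between the two descriptions of the norm: integrals of nonnegative functions are
  estimated without integrability conditions, and a finite bound gives membership and norm at once.
\<close>

lemma Lp_norm_le:
  assumes q: "1 \<le> q" and [measurable]: "f \<in> borel_measurable borel" and "0 \<le> M"
    and le: "(\<integral>\<^sup>+x. ennreal (norm (f x) powr q) \<partial>lborel) \<le> ennreal (M powr q)"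
  shows Lp_funI: "f \<in> Lp_fun q" and Lp_normI: "Lp_norm q f \<le> M"
proof -
  show f: "f \<in> Lp_fun q"
    using le_less_trans[OF le ennreal_less_top]
    by (auto simp: Lp_fun_def integrable_iff_bounded)
  have "Lp_norm q f powr q \<le> M powr q"
    using le by (simp add: nn_integral_Lp_norm[OF q f])
  then show "Lp_norm q f \<le> M"
    using q \<open>0 \<le> M\<close> by (smt (verit) Lp_norm_nonneg powr_less_mono2)
qed

lemma Lp_norm_mono:
  assumes q: "1 \<le> q" and [measurable]: "f \<in> borel_measurable borel" and g: "g \<in> Lp_fun q"
    and "0 \<le> c" and le: "AE x in lborel. norm (f x) \<le> c * norm (g x)"
  shows Lp_fun_mono: "f \<in> Lp_fun q" and Lp_norm_mono': "Lp_norm q f \<le> c * Lp_norm q g"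
proof -
  have "(\<integral>\<^sup>+x. ennreal (norm (f x) powr q) \<partial>lborel) \<le> (\<integral>\<^sup>+x. ennreal (c powr q) * ennreal (norm (g x) powr q) \<partial>lborel)"
  proof (rule nn_integral_mono_AE)
    show "AE x in lborel. ennreal (norm (f x) powr q) \<le> ennreal (c powr q) * ennreal (norm (g x) powr q)"
      using le
    proof eventually_elim
      case (elim x)
      have "norm (f x) powr q \<le> (c * norm (g x)) powr q"
        using q elim by (intro powr_mono2) auto
      then show ?case
        using \<open>0 \<le> c\<close> by (simp add: powr_mult ennreal_leI flip: ennreal_mult'')
    qed
  qed
  also have "\<dots> = ennreal ((c * Lp_norm q g) powr q)"
    using q g \<open>0 \<le> c\<close>
    by (subst nn_integral_cmult) (auto simp: nn_integral_Lp_norm powr_mult ennreal_mult')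
  finally have *: "(\<integral>\<^sup>+x. ennreal (norm (f x) powr q) \<partial>lborel) \<le> ennreal ((c * Lp_norm q g) powr q)" .
  show "f \<in> Lp_fun q" "Lp_norm q f \<le> c * Lp_norm q g"
    using Lp_norm_le[OF q _ _ *] \<open>0 \<le> c\<close> by auto
qed

lemma Lp_norm_cong_AE:
  assumes "f \<in> borel_measurable borel" "g \<in> borel_measurable borel" "AE x in lborel. f x = g x"
  shows "Lp_norm q f = Lp_norm q g"
  unfolding Lp_norm_def using assms
  by (intro arg_cong[where f="\<lambda>x. x powr (1/q)"] integral_cong_AE) auto

text \<open>
  The graph of the convex function \<open>t \<mapsto> t powr q\<close> lies above its tangent at \<open>m\<close>; this is Young's
  inequality for \<open>x\<close> and \<open>m powr (q - 1)\<close>. The point \<open>m = 0\<close> is included.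
\<close>

lemma powr_tangent:
  fixes q x m :: real
  assumes "1 \<le> q" "0 \<le> x" "0 \<le> m"
  shows "m powr q + q * m powr (q - 1) * (x - m) \<le> x powr q"
proof -
  consider "m = 0" | "m > 0" "q = 1" | "m > 0" "q > 1" using assms by linarith
  then show ?thesis
  proof cases
    case 3
    have "x * m powr (q - 1) \<le> x powr q / q + (m powr (q - 1)) powr (q / (q - 1)) / (q / (q - 1))"
      using 3 assms by (intro Youngs_inequality) (auto simp: field_simps)
    also have "(m powr (q - 1)) powr (q / (q - 1)) = m powr q"
      using 3 by (simp add: powr_powr)
    finally have "q * (x * m powr (q - 1)) \<le> x powr q + (q - 1) * m powr q"
      using 3 by (simp add: field_simps)
    moreover have "m * m powr (q - 1) = m powr q"
      using 3 by (simp add: powr_mult_base)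
    ultimately show ?thesis
      by (simp add: algebra_simps)
  qed (use assms in auto)
qed

text \<open>
  Convexity at the point \<open>(s + t) / (a + b)\<close>, a convex combination of \<open>s / a\<close> and \<open>t / b\<close>.
  Integrating it with \<open>a\<close> and \<open>b\<close> just above the norms gives the triangle inequality.
\<close>

lemma powr_add_le_weighted:
  fixes q s t a b :: real
  assumes q: "1 \<le> q" and "0 \<le> s" "0 \<le> t" "0 < a" "0 < b"
  shows "(s + t) powr q \<le> (a + b) powr (q - 1) * (a * (s / a) powr q + b * (t / b) powr q)"
proof -
  define m where "m = (s + t) / (a + b)"
  have m: "0 \<le> m" and st: "s + t = (a + b) * m"
    using assms by (auto simp: m_def)
  have "a * (m powr q + q * m powr (q - 1) * (s / a - m))
      + b * (m powr q + q * m powr (q - 1) * (t / b - m)) \<le> a * (s / a) powr q + b * (t / b) powr q"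
    using assms m by (intro add_mono mult_left_mono powr_tangent) auto
  also have "a * (m powr q + q * m powr (q - 1) * (s / a - m))
      + b * (m powr q + q * m powr (q - 1) * (t / b - m))
      = (a + b) * m powr q + q * m powr (q - 1) * (s + t - (a + b) * m)"
    using assms by (simp add: field_simps)
  also have "\<dots> = (a + b) * m powr q"
    by (simp add: st)
  finally have "(a + b) powr (q - 1) * ((a + b) * m powr q)
      \<le> (a + b) powr (q - 1) * (a * (s / a) powr q + b * (t / b) powr q)"
    by (intro mult_left_mono) auto
  also have "(a + b) powr (q - 1) * ((a + b) * m powr q) = (a + b) powr q * m powr q"
    using assms powr_mult_base[of "a+b" "q-1"] by (simp add: mult_ac)
  also have "\<dots> = (s + t) powr q"
    using assms m by (simp add: st powr_mult)
  finally show ?thesis .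
qed

lemma Lp_norm_add:
  assumes q: "1 \<le> q" and f: "f \<in> Lp_fun q" and g: "g \<in> Lp_fun q"
  shows Lp_fun_add: "(\<lambda>x. f x + g x) \<in> Lp_fun q"
    and Lp_norm_triangle: "Lp_norm q (\<lambda>x. f x + g x) \<le> Lp_norm q f + Lp_norm q g"
proof -
  note [measurable] = f g
  \<comment> \<open>Numbers strictly above the norms can be divided by, even if a norm is zero.\<close>
  have *: "(\<lambda>x. f x + g x) \<in> Lp_fun q \<and> Lp_norm q (\<lambda>x. f x + g x) \<le> a + b"
    if a: "Lp_norm q f < a" and b: "Lp_norm q g < b" for a b
  proof -
    have pos: "0 < a" "0 < b" using a b Lp_norm_nonneg by (meson le_less_trans)+
    define c where "c = (a + b) powr (q - 1)"
    have ptw: "norm (f x + g x) powr q \<le> c * (a * (norm (f x) / a) powr q + b * (norm (g x) / b) powr q)" for x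
    proof -
      have "norm (f x + g x) powr q \<le> (norm (f x) + norm (g x)) powr q"
        using q by (intro powr_mono2 norm_triangle_ineq) auto
      also have "\<dots> \<le> c * (a * (norm (f x) / a) powr q + b * (norm (g x) / b) powr q)"
        unfolding c_def using q pos by (intro powr_add_le_weighted) auto
      finally show ?thesis .
    qed
    have int: "integrable lborel (\<lambda>x. (norm (f x) / a) powr q)" "integrable lborel (\<lambda>x. (norm (g x) / b) powr q)"
      using f g pos by (auto simp: Lp_fun_def powr_divide)
    have quot: "(LINT x|lborel. (norm (u x) / d) powr q) \<le> 1" if "Lp_norm q u < d" for d and u :: "'a \<Rightarrow> 'b"
    proof -
      have "0 < d" using that Lp_norm_nonneg by (meson le_less_trans)
      have "Lp_norm q u powr q \<le> d powr q" using q that by (intro powr_mono2) auto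
      then show ?thesis
        using \<open>0 < d\<close> by (simp add: powr_divide Lp_norm_powr[OF q])
    qed
    have "(\<integral>\<^sup>+x. ennreal (norm (f x + g x) powr q) \<partial>lborel)
      \<le> (\<integral>\<^sup>+x. ennreal (c * (a * (norm (f x) / a) powr q + b * (norm (g x) / b) powr q)) \<partial>lborel)"
      by (intro nn_integral_mono ennreal_leI ptw)
    also have "\<dots> = ennreal (LINT x|lborel. c * (a * (norm (f x) / a) powr q + b * (norm (g x) / b) powr q))"
      using int pos by (intro nn_integral_eq_integral) (auto simp: c_def)
    also have "(LINT x|lborel. c * (a * (norm (f x) / a) powr q + b * (norm (g x) / b) powr q))
       = c * (a * (LINT x|lborel. (norm (f x) / a) powr q) + b * (LINT x|lborel. (norm (g x) / b) powr q))"
      using int by simp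
    also have "ennreal \<dots> \<le> ennreal (c * (a * 1 + b * 1))"
      using pos a b by (intro ennreal_leI mult_left_mono add_mono quot) (auto simp: c_def)
    also have "c * (a * 1 + b * 1) = (a + b) powr q"
      using pos powr_mult_base[of "a+b" "q-1"] by (simp add: c_def mult_ac)
    finally show ?thesis
      using Lp_norm_le[OF q, of "\<lambda>x. f x + g x" "a + b"] pos by auto
  qed
  show "(\<lambda>x. f x + g x) \<in> Lp_fun q"
    using *[of "Lp_norm q f + 1" "Lp_norm q g + 1"] by simp
  show "Lp_norm q (\<lambda>x. f x + g x) \<le> Lp_norm q f + Lp_norm q g"
  proof (rule field_le_epsilon)
    fix e :: real assume "0 < e"
    then show "Lp_norm q (\<lambda>x. f x + g x) \<le> Lp_norm q f + Lp_norm q g + e"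
      using *[of "Lp_norm q f + e/2" "Lp_norm q g + e/2"] by simp
  qed
qed

lemma Lp_norm_mult_le:
  assumes q: "1 \<le> q" and f: "f \<in> Lp_fun q" and [measurable]: "w \<in> borel_measurable borel"
    and c: "0 \<le> c" "\<And>x. norm (w x) \<le> c"
  shows Lp_fun_mult: "(\<lambda>x. w x * f x) \<in> Lp_fun q"
    and Lp_norm_mult: "Lp_norm q (\<lambda>x. w x * f x) \<le> c * Lp_norm q f"
proof -
  note [measurable] = f
  have *: "AE x in lborel. norm (w x * f x) \<le> c * norm (f x)"
    by (simp add: norm_mult mult_right_mono c)
  show "(\<lambda>x. w x * f x) \<in> Lp_fun q" "Lp_norm q (\<lambda>x. w x * f x) \<le> c * Lp_norm q f"
    using Lp_norm_mono[OF q _ f c(1) *] by auto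
qed

lemma Lp_scaleR:
  assumes q: "1 \<le> q" and f: "f \<in> Lp_fun q"
  shows Lp_fun_scaleR: "(\<lambda>x. c *\<^sub>R f x) \<in> Lp_fun q"
    and Lp_norm_scaleR: "Lp_norm q (\<lambda>x. c *\<^sub>R f x) = \<bar>c\<bar> * Lp_norm q f"
  using q f by (auto simp: Lp_fun_def Lp_norm_def powr_mult powr_powr)

lemma Lp_uminus:
  shows Lp_norm_uminus: "Lp_norm q (\<lambda>x. - f x) = Lp_norm q f"
    and Lp_fun_uminus: "f \<in> Lp_fun q \<Longrightarrow> (\<lambda>x. - f x) \<in> Lp_fun q"
  by (auto simp: Lp_fun_def Lp_norm_def)

lemma Lp_norm_minus_commute: "Lp_norm q (\<lambda>x. f x - g x) = Lp_norm q (\<lambda>x. g x - f x)"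
  by (simp add: Lp_norm_def norm_minus_commute)

lemma Lp_fun_diff:
  assumes "1 \<le> q" "f \<in> Lp_fun q" "g \<in> Lp_fun q"
  shows "(\<lambda>x. f x - g x) \<in> Lp_fun q"
  using Lp_fun_add[OF assms(1,2) Lp_fun_uminus[OF assms(3)]] by simp

lemma Lp_norm_diff_le:
  assumes "1 \<le> q" "f \<in> Lp_fun q" "g \<in> Lp_fun q"
  shows "Lp_norm q (\<lambda>x. f x - g x) \<le> Lp_norm q f + Lp_norm q g"
  using Lp_norm_triangle[OF assms(1,2) Lp_fun_uminus[OF assms(3)]] by (simp add: Lp_norm_uminus)

lemma Lp_norm_triangle3:
  assumes "1 \<le> q" "f \<in> Lp_fun q" "g \<in> Lp_fun q" "h \<in> Lp_fun q"
  shows "Lp_norm q (\<lambda>x. f x - h x) \<le> Lp_norm q (\<lambda>x. f x - g x) + Lp_norm q (\<lambda>x. g x - h x)"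
  using Lp_norm_triangle[OF assms(1) Lp_fun_diff[OF assms(1,2,3)] Lp_fun_diff[OF assms(1,3,4)]] by simp

lemma Lp_norm_le_add_diff:
  assumes "1 \<le> q" "f \<in> Lp_fun q" "g \<in> Lp_fun q"
  shows "Lp_norm q f \<le> Lp_norm q g + Lp_norm q (\<lambda>x. f x - g x)"
  using Lp_norm_triangle[OF assms(1,3) Lp_fun_diff[OF assms(1,2,3)]] by simp

lemma Lp_fun_zero [simp]: "(\<lambda>x. 0) \<in> Lp_fun q"
  by (simp add: Lp_fun_def)

lemma Lp_norm_zero [simp]: "Lp_norm q (\<lambda>x. 0) = 0"
  by (simp add: Lp_norm_def)

lemma Lp_norm_eq_0_iff:
  assumes q: "1 \<le> q" and f: "f \<in> Lp_fun q"
  shows "Lp_norm q f = 0 \<longleftrightarrow> (AE x in lborel. f x = 0)"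
proof -
  note [measurable] = f
  have "Lp_norm q f = 0 \<longleftrightarrow> (\<integral>\<^sup>+x. ennreal (norm (f x) powr q) \<partial>lborel) = 0"
    using q by (simp add: nn_integral_Lp_norm[OF q f] ennreal_eq_0_iff) 
  also have "\<dots> \<longleftrightarrow> (AE x in lborel. ennreal (norm (f x) powr q) = 0)"
    by (rule nn_integral_0_iff_AE) auto
  finally show ?thesis using q by simp
qed

text \<open>
  The norm is lower semicontinuous under convergence almost everywhere, by Fatou's lemma. This turns
  estimates between members of a sequence into estimates for its limit.
\<close>

lemma Lp_Fatou:
  assumes q: "1 \<le> q" and f: "\<And>n. f n \<in> Lp_fun q" and [measurable]: "F \<in> borel_measurable borel"
    and lim: "AE x in lborel. (\<lambda>n. f n x) \<longlonglongrightarrow> F x" and M: "0 \<le> M"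
    and bound: "\<forall>\<^sub>F n in sequentially. Lp_norm q (f n) \<le> M"
  shows Lp_fun_Fatou: "F \<in> Lp_fun q" and Lp_norm_Fatou: "Lp_norm q F \<le> M"
proof -
  note [measurable] = f
  have "(\<integral>\<^sup>+x. ennreal (norm (F x) powr q) \<partial>lborel)
      = (\<integral>\<^sup>+x. liminf (\<lambda>n. ennreal (norm (f n x) powr q)) \<partial>lborel)"
  proof (rule nn_integral_cong_AE)
    show "AE x in lborel. ennreal (norm (F x) powr q) = liminf (\<lambda>n. ennreal (norm (f n x) powr q))"
      using lim
    proof eventually_elim
      case (elim x)
      have "(\<lambda>n. ennreal (norm (f n x) powr q)) \<longlonglongrightarrow> ennreal (norm (F x) powr q)"
        using elim q by (intro tendsto_ennrealI tendsto_powr' tendsto_norm tendsto_const) auto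
      then show ?case
        by (intro lim_imp_Liminf[symmetric]) auto
    qed
  qed
  also have "\<dots> \<le> liminf (\<lambda>n. \<integral>\<^sup>+x. ennreal (norm (f n x) powr q) \<partial>lborel)"
    by (rule nn_integral_liminf) auto
  also have "\<dots> \<le> ennreal (M powr q)"
  proof (rule Liminf_le)
    show "\<forall>\<^sub>F n in sequentially. (\<integral>\<^sup>+x. ennreal (norm (f n x) powr q) \<partial>lborel) \<le> ennreal (M powr q)"
      using bound
    proof eventually_elim
      case (elim n)
      then show ?case
        using q by (auto simp: nn_integral_Lp_norm[OF q f] intro!: ennreal_leI powr_mono2)
    qed
  qed simp
  finally have *: "(\<integral>\<^sup>+x. ennreal (norm (F x) powr q) \<partial>lborel) \<le> ennreal (M powr q)" .
  show "F \<in> Lp_fun q" "Lp_norm q F \<le> M"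
    using Lp_norm_le[OF q _ M *] by auto
qed

lemma Lp_norm_tendsto_0_dominated:
  assumes q: "1 \<le> q" and [measurable]: "\<And>n. f n \<in> borel_measurable borel" and w: "integrable lborel w"
    and lim: "AE x in lborel. (\<lambda>n. f n x) \<longlonglongrightarrow> 0"
    and bound: "\<And>n. AE x in lborel. norm (f n x) powr q \<le> w x"
  shows "(\<lambda>n. Lp_norm q (f n)) \<longlonglongrightarrow> 0"
proof -
  have "(\<lambda>n. LINT x|lborel. norm (f n x) powr q) \<longlonglongrightarrow> (LINT x|(lborel :: 'a measure). 0)"
  proof (rule integral_dominated_convergence[OF _ _ w])
    show "AE x in lborel. (\<lambda>n. norm (f n x) powr q) \<longlonglongrightarrow> 0"
      using lim
    proof eventually_elim
      case (elim x)
      have "(\<lambda>n. norm (f n x) powr q) \<longlonglongrightarrow> 0 powr q"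
        using q tendsto_norm_zero[OF elim] by (intro tendsto_powr' tendsto_const) auto
      then show ?case using q by simp
    qed
  qed (use bound in auto)
  then have "(\<lambda>n. LINT x|lborel. norm (f n x) powr q) \<longlonglongrightarrow> 0"
    by simp
  then have "(\<lambda>n. Lp_norm q (f n)) \<longlonglongrightarrow> 0 powr (1 / q)"
    unfolding Lp_norm_def using q by (intro tendsto_powr' tendsto_const) auto
  then show ?thesis using q by simp
qed

text \<open>
  The theorem of Riesz and Fischer. A sufficiently fast subsequence converges almost everywhere, and
  Fatou's lemma carries the Cauchy estimate over to the limit.
\<close>

lemma Lp_complete:
  fixes f :: "nat \<Rightarrow> 'a::euclidean_space \<Rightarrow> 'b::{real_normed_field,euclidean_space}"
  assumes q: "1 \<le> q" and f: "\<And>n. f n \<in> Lp_fun q"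
    and cauchy: "\<And>e. 0 < e \<Longrightarrow> \<exists>N. \<forall>m\<ge>N. \<forall>n\<ge>N. Lp_norm q (\<lambda>x. f m x - f n x) < e"
  obtains F where "F \<in> Lp_fun q" "(\<lambda>n. Lp_norm q (\<lambda>x. f n x - F x)) \<longlonglongrightarrow> 0"
proof -
  note [measurable] = f
  have "\<exists>r. \<forall>n. (\<forall>m\<ge>r n. \<forall>k\<ge>r n. Lp_norm q (\<lambda>x. f m x - f k x) < (1/4) ^ n) \<and> r n < r (Suc n)"
  proof (rule dependent_nat_choice)
    show "\<exists>N. \<forall>m\<ge>N. \<forall>k\<ge>N. Lp_norm q (\<lambda>x. f m x - f k x) < (1/4) ^ 0"
      using cauchy[of 1] by simp
    fix N n
    obtain N' where "\<forall>m\<ge>N'. \<forall>k\<ge>N'. Lp_norm q (\<lambda>x. f m x - f k x) < (1/4) ^ Suc n"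
      using cauchy[of "(1/4) ^ Suc n"] by auto
    then show "\<exists>N'. (\<forall>m\<ge>N'. \<forall>k\<ge>N'. Lp_norm q (\<lambda>x. f m x - f k x) < (1/4) ^ Suc n) \<and> N < N'"
      by (intro exI[of _ "max N' (Suc N)"]) auto
  qed
  then obtain r where r: "\<And>n m k. r n \<le> m \<Longrightarrow> r n \<le> k \<Longrightarrow> Lp_norm q (\<lambda>x. f m x - f k x) < (1/4) ^ n"
    and rS: "\<And>n. r n < r (Suc n)" by blast
  have mono: "strict_mono r" using rS by (simp add: strict_mono_Suc_iff)
  define d where "d n x = f (r (Suc n)) x - f (r n) x" for n x
  have d: "d n \<in> Lp_fun q" for n
    unfolding d_def by (intro Lp_fun_diff q f)
  have dn: "Lp_norm q (d n) < (1/4) ^ n" for n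
    unfolding d_def using rS[of n] by (intro r) auto
  note [measurable] = d
  \<comment> \<open>The rate \<open>4\<^sup>-\<^sup>n\<close> leaves room for the weight \<open>2\<^sup>n\<close>, so almost everywhere the
    increments are eventually at most \<open>2\<^sup>-\<^sup>n\<close>.\<close>
  have "(\<integral>\<^sup>+x. (\<Sum>n. ennreal ((2 ^ n * norm (d n x)) powr q)) \<partial>lborel)
      = (\<Sum>n. \<integral>\<^sup>+x. ennreal ((2 ^ n) powr q) * ennreal (norm (d n x) powr q) \<partial>lborel)"
    by (subst nn_integral_suminf) (auto simp: powr_mult ennreal_mult')
  also have "\<dots> = (\<Sum>n. ennreal ((2 ^ n * Lp_norm q (d n)) powr q))"
    by (subst nn_integral_cmult) (auto simp: nn_integral_Lp_norm[OF q d] powr_mult ennreal_mult')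
  also have "\<dots> \<le> (\<Sum>n. ennreal ((1/2) ^ n))"
  proof (intro suminf_le ennreal_leI)
    fix n
    have "(2 ^ n * Lp_norm q (d n)) powr q \<le> ((1/2) ^ n) powr q"
    proof (intro powr_mono2)
      have "2 ^ n * Lp_norm q (d n) \<le> 2 ^ n * (1/4) ^ n"
        using dn[of n] by (intro mult_left_mono) auto
      also have "\<dots> = (1/2) ^ n" by (simp flip: power_mult_distrib)
      finally show "2 ^ n * Lp_norm q (d n) \<le> (1/2) ^ n" .
    qed (use q in auto)
    also have "\<dots> \<le> ((1/2) ^ n) powr 1"
      using q by (intro powr_mono') (auto simp: power_le_one)
    finally show "(2 ^ n * Lp_norm q (d n)) powr q \<le> (1/2) ^ n" by simp
  qed auto
  also have "\<dots> < \<infinity>"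
    by (simp add: suminf_ennreal2 summable_geometric less_top)
  finally have "AE x in lborel. (\<Sum>n. ennreal ((2 ^ n * norm (d n x)) powr q)) \<noteq> \<infinity>"
    by (intro nn_integral_PInf_AE) auto
  then have conv: "AE x in lborel. convergent (\<lambda>n. f (r n) x)"
  proof eventually_elim
    case (elim x)
    then have "summable (\<lambda>n. (2 ^ n * norm (d n x)) powr q)"
      by (intro summable_suminf_not_top) auto
    then have "(\<lambda>n. (2 ^ n * norm (d n x)) powr q) \<longlonglongrightarrow> 0"
      by (rule summable_LIMSEQ_zero)
    then have "\<forall>\<^sub>F n in sequentially. (2 ^ n * norm (d n x)) powr q < 1"
      by (rule order_tendstoD) simp
    then have ev: "\<forall>\<^sub>F n in sequentially. norm (d n x) \<le> (1/2) ^ n"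
    proof eventually_elim
      case (elim n)
      then have "2 ^ n * norm (d n x) \<le> 1"
        using q ge_one_powr_ge_zero[of "2 ^ n * norm (d n x)" q] by linarith
      then show ?case by (simp add: field_simps)
    qed
    have "summable (\<lambda>n. d n x)"
      by (rule summable_comparison_test_ev[OF ev]) (simp add: summable_geometric)
    then have "convergent (\<lambda>n. \<Sum>k<n. d k x)"
      by (simp add: summable_iff_convergent)
    then have "convergent (\<lambda>n. f (r 0) x + (\<Sum>k<n. d k x))"
      by (intro convergent_add convergent_const)
    moreover have "f (r 0) x + (\<Sum>k<n. d k x) = f (r n) x" for n
      unfolding d_def by (subst sum_lessThan_telescope) simp
    ultimately show ?case by simp
  qed
  define F where "F x = lim (\<lambda>n. f (r n) x)" for x
  have [measurable]: "F \<in> borel_measurable borel"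
    unfolding F_def by measurable
  have lim: "AE x in lborel. (\<lambda>n. f (r n) x) \<longlonglongrightarrow> F x"
    using conv by eventually_elim (simp add: F_def convergent_LIMSEQ_iff)
  have close: "\<exists>N. \<forall>n\<ge>N. (\<lambda>x. f n x - F x) \<in> Lp_fun q \<and> Lp_norm q (\<lambda>x. f n x - F x) \<le> e" if "0 < e" for e
  proof -
    obtain N where N: "\<And>m n. m \<ge> N \<Longrightarrow> n \<ge> N \<Longrightarrow> Lp_norm q (\<lambda>x. f m x - f n x) < e"
      using cauchy[OF \<open>0 < e\<close>] by blast
    have "(\<lambda>x. f n x - F x) \<in> Lp_fun q \<and> Lp_norm q (\<lambda>x. f n x - F x) \<le> e" if "n \<ge> N" for n
    proof (intro conjI)
      have lim': "AE x in lborel. (\<lambda>k. f n x - f (r k) x) \<longlonglongrightarrow> f n x - F x"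
        using lim by eventually_elim (intro tendsto_intros)
      have "\<forall>\<^sub>F k in sequentially. Lp_norm q (\<lambda>x. f n x - f (r k) x) \<le> e"
        using eventually_ge_at_top[of N]
      proof eventually_elim
        case (elim k)
        then have "N \<le> r k" using seq_suble[OF mono, of k] by linarith
        then show ?case using N[OF \<open>n \<ge> N\<close>] by (simp add: less_imp_le)
      qed
      note * = Lp_Fatou[OF q Lp_fun_diff[OF q f f] _ lim' _ this]
      show "(\<lambda>x. f n x - F x) \<in> Lp_fun q" by (rule *(1)) (use \<open>0 < e\<close> in auto)
      show "Lp_norm q (\<lambda>x. f n x - F x) \<le> e" by (rule *(2)) (use \<open>0 < e\<close> in auto)
    qed
    then show ?thesis by blast
  qed
  show ?thesis
  proof
    obtain N where "(\<lambda>x. f N x - F x) \<in> Lp_fun q" using close[of 1] by auto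
    from Lp_fun_diff[OF q f[of N] this] show "F \<in> Lp_fun q" by simp
    show "(\<lambda>n. Lp_norm q (\<lambda>x. f n x - F x)) \<longlonglongrightarrow> 0"
    proof (rule LIMSEQ_I)
      fix e :: real assume "0 < e"
      then obtain N where "\<forall>n\<ge>N. Lp_norm q (\<lambda>x. f n x - F x) \<le> e / 2" using close[of "e/2"] by auto
      then show "\<exists>N. \<forall>n\<ge>N. norm (Lp_norm q (\<lambda>x. f n x - F x) - 0) < e"
        using \<open>0 < e\<close> by (intro exI[of _ N]) force
    qed
  qed
qed

text \<open>
  The factor \<open>1 - (1/2) ^ k\<close> makes the geometric bound stable under induction on \<open>k\<close>.
\<close>

lemma Lp_diff_le_geometric:
  fixes f :: "nat \<Rightarrow> 'a::euclidean_space \<Rightarrow> 'b::{real_normed_field,euclidean_space}"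
  assumes q: "1 \<le> q" and f: "\<And>n. f n \<in> Lp_fun q"
    and step: "\<And>n. Lp_norm q (\<lambda>x. f (Suc n) x - f n x) \<le> K * (1/2) ^ n"
  shows "Lp_norm q (\<lambda>x. f (n + k) x - f n x) \<le> 2 * K * (1/2) ^ n * (1 - (1/2) ^ k)"
proof (induction k)
  case (Suc k)
  have "Lp_norm q (\<lambda>x. f (n + Suc k) x - f n x)
     \<le> Lp_norm q (\<lambda>x. f (Suc (n + k)) x - f (n + k) x) + Lp_norm q (\<lambda>x. f (n + k) x - f n x)"
    using Lp_norm_triangle3[OF q f f f, of "Suc (n + k)" n "n + k"] by simp
  also have "\<dots> \<le> K * (1/2) ^ (n + k) + 2 * K * (1/2) ^ n * (1 - (1/2) ^ k)"
    by (intro add_mono step Suc)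
  also have "\<dots> = 2 * K * (1/2) ^ n * (1 - (1/2) ^ Suc k)"
    by (simp add: power_add algebra_simps)
  finally show ?case .
qed simp

lemma Lp_geometric_limit:
  fixes f :: "nat \<Rightarrow> 'a::euclidean_space \<Rightarrow> 'b::{real_normed_field,euclidean_space}"
  assumes q: "1 \<le> q" and f: "\<And>n. f n \<in> Lp_fun q"
    and step: "\<And>n. Lp_norm q (\<lambda>x. f (Suc n) x - f n x) \<le> K * (1/2) ^ n"
  obtains F where "F \<in> Lp_fun q" "(\<lambda>n. Lp_norm q (\<lambda>x. f n x - F x)) \<longlonglongrightarrow> 0"
proof (rule Lp_complete[OF q f])
  fix e :: real assume e: "0 < e"
  have K: "0 \<le> K" using order_trans[OF Lp_norm_nonneg step[of 0]] by simp
  have "(\<lambda>n. 2 * K * (1/2) ^ n) \<longlonglongrightarrow> 2 * K * 0"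
    by (intro tendsto_intros LIMSEQ_power_zero) auto
  then have "\<forall>\<^sub>F n in sequentially. 2 * K * (1/2) ^ n < e / 2"
    using e by (intro order_tendstoD) auto
  then obtain N where N: "2 * K * (1/2) ^ N < e / 2"
    by (auto simp: eventually_sequentially)
  have *: "Lp_norm q (\<lambda>x. f m x - f N x) < e / 2" if "N \<le> m" for m
  proof -
    obtain k where "m = N + k" using le_Suc_ex[OF \<open>N \<le> m\<close>] by auto
    then have "Lp_norm q (\<lambda>x. f m x - f N x) \<le> 2 * K * (1/2) ^ N * (1 - (1/2) ^ k)"
      using Lp_diff_le_geometric[OF q f step] by simp
    also have "\<dots> \<le> 2 * K * (1/2) ^ N * 1"
      using K by (intro mult_left_mono) auto
    finally show ?thesis using N by simp
  qed
  show "\<exists>N. \<forall>m\<ge>N. \<forall>n\<ge>N. Lp_norm q (\<lambda>x. f m x - f n x) < e"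
  proof (intro exI allI impI)
    fix m n assume "N \<le> m" "N \<le> n"
    then show "Lp_norm q (\<lambda>x. f m x - f n x) < e"
      using Lp_norm_triangle3[OF q f f f, of m n N] *[of m] *[of n]
      by (simp add: Lp_norm_minus_commute[of q "f N" "f n"])
  qed
qed (use that in blast)

section \<open>Relative compactness as total boundedness\<close>

definition Lp_class :: "real \<Rightarrow> ('a::euclidean_space \<Rightarrow> 'b::{real_normed_field,euclidean_space}) \<Rightarrow> ('a \<Rightarrow> 'b) set"
  where "Lp_class q f = ae_rel q `` {f}"

lemma mem_Lp_class: "g \<in> Lp_class q f \<longleftrightarrow> f \<in> Lp_fun q \<and> g \<in> Lp_fun q \<and> (AE x in lborel. f x = g x)"
  by (auto simp: Lp_class_def ae_rel_def)

lemma equiv_ae_rel: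
  "equiv (Lp_fun q) (ae_rel q :: (('a::euclidean_space \<Rightarrow> 'b::{real_normed_field,euclidean_space}) \<times> _) set)"
proof (rule equivI)
  show "(ae_rel q :: (('a \<Rightarrow> 'b) \<times> _) set) \<subseteq> Lp_fun q \<times> Lp_fun q" by (auto simp: ae_rel_def)
  show "refl_on (Lp_fun q) (ae_rel q :: (('a \<Rightarrow> 'b) \<times> _) set)" by (auto simp: ae_rel_def refl_on_def)
  show "sym (ae_rel q :: (('a \<Rightarrow> 'b) \<times> _) set)" by (auto simp: ae_rel_def intro!: symI)
  show "trans (ae_rel q :: (('a \<Rightarrow> 'b) \<times> _) set)"
  proof (rule transI)
    fix f g h :: "'a \<Rightarrow> 'b" assume "(f, g) \<in> ae_rel q" "(g, h) \<in> ae_rel q"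
    then have "f \<in> Lp_fun q" "h \<in> Lp_fun q" "AE x in lborel. f x = g x" "AE x in lborel. g x = h x"
      by (auto simp: ae_rel_def)
    moreover from this(3,4) have "AE x in lborel. f x = h x" by eventually_elim simp
    ultimately show "(f, h) \<in> ae_rel q" by (simp add: ae_rel_def)
  qed
qed

lemma Lp_class_in: "f \<in> Lp_fun q \<Longrightarrow> Lp_class q f \<in> Lp q"
  unfolding Lp_def Lp_class_def by (rule quotientI)

lemma Lp_class_cases:
  assumes "F \<in> Lp q" obtains f where "f \<in> Lp_fun q" "F = Lp_class q f"
  using assms unfolding Lp_def Lp_class_def by (auto elim: quotientE)

lemma Lp_class_eq_iff:
  assumes "f \<in> Lp_fun q" "g \<in> Lp_fun q"
  shows "Lp_class q f = Lp_class q g \<longleftrightarrow> (AE x in lborel. f x = g x)"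
  unfolding Lp_class_def using assms
  by (subst eq_equiv_class_iff[OF equiv_ae_rel]) (auto simp: ae_rel_def)

lemma Lp_dist_class:
  assumes f: "f \<in> Lp_fun q" and g: "g \<in> Lp_fun q"
  shows "Lp_dist q (Lp_class q f) (Lp_class q g) = Lp_norm q (\<lambda>x. f x - g x)"
proof -
  have *: "(SOME u. u \<in> Lp_class q v) \<in> Lp_fun q \<and> (AE x in lborel. v x = (SOME u. u \<in> Lp_class q v) x)"
    if "v \<in> Lp_fun q" for v :: "'a \<Rightarrow> 'b"
  proof -
    have "v \<in> Lp_class q v" using that by (simp add: mem_Lp_class)
    then have "(SOME u. u \<in> Lp_class q v) \<in> Lp_class q v" using some_in_eq by blast
    then show ?thesis using mem_Lp_class[of "SOME u. u \<in> Lp_class q v" q v] by blast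
  qed
  note [measurable] = f g *[OF f, THEN conjunct1] *[OF g, THEN conjunct1]
  show ?thesis
    unfolding Lp_dist_def
  proof (rule Lp_norm_cong_AE)
    show "AE x in lborel. (SOME u. u \<in> Lp_class q f) x - (SOME u. u \<in> Lp_class q g) x = f x - g x"
      using *[OF f, THEN conjunct2] *[OF g, THEN conjunct2] by eventually_elim simp
  qed auto
qed

lemma Metric_space_Lp:
  assumes q: "1 \<le> q"
  shows "Metric_space (Lp q) (Lp_dist q :: ('a::euclidean_space \<Rightarrow> 'b::{real_normed_field,euclidean_space}) set \<Rightarrow> _)"
proof
  fix F G H :: "('a \<Rightarrow> 'b) set"
  show "0 \<le> Lp_dist q F G" by (simp add: Lp_dist_def)
  show "Lp_dist q F G = Lp_dist q G F"
    unfolding Lp_dist_def by (rule Lp_norm_minus_commute)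
  assume "F \<in> Lp q" "G \<in> Lp q"
  then obtain f g where fg: "f \<in> Lp_fun q" "g \<in> Lp_fun q" "F = Lp_class q f" "G = Lp_class q g"
    by (metis Lp_class_cases)
  then show "Lp_dist q F G = 0 \<longleftrightarrow> F = G"
    by (simp add: Lp_dist_class Lp_class_eq_iff Lp_norm_eq_0_iff[OF q Lp_fun_diff[OF q]])
  assume "H \<in> Lp q"
  then obtain h where "h \<in> Lp_fun q" "H = Lp_class q h"
    by (metis Lp_class_cases)
  with fg show "Lp_dist q F H \<le> Lp_dist q F G + Lp_dist q G H"
    by (simp add: Lp_dist_class Lp_norm_triangle3[OF q])
qed

lemma mcomplete_Lp:
  assumes q: "1 \<le> q"
  shows "Metric_space.mcomplete (Lp q)
    (Lp_dist q :: ('a::euclidean_space \<Rightarrow> 'b::{real_normed_field,euclidean_space}) set \<Rightarrow> _)"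
proof -
  interpret Metric_space "Lp q" "Lp_dist q :: ('a \<Rightarrow> 'b) set \<Rightarrow> _"
    by (rule Metric_space_Lp[OF q])
  show ?thesis
    unfolding mcomplete_def
  proof (intro allI impI)
    fix \<sigma> :: "nat \<Rightarrow> ('a \<Rightarrow> 'b) set" assume \<sigma>: "MCauchy \<sigma>"
    then have "\<forall>n. \<exists>f. f \<in> Lp_fun q \<and> \<sigma> n = Lp_class q f"
      unfolding MCauchy_def by (metis Lp_class_cases range_subsetD)
    then obtain f where f: "\<And>n. f n \<in> Lp_fun q" and \<sigma>f: "\<And>n. \<sigma> n = Lp_class q (f n)"
      by metis
    obtain F where F: "F \<in> Lp_fun q" "(\<lambda>n. Lp_norm q (\<lambda>x. f n x - F x)) \<longlonglongrightarrow> 0"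
    proof (rule Lp_complete[OF q f])
      fix e :: real assume "0 < e"
      with \<sigma> obtain N where "\<forall>n n'. N \<le> n \<longrightarrow> N \<le> n' \<longrightarrow> Lp_dist q (\<sigma> n) (\<sigma> n') < e"
        by (auto simp: MCauchy_def)
      then show "\<exists>N. \<forall>m\<ge>N. \<forall>n\<ge>N. Lp_norm q (\<lambda>x. f m x - f n x) < e"
        by (auto simp: \<sigma>f Lp_dist_class f)
    qed
    have "limitin mtopology \<sigma> (Lp_class q F) sequentially"
      using F f by (simp add: limitin_metric_dist_null \<sigma>f Lp_dist_class Lp_class_in)
    then show "\<exists>x. limitin mtopology \<sigma> x sequentially" ..
  qed
qed

text \<open>
  Total boundedness for functions instead of classes. The centres range over the whole space, which
  makes the property easy to transfer along approximations and Lipschitz maps.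
\<close>

definition Lp_totally_bounded :: "real \<Rightarrow> ('a::euclidean_space \<Rightarrow> 'b::{real_normed_field,euclidean_space}) set \<Rightarrow> bool"
  where "Lp_totally_bounded q A \<longleftrightarrow> A \<subseteq> Lp_fun q \<and>
    (\<forall>e>0. \<exists>K. finite K \<and> K \<subseteq> Lp_fun q \<and> (\<forall>f\<in>A. \<exists>g\<in>K. Lp_norm q (\<lambda>x. f x - g x) < e))"

text \<open>
  The passage from classes to functions. Centres of the covering balls may lie outside the set in
  the version for functions, so in one direction they have to be moved into the set, at the price of
  doubling the radius.
\<close>

lemma mtotally_bounded_Lp_class_iff:
  fixes A :: "('a::euclidean_space \<Rightarrow> 'b::{real_normed_field,euclidean_space}) set"
  assumes q: "1 \<le> q" and A: "A \<subseteq> Lp_fun q"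
  shows "Metric_space.mtotally_bounded (Lp q) (Lp_dist q) (Lp_class q ` A) \<longleftrightarrow> Lp_totally_bounded q A"
proof -
  interpret Metric_space "Lp q" "Lp_dist q :: ('a \<Rightarrow> 'b) set \<Rightarrow> _"
    by (rule Metric_space_Lp[OF q])
  show ?thesis
  proof
    assume L: "mtotally_bounded (Lp_class q ` A)"
    show "Lp_totally_bounded q A"
      unfolding Lp_totally_bounded_def
    proof (intro conjI allI impI A)
      fix e :: real assume "0 < e"
      then obtain K where K: "finite K" "K \<subseteq> Lp_class q ` A" "Lp_class q ` A \<subseteq> (\<Union>x\<in>K. mball x e)"
        using L unfolding mtotally_bounded_def by meson
      obtain K' where K': "K' \<subseteq> A" "finite K'" "K = Lp_class q ` K'"
        using finite_subset_image[OF K(1,2)] by blast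
      have "\<exists>g\<in>K'. Lp_norm q (\<lambda>x. f x - g x) < e" if f: "f \<in> A" for f
      proof -
        obtain g where "g \<in> K'" "Lp_class q f \<in> mball (Lp_class q g) e"
          using K(3) f K'(3) by blast
        then have "Lp_norm q (\<lambda>x. g x - f x) < e"
          using f K'(1) A by (simp add: Lp_dist_class subset_iff)
        then show ?thesis
          using \<open>g \<in> K'\<close> by (auto simp: Lp_norm_minus_commute[of q f])
      qed
      then show "\<exists>K. finite K \<and> K \<subseteq> Lp_fun q \<and> (\<forall>f\<in>A. \<exists>g\<in>K. Lp_norm q (\<lambda>x. f x - g x) < e)"
        using K' A by blast
    qed
  next
    assume R: "Lp_totally_bounded q A"
    show "mtotally_bounded (Lp_class q ` A)"
      unfolding mtotally_bounded_def
    proof (intro allI impI)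
      fix e :: real assume e: "0 < e"
      then obtain K where K: "finite K" "K \<subseteq> Lp_fun q"
        "\<And>f. f \<in> A \<Longrightarrow> \<exists>g\<in>K. Lp_norm q (\<lambda>x. f x - g x) < e / 2"
        using R unfolding Lp_totally_bounded_def by (meson half_gt_zero)
      \<comment> \<open>Centres without a member of the set nearby are discarded, the others moved to such a member.\<close>
      define near where "near g f \<longleftrightarrow> f \<in> A \<and> Lp_norm q (\<lambda>x. f x - g x) < e / 2" for f g
      define c where "c g = (SOME f. near g f)" for g
      define K' where "K' = {g \<in> K. \<exists>f. near g f}"
      have c: "near g (c g)" if "g \<in> K'" for g
        using that someI_ex[of "near g"] unfolding c_def K'_def by auto
      have "\<exists>g\<in>K'. Lp_class q f \<in> mball (Lp_class q (c g)) e" if f: "f \<in> A" for f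
      proof -
        obtain g where g: "g \<in> K" "Lp_norm q (\<lambda>x. f x - g x) < e / 2" using K(3)[OF f] by blast
        then have "g \<in> K'" using f by (auto simp: K'_def near_def)
        have cg: "c g \<in> A" "Lp_norm q (\<lambda>x. c g x - g x) < e / 2"
          using c[OF \<open>g \<in> K'\<close>] by (auto simp: near_def)
        have "Lp_norm q (\<lambda>x. c g x - f x) < e"
          using Lp_norm_triangle3[OF q, of "c g" g f] cg g f A K(2)
          by (auto simp: Lp_norm_minus_commute[of q g f] subset_iff)
        then show ?thesis using \<open>g \<in> K'\<close> cg f A
          by (intro bexI[of _ g]) (auto simp: Lp_dist_class Lp_class_in subset_iff)
      qed
      then show "\<exists>K. finite K \<and> K \<subseteq> Lp_class q ` A \<and> Lp_class q ` A \<subseteq> (\<Union>x\<in>K. mball x e)"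
        using K(1) c by (intro exI[of _ "(\<lambda>g. Lp_class q (c g)) ` K'"]) (auto simp: K'_def near_def)
    qed
  qed
qed

lemma compactin_closure_iff_Lp_totally_bounded:
  fixes C :: "('a::euclidean_space \<Rightarrow> 'b::{real_normed_field,euclidean_space}) set set"
  assumes q: "1 \<le> q" and C: "C \<subseteq> Lp q"
  shows "compactin (Lp_topology q) (Lp_topology q closure_of C) \<longleftrightarrow> Lp_totally_bounded q (\<Union>C)"
proof -
  interpret Metric_space "Lp q" "Lp_dist q :: ('a \<Rightarrow> 'b) set \<Rightarrow> _"
    by (rule Metric_space_Lp[OF q])
  have sub: "\<Union>C \<subseteq> Lp_fun q"
    using C Union_quotient[OF equiv_ae_rel] unfolding Lp_def by blast
  have "C = Lp_class q ` \<Union>C"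
  proof (intro equalityI subsetI)
    fix F assume F: "F \<in> C"
    with C obtain f where f: "f \<in> Lp_fun q" "F = Lp_class q f" by (metis Lp_class_cases subsetD)
    then have "f \<in> F" by (simp add: mem_Lp_class)
    then show "F \<in> Lp_class q ` \<Union>C" using F f by blast
  next
    fix F assume "F \<in> Lp_class q ` \<Union>C"
    then obtain G f where G: "G \<in> C" "f \<in> G" "F = Lp_class q f" by blast
    with C obtain g where g: "g \<in> Lp_fun q" "G = Lp_class q g" by (metis Lp_class_cases subsetD)
    then have "f \<in> Lp_fun q" "AE x in lborel. g x = f x" using G by (auto simp: mem_Lp_class)
    then have "F = G" using g G(3) by (simp add: Lp_class_eq_iff[symmetric])
    then show "F \<in> C" using G by simp
  qed
  then have "Lp_totally_bounded q (\<Union>C) \<longleftrightarrow> mtotally_bounded C"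
    using mtotally_bounded_Lp_class_iff[OF q sub] by simp
  also have "\<dots> \<longleftrightarrow> compactin mtopology (mtopology closure_of C)"
    using mtotally_bounded_eq_compact_closure_of[OF mcomplete_Lp[OF q]] C by blast
  finally show ?thesis by (simp add: Lp_topology_def)
qed

lemma Lp_totally_boundedI_subsequence:
  fixes A :: "('a::euclidean_space \<Rightarrow> 'b::{real_normed_field,euclidean_space}) set"
  assumes q: "1 \<le> q" and A: "A \<subseteq> Lp_fun q"
    and sub: "\<And>f :: nat \<Rightarrow> 'a \<Rightarrow> 'b. (\<And>n. f n \<in> A) \<Longrightarrow> \<exists>r F. strict_mono r \<and> F \<in> Lp_fun q \<and>
                 (\<lambda>n. Lp_norm q (\<lambda>x. f (r n) x - F x)) \<longlonglongrightarrow> 0"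
  shows "Lp_totally_bounded q A"
proof -
  interpret Metric_space "Lp q" "Lp_dist q :: ('a \<Rightarrow> 'b) set \<Rightarrow> _"
    by (rule Metric_space_Lp[OF q])
  have "mtotally_bounded (Lp_class q ` A)"
    unfolding mtotally_bounded_sequentially
  proof (intro conjI allI impI)
    show "Lp_class q ` A \<subseteq> Lp q" using A Lp_class_in by blast
    fix \<sigma> :: "nat \<Rightarrow> ('a \<Rightarrow> 'b) set" assume "range \<sigma> \<subseteq> Lp_class q ` A"
    then have "\<forall>n. \<exists>f. f \<in> A \<and> \<sigma> n = Lp_class q f" by blast
    then obtain f where f: "\<And>n. f n \<in> A" and \<sigma>: "\<And>n. \<sigma> n = Lp_class q (f n)" by metis
    obtain r F where r: "strict_mono r" "F \<in> Lp_fun q" "(\<lambda>n. Lp_norm q (\<lambda>x. f (r n) x - F x)) \<longlonglongrightarrow> 0"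
      using sub[of f] f by blast
    have fp: "f n \<in> Lp_fun q" for n using f A by blast
    have "limitin mtopology (\<sigma> \<circ> r) (Lp_class q F) sequentially"
      using r(2,3) fp by (simp add: limitin_metric_dist_null \<sigma> Lp_dist_class Lp_class_in)
    then have "MCauchy (\<sigma> \<circ> r)"
      using fp by (intro convergent_imp_MCauchy) (auto simp: \<sigma> Lp_class_in)
    then show "\<exists>r. strict_mono r \<and> MCauchy (\<sigma> \<circ> r)" using r(1) by blast
  qed
  then show ?thesis using mtotally_bounded_Lp_class_iff[OF q A] by simp
qed

text \<open>
  A set that lies within any given distance of some totally bounded set is totally bounded.
\<close>

lemma Lp_totally_bounded_approx:
  assumes q: "1 \<le> q" and A: "A \<subseteq> Lp_fun q"
    and approx: "\<And>e. 0 < e \<Longrightarrow> \<exists>B. Lp_totally_bounded q B \<and> (\<forall>f\<in>A. \<exists>g\<in>B. Lp_norm q (\<lambda>x. f x - g x) \<le> e)"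
  shows "Lp_totally_bounded q A"
  unfolding Lp_totally_bounded_def
proof (intro conjI allI impI A)
  fix e :: real assume e: "0 < e"
  then obtain B where B: "Lp_totally_bounded q B" "\<And>f. f \<in> A \<Longrightarrow> \<exists>g\<in>B. Lp_norm q (\<lambda>x. f x - g x) \<le> e / 2"
    using approx[of "e/2"] by auto
  then obtain K where K: "finite K" "K \<subseteq> Lp_fun q" "\<And>f. f \<in> B \<Longrightarrow> \<exists>g\<in>K. Lp_norm q (\<lambda>x. f x - g x) < e / 2"
    using e unfolding Lp_totally_bounded_def by (meson half_gt_zero)
  have "\<exists>g\<in>K. Lp_norm q (\<lambda>x. f x - g x) < e" if f: "f \<in> A" for f
  proof -
    obtain g where g: "g \<in> B" "Lp_norm q (\<lambda>x. f x - g x) \<le> e / 2" using B(2)[OF f] by blast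
    obtain h where h: "h \<in> K" "Lp_norm q (\<lambda>x. g x - h x) < e / 2" using K(3)[OF g(1)] by blast
    have "f \<in> Lp_fun q" "g \<in> Lp_fun q" "h \<in> Lp_fun q"
      using f g h A K B(1) by (auto simp: Lp_totally_bounded_def)
    from Lp_norm_triangle3[OF q this] show ?thesis using g h by (intro bexI[of _ h]) auto
  qed
  then show "\<exists>K. finite K \<and> K \<subseteq> Lp_fun q \<and> (\<forall>f\<in>A. \<exists>g\<in>K. Lp_norm q (\<lambda>x. f x - g x) < e)"
    using K by blast
qed

lemma Lp_totally_bounded_Lipschitz_image:
  assumes TB: "Lp_totally_bounded q A"
    and T: "\<And>f. f \<in> Lp_fun q \<Longrightarrow> T f \<in> Lp_fun q"
    and lip: "\<And>f g. f \<in> Lp_fun q \<Longrightarrow> g \<in> Lp_fun q \<Longrightarrow>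
       Lp_norm q (\<lambda>x. T f x - T g x) \<le> L * Lp_norm q (\<lambda>x. f x - g x)"
  shows "Lp_totally_bounded q (T ` A)"
  unfolding Lp_totally_bounded_def
proof (intro conjI allI impI)
  have A: "A \<subseteq> Lp_fun q" using TB by (simp add: Lp_totally_bounded_def)
  then show "T ` A \<subseteq> Lp_fun q" using T by blast
  fix e :: real assume e: "0 < e"
  then have "0 < e / (\<bar>L\<bar> + 1)" by simp
  then obtain K where K: "finite K" "K \<subseteq> Lp_fun q"
     "\<And>f. f \<in> A \<Longrightarrow> \<exists>g\<in>K. Lp_norm q (\<lambda>x. f x - g x) < e / (\<bar>L\<bar> + 1)"
    using TB unfolding Lp_totally_bounded_def by meson
  have "\<exists>g\<in>T ` K. Lp_norm q (\<lambda>x. T f x - g x) < e" if f: "f \<in> A" for f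
  proof -
    obtain g where g: "g \<in> K" "Lp_norm q (\<lambda>x. f x - g x) < e / (\<bar>L\<bar> + 1)" using K(3)[OF f] by blast
    have "Lp_norm q (\<lambda>x. T f x - T g x) \<le> L * Lp_norm q (\<lambda>x. f x - g x)"
      using f g A K by (intro lip) auto
    also have "\<dots> \<le> (\<bar>L\<bar> + 1) * Lp_norm q (\<lambda>x. f x - g x)"
      by (intro mult_right_mono) auto
    also have "\<dots> < e" using g(2) by (simp add: field_simps)
    finally show ?thesis using g(1) by blast
  qed
  then show "\<exists>K. finite K \<and> K \<subseteq> Lp_fun q \<and> (\<forall>f\<in>T ` A. \<exists>g\<in>K. Lp_norm q (\<lambda>x. f x - g x) < e)"
    using K T by (intro exI[of _ "T ` K"]) blast
qed

lemma Lp_totally_bounded_imp_bounded: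
  assumes q: "1 \<le> q" and TB: "Lp_totally_bounded q A"
  obtains M where "0 < M" "\<And>f. f \<in> A \<Longrightarrow> Lp_norm q f \<le> M"
proof -
  obtain K where K: "finite K" "K \<subseteq> Lp_fun q"
     "\<And>f. f \<in> A \<Longrightarrow> \<exists>g\<in>K. Lp_norm q (\<lambda>x. f x - g x) < 1"
    using TB unfolding Lp_totally_bounded_def by (meson zero_less_one)
  have "Lp_norm q f \<le> sum (Lp_norm q) K + 1" if f: "f \<in> A" for f
  proof -
    obtain g where g: "g \<in> K" "Lp_norm q (\<lambda>x. f x - g x) < 1" using K(3)[OF f] by blast
    have "f \<in> Lp_fun q" "g \<in> Lp_fun q" using f g TB K by (auto simp: Lp_totally_bounded_def)
    from Lp_norm_le_add_diff[OF q this]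
    show ?thesis using g member_le_sum[OF g(1), of "Lp_norm q"] K(1) by auto
  qed
  moreover have "0 < sum (Lp_norm q) K + 1"
    by (simp add: add_nonneg_pos sum_nonneg)
  ultimately show ?thesis using that by blast
qed

section \<open>Convolution and the inequality of Young\<close>

text \<open>
  Jensen's inequality for \<open>t \<mapsto> t powr q\<close> and the measure with density \<open>k\<close>, whose total mass is
  arbitrary: integrate the tangent inequality at the \<open>k\<close>-mean of \<open>\<phi>\<close>.
\<close>

lemma Jensen_powr:
  fixes k \<phi> :: "'a::euclidean_space \<Rightarrow> real"
  assumes q: "1 \<le> q" and k: "integrable lborel k" "\<And>y. 0 \<le> k y"
    and [measurable]: "\<phi> \<in> borel_measurable borel" and \<phi>: "\<And>y. 0 \<le> \<phi> y"
    and int: "integrable lborel (\<lambda>y. k y * \<phi> y powr q)"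
  shows integrable_powr_imp: "integrable lborel (\<lambda>y. k y * \<phi> y)"
    and integral_powr_le: "(LINT y|lborel. k y * \<phi> y) powr q
            \<le> (LINT y|lborel. k y) powr (q - 1) * (LINT y|lborel. k y * \<phi> y powr q)"
proof -
  have [measurable]: "k \<in> borel_measurable borel" using k(1) by auto
  show int1: "integrable lborel (\<lambda>y. k y * \<phi> y)"
  proof (rule Bochner_Integration.integrable_bound)
    show "integrable lborel (\<lambda>y. k y + k y * \<phi> y powr q)"
      using k int by simp
    show "AE y in lborel. norm (k y * \<phi> y) \<le> norm (k y + k y * \<phi> y powr q)"
    proof (rule AE_I2)
      fix y
      have "\<phi> y \<le> 1 + \<phi> y powr q"
      proof (cases "\<phi> y \<le> 1")
        case True then show ?thesis by (simp add: add_increasing2)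
      next
        case False
        then have "\<phi> y powr 1 \<le> \<phi> y powr q" using q by (intro powr_mono) auto
        then show ?thesis using \<phi>[of y] by simp
      qed
      then have "k y * \<phi> y \<le> k y * (1 + \<phi> y powr q)" by (intro mult_left_mono k)
      then show "norm (k y * \<phi> y) \<le> norm (k y + k y * \<phi> y powr q)"
        using k(2)[of y] \<phi>[of y] by (simp add: algebra_simps)
    qed
  qed simp
  define K where "K = (LINT y|lborel. k y)"
  define I where "I = (LINT y|lborel. k y * \<phi> y)"
  have I0: "0 \<le> I" unfolding I_def using k \<phi> by (intro integral_nonneg_AE) auto
  have K0: "0 \<le> K" unfolding K_def using k by (intro integral_nonneg_AE) auto
  have "I powr q \<le> K powr (q - 1) * (LINT y|lborel. k y * \<phi> y powr q)"
  \<comment> \<open>For \<open>K = 0\<close> the mean is undefined, and \<open>0 powr 0 = 0\<close> occurs if \<open>q = 1\<close>.\<close>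
  proof (cases "K = 0")
    case True
    then have "AE y in lborel. k y = 0"
      using k unfolding K_def by (subst (asm) integral_nonneg_eq_0_iff_AE) auto
    then have "AE y in lborel. k y * \<phi> y = 0" by eventually_elim simp
    then have "I = 0" unfolding I_def by (simp add: integral_eq_zero_AE)
    then show ?thesis using q True by simp
  next
    case False
    then have K: "0 < K" using K0 by simp
    define m where "m = I / K"
    have m: "0 \<le> m" and Im: "I = K * m" using I0 K by (auto simp: m_def)
    have "(LINT y|lborel. m powr q * k y + q * m powr (q - 1) * (k y * \<phi> y - m * k y))
       \<le> (LINT y|lborel. k y * \<phi> y powr q)"
    proof (intro integral_mono)
      fix y
      have "k y * (m powr q + q * m powr (q - 1) * (\<phi> y - m)) \<le> k y * \<phi> y powr q"
        using q m \<phi> by (intro mult_left_mono powr_tangent k) auto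
      then show "m powr q * k y + q * m powr (q - 1) * (k y * \<phi> y - m * k y) \<le> k y * \<phi> y powr q"
        by (simp add: algebra_simps)
    qed (use k int int1 in auto)
    also have "(LINT y|lborel. m powr q * k y + q * m powr (q - 1) * (k y * \<phi> y - m * k y))
       = m powr q * K + q * m powr (q - 1) * (I - m * K)"
      using k int1 by (simp add: K_def I_def)
    also have "\<dots> = m powr q * K" by (simp add: Im)
    finally have "K powr (q - 1) * (m powr q * K) \<le> K powr (q - 1) * (LINT y|lborel. k y * \<phi> y powr q)"
      by (intro mult_left_mono) auto
    also have "K powr (q - 1) * (m powr q * K) = I powr q"
      using K m powr_mult_base[of K "q - 1"] by (simp add: Im powr_mult mult_ac)
    finally show ?thesis .
  qed
  then show "(LINT y|lborel. k y * \<phi> y) powr q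
            \<le> (LINT y|lborel. k y) powr (q - 1) * (LINT y|lborel. k y * \<phi> y powr q)"
    by (simp add: I_def K_def)
qed

text \<open>
  An integral of functions of \<open>x\<close> has norm at most the total weight times a common bound for the norms
  of the functions. Both Young's inequality and the convergence of averages are instances; in the
  second one the bound holds only for \<open>y\<close> in the support of the kernel, hence the restriction to
  \<open>k y \<noteq> 0\<close>. The proof is Jensen's inequality in \<open>y\<close> followed by the exchange of the integrals.
\<close>

lemma Minkowski_integral:
  fixes G :: "'a::euclidean_space \<Rightarrow> 'a \<Rightarrow> 'b::{real_normed_field,euclidean_space}"
    and \<phi> :: "'a \<Rightarrow> 'a \<Rightarrow> real"
  assumes q: "1 \<le> q"
    and [measurable]: "case_prod G \<in> borel_measurable (lborel \<Otimes>\<^sub>M lborel)"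
      "case_prod \<phi> \<in> borel_measurable (lborel \<Otimes>\<^sub>M lborel)"
    and k: "integrable lborel k" "\<And>y. 0 \<le> k y"
    and \<phi>: "\<And>x y. 0 \<le> \<phi> x y" and G: "\<And>x y. norm (G x y) \<le> k y * \<phi> x y" and "0 \<le> M"
    and slice: "\<And>y. k y \<noteq> 0 \<Longrightarrow> (\<integral>\<^sup>+x. ennreal (\<phi> x y powr q) \<partial>lborel) \<le> ennreal (M powr q)"
  shows Minkowski_AE_integrable: "AE x in lborel. integrable lborel (G x)"
    and Minkowski_Lp_fun: "(\<lambda>x. LINT y|lborel. G x y) \<in> Lp_fun q"
    and Minkowski_Lp_norm: "Lp_norm q (\<lambda>x. LINT y|lborel. G x y) \<le> (LINT y|lborel. k y) * M"
proof -
  have [measurable]: "k \<in> borel_measurable borel" using k(1) by auto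
  define K where "K = (LINT y|lborel. k y)"
  have K0: "0 \<le> K" unfolding K_def using k by (intro integral_nonneg_AE) auto
  have "(\<integral>\<^sup>+x. \<integral>\<^sup>+y. ennreal (k y * \<phi> x y powr q) \<partial>lborel \<partial>lborel)
      = (\<integral>\<^sup>+y. \<integral>\<^sup>+x. ennreal (k y * \<phi> x y powr q) \<partial>lborel \<partial>lborel)"
    by (intro lborel_pair.Fubini') measurable
  also have "\<dots> = (\<integral>\<^sup>+y. ennreal (k y) * (\<integral>\<^sup>+x. ennreal (\<phi> x y powr q) \<partial>lborel) \<partial>lborel)"
    by (intro nn_integral_cong) (simp add: ennreal_mult' k nn_integral_cmult)
  also have "\<dots> \<le> (\<integral>\<^sup>+y. ennreal (k y) * ennreal (M powr q) \<partial>lborel)"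
  proof (intro nn_integral_mono)
    fix y show "ennreal (k y) * (\<integral>\<^sup>+x. ennreal (\<phi> x y powr q) \<partial>lborel) \<le> ennreal (k y) * ennreal (M powr q)"
      using slice[of y] by (cases "k y = 0") (auto intro!: mult_left_mono)
  qed
  also have "\<dots> = ennreal (K * M powr q)"
    using k K0 by (simp add: nn_integral_multc nn_integral_eq_integral K_def ennreal_mult)
  finally have total: "(\<integral>\<^sup>+x. \<integral>\<^sup>+y. ennreal (k y * \<phi> x y powr q) \<partial>lborel \<partial>lborel) \<le> ennreal (K * M powr q)" .
  have "AE x in lborel. (\<integral>\<^sup>+y. ennreal (k y * \<phi> x y powr q) \<partial>lborel) \<noteq> \<infinity>"
    using le_less_trans[OF total ennreal_less_top] by (intro nn_integral_PInf_AE) auto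
  then have int: "AE x in lborel. integrable lborel (\<lambda>y. k y * \<phi> x y powr q)"
  proof eventually_elim
    case (elim x)
    then show ?case using k by (intro integrableI_bounded) (auto simp: less_top)
  qed
  have dom: "integrable lborel (G x)"
    "norm (LINT y|lborel. G x y) powr q \<le> K powr (q - 1) * (LINT y|lborel. k y * \<phi> x y powr q)"
    if "integrable lborel (\<lambda>y. k y * \<phi> x y powr q)" for x
  proof -
    note J = Jensen_powr[OF q k _ \<phi>[of x] that]
    have int1: "integrable lborel (\<lambda>y. k y * \<phi> x y)" by (rule J(1)) measurable
    show int2: "integrable lborel (G x)"
      by (rule Bochner_Integration.integrable_bound[OF int1]) (use G k \<phi> in auto)
    have "norm (LINT y|lborel. G x y) \<le> (LINT y|lborel. k y * \<phi> x y)"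
      by (rule Bochner_Integration.integral_norm_bound_integral) (use int1 int2 G in auto)
    then have "norm (LINT y|lborel. G x y) powr q \<le> (LINT y|lborel. k y * \<phi> x y) powr q"
      using q by (intro powr_mono2) auto
    also have "\<dots> \<le> K powr (q - 1) * (LINT y|lborel. k y * \<phi> x y powr q)"
      unfolding K_def by (rule J(2)) measurable
    finally show "norm (LINT y|lborel. G x y) powr q \<le> K powr (q - 1) * (LINT y|lborel. k y * \<phi> x y powr q)" .
  qed
  show "AE x in lborel. integrable lborel (G x)"
    using int by eventually_elim (rule dom(1))
  have "(\<integral>\<^sup>+x. ennreal (norm (LINT y|lborel. G x y) powr q) \<partial>lborel)
     \<le> (\<integral>\<^sup>+x. ennreal (K powr (q - 1)) * (\<integral>\<^sup>+y. ennreal (k y * \<phi> x y powr q) \<partial>lborel) \<partial>lborel)"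
  proof (rule nn_integral_mono_AE)
    show "AE x in lborel. ennreal (norm (LINT y|lborel. G x y) powr q)
       \<le> ennreal (K powr (q - 1)) * (\<integral>\<^sup>+y. ennreal (k y * \<phi> x y powr q) \<partial>lborel)"
      using int
    proof eventually_elim
      case (elim x)
      have "(\<integral>\<^sup>+y. ennreal (k y * \<phi> x y powr q) \<partial>lborel) = ennreal (LINT y|lborel. k y * \<phi> x y powr q)"
        using elim k by (intro nn_integral_eq_integral) auto
      then show ?case
        using dom(2)[OF elim] by (simp add: ennreal_leI flip: ennreal_mult')
    qed
  qed
  also have "\<dots> = ennreal (K powr (q - 1)) * (\<integral>\<^sup>+x. \<integral>\<^sup>+y. ennreal (k y * \<phi> x y powr q) \<partial>lborel \<partial>lborel)"
    by (intro nn_integral_cmult) measurable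
  also have "\<dots> \<le> ennreal (K powr (q - 1)) * ennreal (K * M powr q)"
    by (intro mult_left_mono total) auto
  also have "\<dots> = ennreal ((K * M) powr q)"
    using K0 \<open>0 \<le> M\<close> powr_mult_base[of K "q - 1"] by (simp add: powr_mult mult_ac flip: ennreal_mult')
  finally have le: "(\<integral>\<^sup>+x. ennreal (norm (LINT y|lborel. G x y) powr q) \<partial>lborel) \<le> ennreal ((K * M) powr q)" .
  note * = Lp_norm_le[OF q _ _ le]
  show "(\<lambda>x. LINT y|lborel. G x y) \<in> Lp_fun q" by (rule *(1)) (use K0 \<open>0 \<le> M\<close> in auto)
  show "Lp_norm q (\<lambda>x. LINT y|lborel. G x y) \<le> (LINT y|lborel. k y) * M"
    unfolding K_def[symmetric] by (rule *(2)) (use K0 \<open>0 \<le> M\<close> in auto)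
qed

lemma lborel_distr_reflect: "distr lborel borel (\<lambda>y. x - y) = (lborel :: 'a::euclidean_space measure)"
  by (subst (2) lborel_affine[of "-1" x]) (auto simp: density_1 one_ennreal_def[symmetric])

lemma lborel_distr_translate: "distr lborel borel (\<lambda>y. y - x) = (lborel :: 'a::euclidean_space measure)"
proof -
  have "(\<lambda>y. y - x) = (+) (- x)" by auto
  then show ?thesis using lborel_distr_plus[of "-x"] by simp
qed

lemma nn_integral_translate:
  fixes x :: "'a::euclidean_space"
  assumes "u \<in> borel_measurable borel"
  shows "(\<integral>\<^sup>+y. u (y - x) \<partial>lborel) = (\<integral>\<^sup>+y. u y \<partial>lborel)"
  by (subst (2) lborel_distr_translate[symmetric, of x]) (simp add: nn_integral_distr assms)

lemma integral_reflect:
  fixes x :: "'a::euclidean_space" and u :: "'a \<Rightarrow> 'b::euclidean_space"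
  assumes "u \<in> borel_measurable borel"
  shows "(LINT y|lborel. u (x - y)) = (LINT y|lborel. u y)"
  by (subst (2) lborel_distr_reflect[symmetric, of x]) (simp add: integral_distr assms)

lemma integral_translate:
  fixes x :: "'a::euclidean_space" and u :: "'a \<Rightarrow> 'b::euclidean_space"
  assumes "u \<in> borel_measurable borel"
  shows "(LINT y|lborel. u (y - x)) = (LINT y|lborel. u y)"
  by (subst (2) lborel_distr_translate[symmetric, of x]) (simp add: integral_distr assms)

lemma integrable_reflect:
  fixes x :: "'a::euclidean_space" and u :: "'a \<Rightarrow> 'b::euclidean_space"
  assumes "integrable lborel u"
  shows "integrable lborel (\<lambda>y. u (x - y))"
proof -
  have "integrable (distr lborel borel (\<lambda>y. x - y)) u"
    using assms by (simp add: lborel_distr_reflect)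
  then show ?thesis by (rule integrable_distr[rotated]) simp
qed

lemma AE_reflect:
  fixes x :: "'a::euclidean_space"
  assumes "AE y in lborel. P y"
  shows "AE y in lborel. P (x - y)"
proof -
  have "AE y in distr lborel borel (\<lambda>y. x - y). P y"
    using assms by (subst lborel_distr_reflect)
  then show ?thesis by (rule AE_distrD[rotated]) simp
qed

lemma Lp_norm_1: "Lp_norm 1 h = (LINT x|lborel. norm (h x))"
  by (simp add: Lp_norm_def)

lemma Lp_fun_1_iff: "h \<in> Lp_fun 1 \<longleftrightarrow> integrable lborel h"
  by (auto simp: Lp_fun_def integrable_norm_iff)

lemma convolution_commute:
  fixes h f :: "'a::euclidean_space \<Rightarrow> 'b::{real_normed_field,euclidean_space}"
  assumes [measurable]: "h \<in> borel_measurable borel" "f \<in> borel_measurable borel"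
  shows "convolution h f = convolution f h"
proof
  fix x
  have "convolution h f x = (LINT y|lborel. h (x - (x - y)) * f (x - y))"
    unfolding convolution_def by (subst integral_reflect[of "\<lambda>y. h (x - y) * f y" x]) auto
  then show "convolution h f x = convolution f h x"
    by (simp add: convolution_def mult.commute)
qed

text \<open>
  Minkowski's inequality for the translates \<open>x \<mapsto> f (x - y)\<close>, which all have the norm of \<open>f\<close>, with
  weight \<open>norm (h y)\<close>.
\<close>

lemma Young_convolution:
  fixes h f :: "'a::euclidean_space \<Rightarrow> 'b::{real_normed_field,euclidean_space}"
  assumes q: "1 \<le> q" and h: "h \<in> Lp_fun 1" and f: "f \<in> Lp_fun q"
  shows convolution_AE_integrable: "AE x in lborel. integrable lborel (\<lambda>y. h (x - y) * f y)"
    and Lp_fun_convolution: "convolution h f \<in> Lp_fun q"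
    and Lp_norm_convolution: "Lp_norm q (convolution h f) \<le> Lp_norm 1 h * Lp_norm q f"
proof -
  note [measurable] = h[THEN Lp_fun_borel] f[THEN Lp_fun_borel]
  have eq: "convolution h f x = (LINT y|lborel. h y * f (x - y))" for x
    by (subst convolution_commute) (auto simp: convolution_def mult.commute)
  have slice: "(\<integral>\<^sup>+x. ennreal (norm (f (x - y)) powr q) \<partial>lborel) \<le> ennreal (Lp_norm q f powr q)" for y
    using nn_integral_translate[of "\<lambda>x. ennreal (norm (f x) powr q)" y] nn_integral_Lp_norm[OF q f] by simp
  have k: "integrable lborel (\<lambda>y. norm (h y))" using h by (simp add: Lp_fun_1_iff)
  have meas: "(\<lambda>(x, y). h y * f (x - y)) \<in> borel_measurable (lborel \<Otimes>\<^sub>M lborel)"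
    "(\<lambda>(x, y). norm (f (x - y))) \<in> borel_measurable (lborel \<Otimes>\<^sub>M lborel)"
    by measurable
  note * = Minkowski_integral[where k = "\<lambda>y. norm (h y)" and G = "\<lambda>x y. h y * f (x - y)"
      and \<phi> = "\<lambda>x y. norm (f (x - y))" and M = "Lp_norm q f", OF q meas k]
  have "AE x in lborel. integrable lborel (\<lambda>y. h y * f (x - y))"
    by (rule *(1)) (use slice in \<open>auto simp: norm_mult\<close>)
  then show "AE x in lborel. integrable lborel (\<lambda>y. h (x - y) * f y)"
  proof eventually_elim
    case (elim x)
    from integrable_reflect[OF this, of x] show ?case by simp
  qed
  show "convolution h f \<in> Lp_fun q"
    unfolding eq[abs_def] by (rule *(2)) (use slice in \<open>auto simp: norm_mult\<close>)
  show "Lp_norm q (convolution h f) \<le> Lp_norm 1 h * Lp_norm q f"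
    unfolding eq[abs_def] Lp_norm_1 by (rule *(3)) (use slice in \<open>auto simp: norm_mult\<close>)
qed

lemma convolution_cong_AE:
  fixes h f :: "'a::euclidean_space \<Rightarrow> 'b::{real_normed_field,euclidean_space}"
  assumes [measurable]: "h \<in> borel_measurable borel" "h' \<in> borel_measurable borel"
    "f \<in> borel_measurable borel" "f' \<in> borel_measurable borel"
    and "AE x in lborel. h x = h' x" "AE x in lborel. f x = f' x"
  shows "convolution h f x = convolution h' f' x"
  unfolding convolution_def
proof (rule integral_cong_AE)
  show "AE y in lborel. h (x - y) * f y = h' (x - y) * f' y"
    using AE_reflect[OF assms(5), of x] assms(6) by eventually_elim simp
qed auto

lemma convolution_linear_right:
  fixes h f g :: "'a::euclidean_space \<Rightarrow> 'b::{real_normed_field,euclidean_space}"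
  assumes q: "1 \<le> q" and h: "h \<in> Lp_fun 1" and f: "f \<in> Lp_fun q" and g: "g \<in> Lp_fun q"
  shows "AE x in lborel. convolution h (\<lambda>x. a *\<^sub>R f x + b *\<^sub>R g x) x
           = a *\<^sub>R convolution h f x + b *\<^sub>R convolution h g x"
  using convolution_AE_integrable[OF q h f] convolution_AE_integrable[OF q h g]
  by eventually_elim (simp add: convolution_def algebra_simps)

lemma convolution_linear_left:
  fixes h k f :: "'a::euclidean_space \<Rightarrow> 'b::{real_normed_field,euclidean_space}"
  assumes q: "1 \<le> q" and h: "h \<in> Lp_fun 1" and k: "k \<in> Lp_fun 1" and f: "f \<in> Lp_fun q"
  shows "AE x in lborel. convolution (\<lambda>x. a *\<^sub>R h x + b *\<^sub>R k x) f x
           = a *\<^sub>R convolution h f x + b *\<^sub>R convolution k f x"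
  using convolution_AE_integrable[OF q h f] convolution_AE_integrable[OF q k f]
  by eventually_elim (simp add: convolution_def algebra_simps)

text \<open>
  Fubini's theorem for \<open>h (x - y) * k (y - z) * f z\<close>. Young's inequality for the absolute values shows
  that this function of \<open>(y, z)\<close> is integrable for almost every \<open>x\<close>.
\<close>

lemma convolution_assoc:
  fixes h k f :: "'a::euclidean_space \<Rightarrow> 'b::{real_normed_field,euclidean_space}"
  assumes q: "1 \<le> q" and h: "h \<in> Lp_fun 1" and k: "k \<in> Lp_fun 1" and f: "f \<in> Lp_fun q"
  shows "AE x in lborel. convolution h (convolution k f) x = convolution (convolution h k) f x"
proof -
  note [measurable] = h[THEN Lp_fun_borel] k[THEN Lp_fun_borel] f[THEN Lp_fun_borel]
  define w where "w = convolution (\<lambda>x. norm (k x)) (\<lambda>x. norm (f x))"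
  have h': "(\<lambda>x. norm (h x)) \<in> Lp_fun 1" and k': "(\<lambda>x. norm (k x)) \<in> Lp_fun 1"
    and f': "(\<lambda>x. norm (f x)) \<in> Lp_fun q"
    using h k f by (auto simp: Lp_fun_def)
  have w: "w \<in> Lp_fun q" unfolding w_def by (rule Lp_fun_convolution[OF q k' f'])
  have w0: "0 \<le> w y" for y
    unfolding w_def convolution_def by (intro integral_nonneg_AE) auto
  have inner: "AE y in lborel. (\<integral>\<^sup>+z. ennreal (norm (k (y - z)) * norm (f z)) \<partial>lborel) = ennreal (w y)"
    using convolution_AE_integrable[OF q k' f']
    by eventually_elim (simp add: w_def convolution_def nn_integral_eq_integral)
  show ?thesis
    using convolution_AE_integrable[OF q h' w]
  proof eventually_elim
    case (elim x)
    let ?G = "\<lambda>y z. h (x - y) * k (y - z) * f z"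
    have [measurable]: "case_prod ?G \<in> borel_measurable (lborel \<Otimes>\<^sub>M lborel)"
      by measurable
    have "(\<integral>\<^sup>+p. ennreal (norm (case_prod ?G p)) \<partial>(lborel \<Otimes>\<^sub>M lborel))
       = (\<integral>\<^sup>+y. \<integral>\<^sup>+z. ennreal (norm (?G y z)) \<partial>lborel \<partial>lborel)"
      by (subst lborel.nn_integral_fst[symmetric]) auto
    also have "\<dots> = (\<integral>\<^sup>+y. ennreal (norm (h (x - y))) *
         (\<integral>\<^sup>+z. ennreal (norm (k (y - z)) * norm (f z)) \<partial>lborel) \<partial>lborel)"
      by (intro nn_integral_cong) (simp add: norm_mult mult.assoc ennreal_mult' nn_integral_cmult)
    also have "\<dots> = (\<integral>\<^sup>+y. ennreal (norm (h (x - y)) * w y) \<partial>lborel)"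
    proof (rule nn_integral_cong_AE)
      show "AE y in lborel. ennreal (norm (h (x - y))) *
         (\<integral>\<^sup>+z. ennreal (norm (k (y - z)) * norm (f z)) \<partial>lborel) = ennreal (norm (h (x - y)) * w y)"
        using inner by eventually_elim (simp add: ennreal_mult')
    qed
    also have "\<dots> < \<infinity>"
      using elim w0 by (subst nn_integral_eq_integral) auto
    finally have "integrable (lborel \<Otimes>\<^sub>M lborel) (case_prod ?G)"
      by (intro integrableI_bounded) auto
    then have "(LINT z|lborel. LINT y|lborel. ?G y z) = (LINT y|lborel. LINT z|lborel. ?G y z)"
      by (rule lborel_pair.Fubini_integral)
    also have "(LINT y|lborel. LINT z|lborel. ?G y z) = convolution h (convolution k f) x"
      by (simp add: convolution_def mult.assoc)
    also have "(LINT z|lborel. LINT y|lborel. ?G y z) = convolution (convolution h k) f x"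
    proof -
      have "(LINT y|lborel. h (x - y) * k (y - z)) = convolution h k (x - z)" for z
        using integral_translate[of "\<lambda>y. h (x - z - y) * k y" z]
        by (simp add: convolution_def algebra_simps)
      then show ?thesis by (simp add: convolution_def)
    qed
    finally show ?case by simp
  qed
qed

section \<open>Density, translations and approximate identities\<close>

lemma Lp_bounded_support:
  fixes f :: "'a::euclidean_space \<Rightarrow> 'b::{real_normed_field,euclidean_space}"
  assumes q: "1 \<le> q" and [measurable]: "f \<in> borel_measurable borel" and c: "0 \<le> c"
    and bound: "\<And>x. norm x \<le> R \<Longrightarrow> norm (f x) \<le> c" and zero: "\<And>x. R < norm x \<Longrightarrow> f x = 0"
  shows Lp_fun_bounded_support: "f \<in> Lp_fun q"
    and Lp_norm_bounded_support: "Lp_norm q f \<le> c * measure lborel (cball (0::'a) R) powr (1 / q)"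
proof -
  let ?V = "measure lborel (cball (0::'a) R)"
  have "(\<integral>\<^sup>+x. ennreal (norm (f x) powr q) \<partial>lborel) \<le> (\<integral>\<^sup>+x. ennreal (c powr q) * indicator (cball (0::'a) R) x \<partial>lborel)"
  proof (rule nn_integral_mono)
    fix x :: 'a
    show "ennreal (norm (f x) powr q) \<le> ennreal (c powr q) * indicator (cball 0 R) x"
      using q bound[of x] zero[of x] by (auto simp: indicator_def intro!: ennreal_leI powr_mono2)
  qed
  also have "\<dots> = ennreal (c powr q) * emeasure lborel (cball (0::'a) R)"
    by (rule nn_integral_cmult_indicator) simp
  also have "emeasure lborel (cball (0::'a) R) = ennreal ?V"
    using emeasure_lborel_cball_finite[of "0::'a" R] by (intro emeasure_eq_ennreal_measure) auto
  also have "ennreal (c powr q) * ennreal ?V = ennreal ((c * ?V powr (1 / q)) powr q)"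
    using q c by (simp add: powr_mult powr_powr ennreal_mult')
  finally have *: "(\<integral>\<^sup>+x. ennreal (norm (f x) powr q) \<partial>lborel) \<le> ennreal ((c * ?V powr (1 / q)) powr q)" .
  show "f \<in> Lp_fun q" "Lp_norm q f \<le> c * ?V powr (1 / q)"
    using Lp_norm_le[OF q _ _ *] c by auto
qed

lemma Cc_bounded:
  fixes \<phi> :: "'a::euclidean_space \<Rightarrow> 'b::{real_normed_field,euclidean_space}"
  assumes cont: "continuous_on UNIV \<phi>" and zero: "\<And>x. R < norm x \<Longrightarrow> \<phi> x = 0"
  obtains S where "0 < S" "\<And>x. norm (\<phi> x) \<le> S"
proof -
  have "compact (\<phi> ` cball 0 R)"
    using cont by (intro compact_continuous_image) (auto intro: continuous_on_subset)
  then obtain S where S: "0 < S" "\<And>y. y \<in> \<phi> ` cball 0 R \<Longrightarrow> norm y \<le> S"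
    using compact_imp_bounded bounded_pos by metis
  have "norm (\<phi> x) \<le> S" for x
    using S zero[of x] by (cases "norm x \<le> R") auto
  then show ?thesis using S(1) that by blast
qed

lemma Cc_uniformly_continuous:
  fixes \<phi> :: "'a::euclidean_space \<Rightarrow> 'b::{real_normed_field,euclidean_space}"
  assumes cont: "continuous_on UNIV \<phi>" and zero: "\<And>x. R < norm x \<Longrightarrow> \<phi> x = 0" and e: "0 < e"
  obtains d where "0 < d" "d \<le> 1" "\<And>x y. norm (x - y) < d \<Longrightarrow> norm (\<phi> x - \<phi> y) < e"
proof -
  have "uniformly_continuous_on (cball 0 (R + 1)) \<phi>"
    using cont by (intro compact_uniformly_continuous) (auto intro: continuous_on_subset)
  then obtain d where d: "0 < d" "\<And>x y. norm x \<le> R + 1 \<Longrightarrow> norm y \<le> R + 1 \<Longrightarrow> norm (x - y) < d \<Longrightarrow> norm (\<phi> x - \<phi> y) < e"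
    using e unfolding uniformly_continuous_on_def dist_norm by (metis mem_cball_0)
  show ?thesis
  proof
    show "0 < min d 1" "min d 1 \<le> 1" using d(1) by auto
    fix x y :: 'a assume xy: "norm (x - y) < min d 1"
    show "norm (\<phi> x - \<phi> y) < e"
    proof (cases "norm x \<le> R + 1 \<and> norm y \<le> R + 1")
      case True then show ?thesis using d(2) xy by simp
    next
      case False
      then have "R < norm x" "R < norm y"
        using xy norm_triangle_ineq2[of x y] norm_triangle_ineq2[of y x] by (auto simp: norm_minus_commute)
      then show ?thesis using zero e by simp
    qed
  qed
qed

text \<open>
  Truncating \<open>f\<close> in its values and its support costs little by dominated convergence. The truncation
  is a limit almost everywhere of continuous functions; these are made uniformly bounded by a radial
  retraction and compactly supported by a cutoff, so that dominated convergence applies again.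
\<close>

lemma Lp_density_Cc:
  fixes f :: "'a::euclidean_space \<Rightarrow> 'b::{real_normed_field,euclidean_space}"
  assumes q: "1 \<le> q" and f: "f \<in> Lp_fun q" and e: "0 < e"
  obtains \<phi> R where "continuous_on UNIV \<phi>" "0 < R" "\<And>x. R < norm x \<Longrightarrow> \<phi> x = 0" "\<phi> \<in> Lp_fun q"
    "Lp_norm q (\<lambda>x. f x - \<phi> x) < e"
proof -
  note [measurable] = f[THEN Lp_fun_borel]
  define t where "t n x = indicator {x. norm x \<le> real n \<and> norm (f x) \<le> real n} x *\<^sub>R f x" for n x
  have t_meas [measurable]: "t n \<in> borel_measurable borel" for n
    unfolding t_def by measurable
  have "(\<lambda>n. Lp_norm q (\<lambda>x. f x - t n x)) \<longlonglongrightarrow> 0"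
  proof (rule Lp_norm_tendsto_0_dominated[OF q])
    show "integrable lborel (\<lambda>x. norm (f x) powr q)" using f by (simp add: Lp_fun_def)
    show "AE x in lborel. norm (f x - t n x) powr q \<le> norm (f x) powr q" for n
      using q by (auto simp: t_def indicator_def)
    show "AE x in lborel. (\<lambda>n. f x - t n x) \<longlonglongrightarrow> 0"
    proof (rule AE_I2)
      fix x
      obtain N where N: "max (norm x) (norm (f x)) \<le> real N" using real_arch_simple by blast
      have "\<forall>\<^sub>F n in sequentially. f x - t n x = 0"
        using eventually_ge_at_top[of N]
      proof eventually_elim
        case (elim n)
        then have "real N \<le> real n" by simp
        then show ?case using N by (simp add: t_def)
      qed
      then show "(\<lambda>n. f x - t n x) \<longlonglongrightarrow> 0" by (rule tendsto_eventually)
    qed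
  qed measurable
  then have "\<forall>\<^sub>F n in sequentially. Lp_norm q (\<lambda>x. f x - t n x) < e / 2 \<and> 0 < n"
    using e by (intro eventually_conj eventually_gt_at_top order_tendstoD) auto
  then obtain n where n: "Lp_norm q (\<lambda>x. f x - t n x) < e / 2" "0 < n"
    by (auto simp: eventually_sequentially)
  define N where "N = real n"
  have N: "0 < N" using n by (simp add: N_def)
  define F where "F = t n"
  have [measurable]: "F \<in> borel_measurable borel" unfolding F_def by measurable
  have FN: "norm (F x) \<le> N" and F0: "N < norm x \<Longrightarrow> F x = 0" for x
    by (auto simp: F_def t_def N_def indicator_def)
  have "F measurable_on UNIV"
    by (rule lebesgue_measurable_imp_measurable_on) (auto intro: measurable_completion)
  then obtain Z g where Z: "negligible Z" and g: "\<And>m. continuous_on UNIV (g m)"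
    and lim: "\<And>x. x \<notin> Z \<Longrightarrow> (\<lambda>m. g m x) \<longlonglongrightarrow> F x"
    unfolding measurable_on_def by auto
  have "AE x in lebesgue. x \<notin> Z"
    using Z by (simp add: negligible_iff_null_sets AE_not_in)
  then have AEZ: "AE x in lborel. x \<notin> Z"
    by (simp add: AE_completion_iff)
  \<comment> \<open>The radial retraction onto the ball of radius \<open>N\<close>.\<close>
  define ret where "ret y = (N / max N (norm y)) *\<^sub>R y" for y :: 'b
  have ret_cont: "continuous_on UNIV ret"
    unfolding ret_def using N by (intro continuous_intros) auto
  have ret_norm: "norm (ret y) \<le> N" for y
    using N by (auto simp: ret_def field_simps max_def)
  have ret_id: "ret y = y" if "norm y \<le> N" for y
    using N that by (simp add: ret_def max_def)
  have ret_0: "ret 0 = 0" by (simp add: ret_def)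
  define cut where "cut x = max 0 (min 1 (N + 1 - norm x))" for x :: 'a
  have cut_cont: "continuous_on UNIV cut"
    unfolding cut_def by (intro continuous_intros)
  have cut01: "0 \<le> cut x" "cut x \<le> 1" for x by (auto simp: cut_def)
  define \<psi> where "\<psi> m x = cut x *\<^sub>R ret (g m x)" for m x
  have \<psi>_cont: "continuous_on UNIV (\<psi> m)" for m
    unfolding \<psi>_def using cut_cont g[of m] continuous_on_compose2[OF ret_cont g[of m]]
    by (intro continuous_on_scaleR) auto
  have \<psi>_norm: "norm (\<psi> m x) \<le> N" for m x
    unfolding \<psi>_def using mult_mono[OF cut01(2)[of x] ret_norm[of "g m x"]] cut01[of x] N
    by simp
  have \<psi>_0: "\<psi> m x = 0" if "N + 1 < norm x" for m x
    using that by (simp add: \<psi>_def cut_def)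
  have [measurable]: "\<psi> m \<in> borel_measurable borel" for m
    using \<psi>_cont by (rule borel_measurable_continuous_onI)
  have "(\<lambda>m. Lp_norm q (\<lambda>x. F x - \<psi> m x)) \<longlonglongrightarrow> 0"
  proof (rule Lp_norm_tendsto_0_dominated[OF q])
    show "integrable lborel (\<lambda>x. (2 * N) powr q * indicator (cball (0::'a) (N + 1)) x)"
      by (intro integrable_mult_right integrable_real_indicator emeasure_bounded_finite) auto
    show "AE x in lborel. norm (F x - \<psi> m x) powr q \<le> (2 * N) powr q * indicator (cball (0::'a) (N + 1)) x" for m
    proof (rule AE_I2)
      fix x :: 'a
      have "norm (F x - \<psi> m x) \<le> 2 * N"
        using norm_triangle_ineq4[of "F x" "\<psi> m x"] FN[of x] \<psi>_norm[of m x] by linarith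
      then have "norm (F x - \<psi> m x) powr q \<le> (2 * N) powr q"
        using q by (intro powr_mono2) auto
      then show "norm (F x - \<psi> m x) powr q \<le> (2 * N) powr q * indicator (cball (0::'a) (N + 1)) x"
        using \<psi>_0[of x m] F0[of x] q by (cases "norm x \<le> N + 1") (auto simp: indicator_def)
    qed
    show "AE x in lborel. (\<lambda>m. F x - \<psi> m x) \<longlonglongrightarrow> 0"
      using AEZ
    proof eventually_elim
      case (elim x)
      have "(\<lambda>m. ret (g m x)) \<longlonglongrightarrow> ret (F x)"
        using continuous_on_tendsto_compose[OF ret_cont lim[OF elim]] by simp
      then have "(\<lambda>m. F x - \<psi> m x) \<longlonglongrightarrow> F x - cut x *\<^sub>R ret (F x)"
        unfolding \<psi>_def by (intro tendsto_intros)
      moreover have "cut x *\<^sub>R ret (F x) = F x"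
        using F0[of x] by (cases "norm x \<le> N") (auto simp: ret_id[OF FN] ret_0 cut_def)
      ultimately show ?case by simp
    qed
  qed measurable
  then have "\<forall>\<^sub>F m in sequentially. Lp_norm q (\<lambda>x. F x - \<psi> m x) < e / 2"
    using e by (intro order_tendstoD) auto
  then obtain m where m: "Lp_norm q (\<lambda>x. F x - \<psi> m x) < e / 2"
    by (auto simp: eventually_sequentially)
  have F_Lp: "F \<in> Lp_fun q"
    by (rule Lp_fun_bounded_support[OF q _ less_imp_le[OF N], of _ N]) (use FN F0 in auto)
  have \<psi>_Lp: "\<psi> m \<in> Lp_fun q"
    by (rule Lp_fun_bounded_support[OF q _ less_imp_le[OF N], of _ "N + 1"]) (use \<psi>_norm \<psi>_0 in auto)
  show ?thesis
  proof (rule that[of "\<psi> m" "N + 1"])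
    show "Lp_norm q (\<lambda>x. f x - \<psi> m x) < e"
      using Lp_norm_triangle3[OF q f F_Lp \<psi>_Lp] m n(1) by (simp add: F_def)
  qed (use \<psi>_cont \<psi>_0 \<psi>_Lp N in auto)
qed

lemma Lp_translate:
  fixes f :: "'a::euclidean_space \<Rightarrow> 'b::{real_normed_field,euclidean_space}"
  assumes q: "1 \<le> q" and f: "f \<in> Lp_fun q"
  shows Lp_fun_translate: "(\<lambda>x. f (x - y)) \<in> Lp_fun q"
    and Lp_norm_translate: "Lp_norm q (\<lambda>x. f (x - y)) \<le> Lp_norm q f"
proof -
  note [measurable] = f[THEN Lp_fun_borel]
  have "(\<integral>\<^sup>+x. ennreal (norm (f (x - y)) powr q) \<partial>lborel) \<le> ennreal (Lp_norm q f powr q)"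
    using nn_integral_translate[of "\<lambda>x. ennreal (norm (f x) powr q)" y] nn_integral_Lp_norm[OF q f] by simp
  from Lp_norm_le[OF q _ _ this]
  show "(\<lambda>x. f (x - y)) \<in> Lp_fun q" "Lp_norm q (\<lambda>x. f (x - y)) \<le> Lp_norm q f" by auto
qed

text \<open>
  Clear for a continuous function of compact support, which is uniformly continuous, and
  transferred to all of \<open>L\<^sup>q\<close> by density since translations preserve the norm.
\<close>

lemma Lp_translation_continuous:
  fixes f :: "'a::euclidean_space \<Rightarrow> 'b::{real_normed_field,euclidean_space}"
  assumes q: "1 \<le> q" and f: "f \<in> Lp_fun q" and e: "0 < e"
  obtains d where "0 < d" "\<And>y. norm y < d \<Longrightarrow> Lp_norm q (\<lambda>x. f x - f (x - y)) \<le> e"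
proof -
  obtain \<phi> R where \<phi>: "continuous_on UNIV \<phi>" "0 < R" "\<And>x. R < norm x \<Longrightarrow> \<phi> x = 0" "\<phi> \<in> Lp_fun q"
    "Lp_norm q (\<lambda>x. f x - \<phi> x) < e / 3"
    using Lp_density_Cc[OF q f, of "e / 3"] e by auto
  note [measurable] = f[THEN Lp_fun_borel] \<phi>(4)[THEN Lp_fun_borel]
  \<comment> \<open>The summand \<open>1\<close> only keeps the divisor positive.\<close>
  define W where "W = measure lborel (cball (0::'a) (R + 1)) powr (1 / q) + 1"
  have W: "0 < W" by (simp add: W_def add_nonneg_pos)
  obtain d where d: "0 < d" "d \<le> 1" "\<And>x y. norm (x - y) < d \<Longrightarrow> norm (\<phi> x - \<phi> y) < e / (3 * W)"
    using Cc_uniformly_continuous[OF \<phi>(1), where R = R and e = "e / (3 * W)"] \<phi>(3) e W by auto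
  show ?thesis
  proof (rule that[OF d(1)])
    fix y :: 'a assume y: "norm y < d"
    note T = Lp_fun_translate[OF q f, of y] Lp_fun_translate[OF q \<phi>(4), of y]
    have "Lp_norm q (\<lambda>x. \<phi> x - \<phi> (x - y)) \<le> e / (3 * W) * measure lborel (cball (0::'a) (R + 1)) powr (1 / q)"
    proof (rule Lp_norm_bounded_support[OF q])
      show "norm (\<phi> x - \<phi> (x - y)) \<le> e / (3 * W)" for x
        using d(3)[of x "x - y"] y by simp
      fix x :: 'a assume "R + 1 < norm x"
      then have "R < norm x" "R < norm (x - y)"
        using norm_triangle_ineq2[of x y] y d(2) by auto
      then show "\<phi> x - \<phi> (x - y) = 0" using \<phi>(3) by simp
    qed (use e W in auto)
    also have "\<dots> \<le> e / (3 * W) * W"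
      using e W by (intro mult_left_mono) (auto simp: W_def)
    also have "\<dots> = e / 3" using W by simp
    finally have 1: "Lp_norm q (\<lambda>x. \<phi> x - \<phi> (x - y)) \<le> e / 3" .
    have 2: "Lp_norm q (\<lambda>x. \<phi> (x - y) - f (x - y)) \<le> Lp_norm q (\<lambda>x. \<phi> x - f x)"
      using Lp_norm_translate[OF q Lp_fun_diff[OF q \<phi>(4) f], of y] by simp
    show "Lp_norm q (\<lambda>x. f x - f (x - y)) \<le> e"
      using Lp_norm_triangle3[OF q f \<phi>(4) T(1)] Lp_norm_triangle3[OF q \<phi>(4) T(2) T(1)] 1 2 \<phi>(5)
      by (simp add: Lp_norm_minus_commute[of q \<phi> f])
  qed
qed

definition ball_average :: "real \<Rightarrow> 'a::euclidean_space \<Rightarrow> 'b::{real_normed_field,euclidean_space}"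
  where "ball_average d x = of_real (indicator (ball 0 d) x / measure lborel (ball (0::'a) d))"

lemma ball_average_integrable:
  "integrable lborel (ball_average d :: 'a::euclidean_space \<Rightarrow> 'b::{real_normed_field,euclidean_space})"
proof -
  have "integrable lborel (\<lambda>x::'a. indicator (ball 0 d) x / measure lborel (ball (0::'a) d) :: real)"
    by (intro integrable_divide_zero integrable_real_indicator emeasure_bounded_finite) auto
  then have "integrable lborel (\<lambda>x::'a. of_real (indicator (ball 0 d) x / measure lborel (ball (0::'a) d)) :: 'b)"
    by (rule integrable_of_real)
  then show ?thesis by (simp add: ball_average_def[abs_def])
qed

lemma ball_average_measurable [measurable]:
  "(ball_average d :: 'a::euclidean_space \<Rightarrow> 'b::{real_normed_field,euclidean_space}) \<in> borel_measurable borel"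
  using borel_measurable_integrable[OF ball_average_integrable] by simp

lemma ball_average:
  assumes d: "0 < d"
  shows ball_average_Lp_fun: "(ball_average d :: 'a::euclidean_space \<Rightarrow> 'b::{real_normed_field,euclidean_space}) \<in> Lp_fun 1"
    and ball_average_norm: "Lp_norm 1 (ball_average d :: 'a \<Rightarrow> 'b) = 1"
    and ball_average_integral: "(LINT x|lborel. (ball_average d (x::'a) :: 'b)) = 1"
proof -
  have V: "0 < measure lborel (ball (0::'a) d)"
    using d content_ball_pos by blast
  have int: "(LINT x|lborel. indicator (ball (0::'a) d) x / measure lborel (ball (0::'a) d) :: real) = 1"
    using V by simp
  have intb: "integrable lborel (\<lambda>x. indicator (ball (0::'a) d) x / measure lborel (ball (0::'a) d) :: real)"
    by (intro integrable_divide_zero integrable_real_indicator emeasure_bounded_finite) auto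
  show "(ball_average d :: 'a \<Rightarrow> 'b) \<in> Lp_fun 1"
    by (simp add: Lp_fun_1_iff ball_average_integrable)
  show "(LINT x|lborel. (ball_average d (x::'a) :: 'b)) = 1"
    using integral_bounded_linear[OF bounded_linear_of_real[where 'a = 'b] intb]
    by (simp only: ball_average_def int of_real_1)
  have "norm (ball_average d x :: 'b) = indicator (ball (0::'a) d) x / measure lborel (ball (0::'a) d)" for x
    by (simp add: ball_average_def norm_divide)
  then show "Lp_norm 1 (ball_average d :: 'a \<Rightarrow> 'b) = 1"
    using int by (simp add: Lp_norm_1)
qed

lemma ball_average_eq_0: "d \<le> norm x \<Longrightarrow> ball_average d x = 0"
  by (simp add: ball_average_def indicator_def)

text \<open>
  The difference \<open>f - e * f\<close> is an average of the functions \<open>f - f(\<cdot> - y)\<close> over small \<open>y\<close>, so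
  Minkowski's inequality reduces the claim to the continuity of translations.
\<close>

lemma convolution_ball_average_approx:
  fixes f :: "'a::euclidean_space \<Rightarrow> 'b::{real_normed_field,euclidean_space}"
  assumes q: "1 \<le> q" and f: "f \<in> Lp_fun q" and e: "0 < e"
  obtains d where "0 < d"
    "\<And>r. 0 < r \<Longrightarrow> r \<le> d \<Longrightarrow> Lp_norm q (\<lambda>x. f x - convolution (ball_average r) f x) \<le> e"
proof -
  note [measurable] = f[THEN Lp_fun_borel]
  obtain d where d: "0 < d" "\<And>y. norm y < d \<Longrightarrow> Lp_norm q (\<lambda>x. f x - f (x - y)) \<le> e"
    using Lp_translation_continuous[OF q f e] by metis
  show ?thesis
  proof (rule that[OF d(1)])
    fix r :: real assume r: "0 < r" "r \<le> d"
    let ?b = "ball_average r :: 'a \<Rightarrow> 'b"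
    have k: "integrable lborel (\<lambda>y. norm (?b y))" by (intro integrable_norm ball_average_integrable)
    have meas: "(\<lambda>(x, y). ?b y * (f x - f (x - y))) \<in> borel_measurable (lborel \<Otimes>\<^sub>M lborel)"
      "(\<lambda>(x, y). norm (f x - f (x - y))) \<in> borel_measurable (lborel \<Otimes>\<^sub>M lborel)"
      by measurable
    have slice: "(\<integral>\<^sup>+x. ennreal (norm (f x - f (x - y)) powr q) \<partial>lborel) \<le> ennreal (e powr q)"
      if "?b y \<noteq> 0" for y
    proof -
      have "norm y < d" using that r ball_average_eq_0 by (metis le_less_linear order_less_le_trans)
      then have "Lp_norm q (\<lambda>x. f x - f (x - y)) powr q \<le> e powr q"
        using q d by (intro powr_mono2) auto
      then show ?thesis
        using nn_integral_Lp_norm[OF q Lp_fun_diff[OF q f Lp_fun_translate[OF q f]]] by (simp add: ennreal_leI)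
    qed
    note M = Minkowski_integral[where k = "\<lambda>y. norm (?b y)" and G = "\<lambda>x y. ?b y * (f x - f (x - y))"
      and \<phi> = "\<lambda>x y. norm (f x - f (x - y))" and M = e, OF q meas k]
    have "AE x in lborel. f x - convolution ?b f x = (LINT y|lborel. ?b y * (f x - f (x - y)))"
      using convolution_AE_integrable[OF q ball_average_Lp_fun[OF r(1)] f]
    proof eventually_elim
      case (elim x)
      from integrable_reflect[OF this, of x] have int: "integrable lborel (\<lambda>y. ?b y * f (x - y))" by simp
      have "convolution ?b f x = (LINT y|lborel. ?b y * f (x - y))"
        by (subst convolution_commute) (auto simp: convolution_def mult.commute)
      then show ?case
        using int ball_average_integrable[where 'a='a and 'b='b, of r]
        by (simp add: right_diff_distrib ball_average_integral[OF r(1)])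
    qed
    then have "Lp_norm q (\<lambda>x. f x - convolution ?b f x)
        = Lp_norm q (\<lambda>x. LINT y|lborel. ?b y * (f x - f (x - y)))"
      by (intro Lp_norm_cong_AE) (auto simp: convolution_def)
    also have "\<dots> \<le> (LINT y|lborel. norm (?b y)) * e"
      by (rule M(3)) (use slice e in \<open>auto simp: norm_mult\<close>)
    also have "\<dots> = e" using ball_average_norm[OF r(1), where 'a='a and 'b='b] by (simp add: Lp_norm_1)
    finally show "Lp_norm q (\<lambda>x. f x - convolution ?b f x) \<le> e" .
  qed
qed

text \<open>
  The radius for a finite net serves the whole set, because averaging is a contraction.
\<close>

lemma convolution_ball_average_approx_uniform:
  fixes A :: "('a::euclidean_space \<Rightarrow> 'b::{real_normed_field,euclidean_space}) set"
  assumes q: "1 \<le> q" and A: "Lp_totally_bounded q A" and e: "0 < e"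
  obtains d where "0 < d"
    "\<And>r f. 0 < r \<Longrightarrow> r \<le> d \<Longrightarrow> f \<in> A \<Longrightarrow> Lp_norm q (\<lambda>x. f x - convolution (ball_average r) f x) \<le> e"
proof -
  have e3: "0 < e / 3" using e by simp
  obtain K where K: "finite K" "K \<subseteq> Lp_fun q" "\<And>f. f \<in> A \<Longrightarrow> \<exists>g\<in>K. Lp_norm q (\<lambda>x. f x - g x) < e / 3"
    using A e3 unfolding Lp_totally_bounded_def by meson
  have "\<forall>g\<in>K. \<exists>d>0. \<forall>r. 0 < r \<longrightarrow> r \<le> d \<longrightarrow> Lp_norm q (\<lambda>x. g x - convolution (ball_average r) g x) \<le> e / 3"
    using convolution_ball_average_approx[OF q _ e3] K(2) by (metis subsetD)
  then obtain D where D: "\<And>g. g \<in> K \<Longrightarrow> 0 < D g"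
    "\<And>g r. g \<in> K \<Longrightarrow> 0 < r \<Longrightarrow> r \<le> D g \<Longrightarrow> Lp_norm q (\<lambda>x. g x - convolution (ball_average r) g x) \<le> e / 3"
    by metis
  define d where "d = Min (insert 1 (D ` K))"
  have d: "0 < d" "\<And>g. g \<in> K \<Longrightarrow> d \<le> D g"
    using K(1) D(1) by (auto simp: d_def)
  show ?thesis
  proof (rule that[OF d(1)])
    fix r f assume r: "0 < r" "r \<le> d" and f: "f \<in> A"
    obtain g where g: "g \<in> K" "Lp_norm q (\<lambda>x. f x - g x) < e / 3" using K(3)[OF f] by blast
    have fL: "f \<in> Lp_fun q" using f A by (auto simp: Lp_totally_bounded_def)
    have gL: "g \<in> Lp_fun q" using g K by auto
    let ?b = "ball_average r :: 'a \<Rightarrow> 'b"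
    note b = ball_average_Lp_fun[OF r(1), where 'a='a and 'b='b]
    note C = Lp_fun_convolution[OF q b fL] Lp_fun_convolution[OF q b gL]
      Lp_fun_convolution[OF q b Lp_fun_diff[OF q gL fL]]
    note [measurable] = fL[THEN Lp_fun_borel] gL[THEN Lp_fun_borel]
    have "AE x in lborel. convolution ?b (\<lambda>x. g x - f x) x = convolution ?b g x - convolution ?b f x"
      using convolution_linear_right[OF q b gL fL, of 1 "-1"] by simp
    then have "Lp_norm q (\<lambda>x. convolution ?b g x - convolution ?b f x) = Lp_norm q (convolution ?b (\<lambda>x. g x - f x))"
      using C[THEN Lp_fun_borel] by (intro Lp_norm_cong_AE) auto
    also have "\<dots> \<le> e / 3"
      using Lp_norm_convolution[OF q b Lp_fun_diff[OF q gL fL]] g(2)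
      by (simp add: ball_average_norm[OF r(1)] Lp_norm_minus_commute[of q g f])
    finally have "Lp_norm q (\<lambda>x. convolution ?b g x - convolution ?b f x) \<le> e / 3" .
    moreover have "Lp_norm q (\<lambda>x. g x - convolution ?b g x) \<le> e / 3"
      using D(2)[OF g(1) r(1)] d(2)[OF g(1)] r(2) by simp
    ultimately show "Lp_norm q (\<lambda>x. f x - convolution ?b f x) \<le> e"
      using Lp_norm_triangle3[OF q fL gL C(1)] Lp_norm_triangle3[OF q gL C(2) C(1)] g(2) by linarith
  qed
qed

section \<open>Localized convolution operators are compact\<close>

lemma C0_bounds:
  fixes g :: "'a::euclidean_space \<Rightarrow> 'b::{real_normed_field,euclidean_space}"
  assumes g: "g \<in> C0"
  shows C0_small: "0 < e \<Longrightarrow> \<exists>R>0. \<forall>x. R < norm x \<longrightarrow> norm (g x) \<le> e"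
    and C0_bounded: "\<exists>G>0. \<forall>x. norm (g x) \<le> G"
proof -
  have small: "\<exists>R>0. \<forall>x. R < norm x \<longrightarrow> norm (g x) \<le> e" if e: "0 < e" for e
  proof -
    have "\<forall>\<^sub>F x in at_infinity. dist (g x) 0 < e"
      using g e by (auto simp: C0_def tendsto_iff)
    then obtain R where "\<forall>x. R \<le> norm x \<longrightarrow> norm (g x) < e"
      by (auto simp: eventually_at_infinity)
    then show ?thesis by (intro exI[of _ "max R 1"]) (auto intro: less_imp_le)
  qed
  then show "0 < e \<Longrightarrow> \<exists>R>0. \<forall>x. R < norm x \<longrightarrow> norm (g x) \<le> e" .
  obtain R where R: "\<And>x. R < norm x \<Longrightarrow> norm (g x) \<le> 1" using small[of 1] by auto
  have "compact (g ` cball 0 R)"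
    using g by (intro compact_continuous_image) (auto simp: C0_def intro: continuous_on_subset)
  then obtain S where S: "0 < S" "\<And>y. y \<in> g ` cball 0 R \<Longrightarrow> norm y \<le> S"
    using compact_imp_bounded bounded_pos by metis
  have "norm (g x) \<le> max S 1" for x
    using S(2)[of "g x"] R[of x] by (cases "norm x \<le> R") auto
  then show "\<exists>G>0. \<forall>x. norm (g x) \<le> G" using S(1) by (intro exI[of _ "max S 1"]) auto
qed

text \<open>
  For a kernel that is both bounded and integrable this replaces Hoelder's inequality, uniformly for
  \<open>q \<ge> 1\<close>: by Jensen's inequality, integrals against \<open>f\<close> are small if the kernel is uniformly small
  and its integral stays bounded.
\<close>

lemma integral_bounded_kernel:
  fixes k f :: "'a::euclidean_space \<Rightarrow> 'b::{real_normed_field,euclidean_space}"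
  assumes q: "1 \<le> q" and k: "integrable lborel k" and S: "\<And>y. norm (k y) \<le> S"
    and K: "(LINT y|lborel. norm (k y)) \<le> K" and f: "f \<in> Lp_fun q" "Lp_norm q f \<le> 1"
  shows integrable_bounded_kernel: "integrable lborel (\<lambda>y. k y * f y)"
    and norm_integral_bounded_kernel: "norm (LINT y|lborel. k y * f y) powr q \<le> K powr (q - 1) * S"
proof -
  have [measurable]: "k \<in> borel_measurable borel" "f \<in> borel_measurable borel"
    using k f(1) by (auto simp: Lp_fun_borel)
  have S0: "0 \<le> S" using order_trans[OF norm_ge_zero S] .
  have fq: "integrable lborel (\<lambda>y. norm (f y) powr q)" using f(1) by (simp add: Lp_fun_def)
  have int: "integrable lborel (\<lambda>y. norm (k y) * norm (f y) powr q)"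
    by (rule Bochner_Integration.integrable_bound[OF integrable_mult_right[OF fq, of S]])
      (auto simp: abs_mult S0 intro!: mult_right_mono S)
  note J = Jensen_powr[OF q integrable_norm[OF k] norm_ge_zero _ norm_ge_zero int]
  have 1: "integrable lborel (\<lambda>y. norm (k y) * norm (f y))" by (rule J(1)) measurable
  show "integrable lborel (\<lambda>y. k y * f y)"
    by (rule Bochner_Integration.integrable_bound[OF 1]) (auto simp: norm_mult)
  have "norm (LINT y|lborel. k y * f y) \<le> (LINT y|lborel. norm (k y * f y))"
    by (rule integral_norm_bound)
  also have "\<dots> = (LINT y|lborel. norm (k y) * norm (f y))" by (simp add: norm_mult)
  finally have "norm (LINT y|lborel. k y * f y) powr q \<le> (LINT y|lborel. norm (k y) * norm (f y)) powr q"
    using q by (intro powr_mono2) auto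
  also have "\<dots> \<le> (LINT y|lborel. norm (k y)) powr (q - 1) * (LINT y|lborel. norm (k y) * norm (f y) powr q)"
    by (rule J(2)) measurable
  also have "\<dots> \<le> K powr (q - 1) * (S * 1)"
  proof (intro mult_mono)
    show "(LINT y|lborel. norm (k y)) powr (q - 1) \<le> K powr (q - 1)"
      using q K by (intro powr_mono2 integral_nonneg_AE) auto
    have "(LINT y|lborel. norm (k y) * norm (f y) powr q) \<le> (LINT y|lborel. S * norm (f y) powr q)"
      using int fq by (intro integral_mono mult_right_mono S) auto
    also have "\<dots> = S * Lp_norm q f powr q" by (simp add: Lp_norm_powr[OF q])
    also have "\<dots> \<le> S * 1 powr q"
      using q f(2) S0 by (intro mult_left_mono powr_mono2) auto
    finally show "(LINT y|lborel. norm (k y) * norm (f y) powr q) \<le> S * 1" by simp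
    show "0 \<le> (LINT y|lborel. norm (k y) * norm (f y) powr q)"
      by (intro integral_nonneg_AE) auto
  qed auto
  finally show "norm (LINT y|lborel. k y * f y) powr q \<le> K powr (q - 1) * S" by simp
qed

text \<open>
  The functions \<open>\<phi> * f\<close> are uniformly bounded and, as \<open>\<phi>\<close> is uniformly continuous, equicontinuous.
  Uniform convergence on a ball implies convergence in \<open>L\<^sup>q\<close> after multiplication by \<open>g\<close> and
  restriction to the ball.
\<close>

lemma Lp_totally_bounded_localized_convolution:
  fixes g \<phi> :: "'a::euclidean_space \<Rightarrow> 'b::{real_normed_field,euclidean_space}"
  assumes q: "1 \<le> q" and g: "g \<in> C0" and \<phi>: "continuous_on UNIV \<phi>"
    and zero: "\<And>x. R' < norm x \<Longrightarrow> \<phi> x = 0" and R: "0 < R"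
  shows "Lp_totally_bounded q
     ((\<lambda>f x. indicator (cball 0 R) x *\<^sub>R (g x * convolution \<phi> f x)) ` Lp_ball q)"
    (is "Lp_totally_bounded q (?T ` _)")
proof -
  have \<phi>1: "\<phi> \<in> Lp_fun 1"
  proof -
    obtain S where "0 < S" "\<And>x. norm (\<phi> x) \<le> S" using Cc_bounded[OF \<phi>, of R'] zero by metis
    then show ?thesis
      using zero borel_measurable_continuous_onI[OF \<phi>] by (intro Lp_fun_bounded_support[of 1 \<phi> S R']) auto
  qed
  have \<phi>int: "integrable lborel \<phi>" using \<phi>1 by (simp add: Lp_fun_1_iff)
  have [measurable]: "cball (0::'a) R \<in> sets borel" by simp
  have [measurable]: "\<phi> \<in> borel_measurable borel" "g \<in> borel_measurable borel"
    using \<phi> g by (auto simp: C0_def intro: borel_measurable_continuous_onI)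
  obtain S where S: "0 < S" "\<And>x. norm (\<phi> x) \<le> S" using Cc_bounded[OF \<phi>, of R'] zero by metis
  obtain G where G: "0 < G" "\<And>x. norm (g x) \<le> G" using C0_bounded[OF g] by blast
  define L where "L = Lp_norm 1 \<phi>"
  have shift: "integrable lborel (\<lambda>y. \<phi> (x - y))" "(LINT y|lborel. norm (\<phi> (x - y))) = L" for x
    using integrable_reflect[OF \<phi>int, of x] integral_reflect[of "\<lambda>y. norm (\<phi> y)" x]
    by (auto simp: L_def Lp_norm_1)
  have ball: "f \<in> Lp_fun q" "Lp_norm q f \<le> 1" if "f \<in> Lp_ball q" for f :: "'a \<Rightarrow> 'b"
    using that by (auto simp: Lp_ball_def)
  have T_Lp: "?T f \<in> Lp_fun q" if "f \<in> Lp_ball q" for f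
  proof -
    note f = ball[OF that]
    have "(\<lambda>x. (indicator (cball 0 R) x *\<^sub>R g x) * convolution \<phi> f x) \<in> Lp_fun q"
    proof (rule Lp_fun_mult[OF q Lp_fun_convolution[OF q \<phi>1 f(1)]])
      show "norm (indicator (cball 0 R) x *\<^sub>R g x) \<le> G" for x
        using G by (auto simp: indicator_def)
    qed (use G in auto)
    then show ?thesis by simp
  qed
  show ?thesis
  proof (rule Lp_totally_boundedI_subsequence[OF q])
    show "?T ` Lp_ball q \<subseteq> Lp_fun q" using T_Lp by blast
    fix F :: "nat \<Rightarrow> 'a \<Rightarrow> 'b" assume "\<And>n. F n \<in> ?T ` Lp_ball q"
    then have "\<forall>n. \<exists>f. f \<in> Lp_ball q \<and> F n = ?T f" by blast
    then obtain f where f: "\<And>n. f n \<in> Lp_ball q" and F: "\<And>n. F n = ?T (f n)" by metis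
    define u where "u n = convolution \<phi> (f n)" for n
    have u_bound: "norm (u n x) \<le> (L powr (q - 1) * S) powr (1 / q)" for n x
    proof -
      have "norm (u n x) powr q \<le> L powr (q - 1) * S"
        unfolding u_def convolution_def
        using norm_integral_bounded_kernel[OF q shift(1) S(2) _ ball[OF f]] shift(2) by simp
      then have "(norm (u n x) powr q) powr (1 / q) \<le> (L powr (q - 1) * S) powr (1 / q)"
        using q by (intro powr_mono2) auto
      then show ?thesis using q by (simp add: powr_powr)
    qed
    have u_equi: "\<exists>d>0. \<forall>n z. z \<in> cball 0 R \<and> norm (x - z) < d \<longrightarrow> norm (u n x - u n z) < e"
      if e: "0 < e" for x e
    proof -
      define W where "W = (2 * L) powr (q - 1) + 1"
      have W: "0 < W" by (simp add: W_def add_nonneg_pos)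
      define s where "s = e powr q / W"
      have s: "0 < s" using e W by (simp add: s_def)
      obtain d where d: "0 < d" "\<And>x y. norm (x - y) < d \<Longrightarrow> norm (\<phi> x - \<phi> y) < s"
        using Cc_uniformly_continuous[OF \<phi>, where R = R' and e = s] zero s by metis
      have "norm (u n x - u n z) < e" if xz: "norm (x - z) < d" for n z
      proof -
        let ?k = "\<lambda>y. \<phi> (x - y) - \<phi> (z - y)"
        have kS: "norm (?k y) \<le> s" for y
          using d(2)[of "x - y" "z - y"] xz by simp
        have kint: "integrable lborel ?k" using shift(1) by simp
        have "(LINT y|lborel. norm (?k y)) \<le> (LINT y|lborel. norm (\<phi> (x - y)) + norm (\<phi> (z - y)))"
          using kint shift(1) by (intro integral_mono norm_triangle_ineq4) auto
        also have "\<dots> = 2 * L" using shift by simp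
        finally have kL: "(LINT y|lborel. norm (?k y)) \<le> 2 * L" .
        have fint: "integrable lborel (\<lambda>y. \<phi> (w - y) * f n y)" for w
          by (rule integrable_bounded_kernel[OF q shift(1) S(2) _ ball[OF f], of _ L]) (simp add: shift(2))
        have "u n x - u n z = (LINT y|lborel. ?k y * f n y)"
          unfolding u_def convolution_def
          using fint by (simp add: left_diff_distrib)
        then have "norm (u n x - u n z) powr q \<le> (2 * L) powr (q - 1) * s"
          using norm_integral_bounded_kernel[OF q kint kS kL ball[OF f]] by simp
        also have "\<dots> < W * s" using s by (simp add: W_def)
        also have "\<dots> = e powr q" using W by (simp add: s_def)
        finally show ?thesis
          using q e by (smt (verit) powr_mono2)
      qed
      then show ?thesis using d(1) by blast
    qed
    obtain \<psi> r where \<psi>: "continuous_on (cball 0 R) \<psi>" and r: "strict_mono (r :: nat \<Rightarrow> nat)"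
      and conv: "\<And>e. 0 < e \<Longrightarrow> \<exists>N. \<forall>n x. n \<ge> N \<and> x \<in> cball 0 R \<longrightarrow> norm (u (r n) x - \<psi> x) < e"
    proof (rule Arzela_Ascoli[of "cball 0 R" u])
      show "norm (u n x) \<le> (L powr (q - 1) * S) powr (1 / q)" for n x by (rule u_bound)
    qed (use u_equi that in auto)
    define P where "P x = indicator (cball 0 R) x *\<^sub>R (g x * \<psi> x)" for x
    have "continuous_on (cball 0 R) (\<lambda>x. g x * \<psi> x)"
      using g \<psi> by (intro continuous_intros) (auto simp: C0_def intro: continuous_on_subset)
    then have [measurable]: "P \<in> borel_measurable borel"
      unfolding P_def by (intro borel_measurable_continuous_on_indicator) auto
    have FL: "F n \<in> Lp_fun q" for n using T_Lp f F by simp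
    have [measurable]: "F n \<in> borel_measurable borel" for n using FL[THEN Lp_fun_borel] .
    define V where "V = measure lborel (cball (0::'a) R) powr (1 / q) + 1"
    have V: "0 < V" by (simp add: V_def add_nonneg_pos)
    have close: "\<exists>N. \<forall>n\<ge>N. (\<lambda>x. F (r n) x - P x) \<in> Lp_fun q \<and> Lp_norm q (\<lambda>x. F (r n) x - P x) \<le> e"
      if e: "0 < e" for e
    proof -
      define s where "s = e / (G * V)"
      have s: "0 < s" using e G V by (simp add: s_def)
      obtain N where N: "\<And>n x. n \<ge> N \<Longrightarrow> x \<in> cball 0 R \<Longrightarrow> norm (u (r n) x - \<psi> x) < s"
        using conv[OF s] by blast
      have "(\<lambda>x. F (r n) x - P x) \<in> Lp_fun q \<and> Lp_norm q (\<lambda>x. F (r n) x - P x) \<le> e" if n: "n \<ge> N" for n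
      proof -
        have eq: "F (r n) x - P x = indicator (cball 0 R) x *\<^sub>R (g x * (u (r n) x - \<psi> x))" for x
          by (simp add: F P_def u_def algebra_simps)
        have b: "norm (F (r n) x - P x) \<le> G * s" if "norm x \<le> R" for x
          unfolding eq using that N[OF n, of x] G s
          by (auto simp: norm_mult intro!: mult_mono intro: less_imp_le)
        have z: "F (r n) x - P x = 0" if "R < norm x" for x
          unfolding eq using that by simp
        have *: "(\<lambda>x. F (r n) x - P x) \<in> Lp_fun q"
          by (rule Lp_fun_bounded_support[OF q, where c = "G * s" and R = R]) (use b z G s in auto)
        have "Lp_norm q (\<lambda>x. F (r n) x - P x) \<le> G * s * measure lborel (cball (0::'a) R) powr (1 / q)"
          by (rule Lp_norm_bounded_support[OF q]) (use b z G s in auto)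
        also have "\<dots> \<le> G * s * V" using G s by (intro mult_left_mono) (auto simp: V_def)
        also have "\<dots> = e" using G V by (simp add: s_def)
        finally show ?thesis using * by simp
      qed
      then show ?thesis by blast
    qed
    have "P \<in> Lp_fun q"
    proof -
      obtain N where "(\<lambda>x. F (r N) x - P x) \<in> Lp_fun q" using close[of 1] by auto
      from Lp_fun_diff[OF q FL[of "r N"] this] show ?thesis by simp
    qed
    moreover have "(\<lambda>n. Lp_norm q (\<lambda>x. F (r n) x - P x)) \<longlonglongrightarrow> 0"
    proof (rule LIMSEQ_I)
      fix e :: real assume "0 < e"
      then obtain N where "\<forall>n\<ge>N. Lp_norm q (\<lambda>x. F (r n) x - P x) \<le> e / 2" using close[of "e/2"] by auto
      then show "\<exists>N. \<forall>n\<ge>N. norm (Lp_norm q (\<lambda>x. F (r n) x - P x) - 0) < e"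
        using \<open>0 < e\<close> by (intro exI[of _ N]) force
    qed
    ultimately show "\<exists>r P. strict_mono r \<and> P \<in> Lp_fun q \<and> (\<lambda>n. Lp_norm q (\<lambda>x. F (r n) x - P x)) \<longlonglongrightarrow> 0"
      using r by blast
  qed
qed

lemma Lp_totally_bounded_multiplier_convolution:
  fixes g h :: "'a::euclidean_space \<Rightarrow> 'b::{real_normed_field,euclidean_space}"
  assumes q: "1 \<le> q" and g: "g \<in> C0" and h: "h \<in> Lp_fun 1"
  shows "Lp_totally_bounded q ((\<lambda>f x. g x * convolution h f x) ` Lp_ball q)"
proof -
  have [measurable]: "g \<in> borel_measurable borel"
    using g by (auto simp: C0_def intro: borel_measurable_continuous_onI)
  obtain G where G: "0 < G" "\<And>x. norm (g x) \<le> G" using C0_bounded[OF g] by blast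
  have ball: "f \<in> Lp_fun q" "Lp_norm q f \<le> 1" if "f \<in> Lp_ball q" for f :: "'a \<Rightarrow> 'b"
    using that by (auto simp: Lp_ball_def)
  show ?thesis
  proof (rule Lp_totally_bounded_approx[OF q])
    show "(\<lambda>f x. g x * convolution h f x) ` Lp_ball q \<subseteq> Lp_fun q"
      using G ball by (auto intro!: Lp_fun_mult[OF q, where c = G] Lp_fun_convolution[OF q h])
    fix e :: real assume e: "0 < e"
    define H where "H = Lp_norm 1 h + 1"
    have H: "0 < H" by (simp add: H_def add_nonneg_pos)
    obtain R where R: "0 < R" "\<And>x. R < norm x \<Longrightarrow> norm (g x) \<le> e / (2 * H)"
      using C0_small[OF g, of "e / (2 * H)"] e H by auto
    have "0 < e / (2 * G)" using e G by simp
    then obtain \<phi> R' where \<phi>: "continuous_on UNIV \<phi>" "\<And>x. R' < norm x \<Longrightarrow> \<phi> x = 0" "\<phi> \<in> Lp_fun 1"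
      "Lp_norm 1 (\<lambda>x. h x - \<phi> x) < e / (2 * G)"
      using Lp_density_Cc[OF order_refl h, of "e / (2 * G)"] by blast
    have [measurable]: "cball (0::'a) R \<in> sets borel" by simp
    let ?T = "\<lambda>f x. indicator (cball 0 R) x *\<^sub>R (g x * convolution \<phi> f x)"
    show "\<exists>B. Lp_totally_bounded q B \<and> (\<forall>F\<in>(\<lambda>f x. g x * convolution h f x) ` Lp_ball q.
        \<exists>P\<in>B. Lp_norm q (\<lambda>x. F x - P x) \<le> e)"
    proof (intro exI conjI ballI)
      show "Lp_totally_bounded q (?T ` Lp_ball q)"
        by (rule Lp_totally_bounded_localized_convolution[OF q g \<phi>(1,2) R(1)])
      fix F assume "F \<in> (\<lambda>f x. g x * convolution h f x) ` Lp_ball q"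
      then obtain f where f: "f \<in> Lp_ball q" "F = (\<lambda>x. g x * convolution h f x)" by blast
      note fL = ball[OF f(1)]
      note C = Lp_fun_convolution[OF q h fL(1)] Lp_fun_convolution[OF q \<phi>(3) fL(1)]
      have hphi: "(\<lambda>x. h x - \<phi> x) \<in> Lp_fun 1" by (intro Lp_fun_diff h \<phi>(3)) simp
      note C3 = Lp_fun_convolution[OF q hphi fL(1)]
      note [measurable] = C[THEN Lp_fun_borel] C3[THEN Lp_fun_borel]
      \<comment> \<open>The error splits into a part outside the ball, where \<open>g\<close> is small, and a part inside the ball,
        where the kernel is \<open>h - \<phi>\<close>.\<close>
      let ?a = "\<lambda>x. (indicator {x. R < norm x} x *\<^sub>R g x) * convolution h f x"
      let ?b = "\<lambda>x. (indicator (cball 0 R) x *\<^sub>R g x) * convolution (\<lambda>x. h x - \<phi> x) f x"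
      have wa: "norm (indicator {x. R < norm x} x *\<^sub>R g x) \<le> e / (2 * H)" for x
        using R(2)[of x] e H by (simp add: indicator_def)
      have wb: "norm (indicator (cball 0 R) x *\<^sub>R g x) \<le> G" for x
        using G by (auto simp: indicator_def)
      note mult_a = Lp_norm_mult_le[OF q C(1) _ _ wa] and mult_b = Lp_norm_mult_le[OF q C3 _ _ wb]
      have a: "?a \<in> Lp_fun q" "Lp_norm q ?a \<le> e / (2 * H) * Lp_norm q (convolution h f)"
        by (rule mult_a; use e H in simp)+
      have b: "?b \<in> Lp_fun q" "Lp_norm q ?b \<le> G * Lp_norm q (convolution (\<lambda>x. h x - \<phi> x) f)"
        by (rule mult_b; use G in simp)+
      have AE: "AE x in lborel. F x - ?T f x = ?a x + ?b x"
        using convolution_linear_left[OF q h \<phi>(3) fL(1), of 1 "-1"]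
      proof eventually_elim
        case (elim x)
        then have "convolution h f x = convolution \<phi> f x + convolution (\<lambda>x. h x - \<phi> x) f x"
          by simp
        then show ?case by (auto simp: f(2) indicator_def ring_distribs)
      qed
      have "Lp_norm q (\<lambda>x. F x - ?T f x) = Lp_norm q (\<lambda>x. ?a x + ?b x)"
        by (rule Lp_norm_cong_AE[OF _ _ AE]) (simp_all add: f(2))
      also have "\<dots> \<le> Lp_norm q ?a + Lp_norm q ?b"
        by (rule Lp_norm_triangle[OF q a(1) b(1)])
      also have "\<dots> \<le> e / (2 * H) * H + G * (e / (2 * G))"
      proof (intro add_mono order_trans[OF a(2)] order_trans[OF b(2)] mult_left_mono)
        have "Lp_norm q (convolution h f) \<le> Lp_norm 1 h * 1"
          using Lp_norm_convolution[OF q h fL(1)] mult_left_mono[OF fL(2), of "Lp_norm 1 h"] by simp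
        then show "Lp_norm q (convolution h f) \<le> H" by (simp add: H_def)
        have "Lp_norm q (convolution (\<lambda>x. h x - \<phi> x) f) \<le> Lp_norm 1 (\<lambda>x. h x - \<phi> x) * 1"
          using Lp_norm_convolution[OF q hphi fL(1)] mult_left_mono[OF fL(2), of "Lp_norm 1 (\<lambda>x. h x - \<phi> x)"] by simp
        then show "Lp_norm q (convolution (\<lambda>x. h x - \<phi> x) f) \<le> e / (2 * G)" using \<phi>(4) by simp
      qed (use e H G in auto)
      also have "\<dots> = e" using e H G by simp
      finally have "Lp_norm q (\<lambda>x. F x - ?T f x) \<le> e" .
      then show "\<exists>P\<in>?T ` Lp_ball q. Lp_norm q (\<lambda>x. F x - P x) \<le> e"
        by (rule bexI[of _ "?T f"]) (use f(1) in blast)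
    qed
  qed
qed

section \<open>Factoring out a multiplier vanishing at infinity\<close>

lemma Lp_norm_tail:
  fixes f :: "'a::euclidean_space \<Rightarrow> 'b::{real_normed_field,euclidean_space}"
  assumes q: "1 \<le> q" and f: "f \<in> Lp_fun q" and e: "0 < e"
  obtains R where "\<And>r. R \<le> r \<Longrightarrow> Lp_norm q (\<lambda>x. indicator {x. r < norm x} x *\<^sub>R f x) \<le> e"
proof -
  note [measurable] = f[THEN Lp_fun_borel]
  have "(\<lambda>n. Lp_norm q (\<lambda>x. indicator {x. real n < norm x} x *\<^sub>R f x)) \<longlonglongrightarrow> 0"
  proof (rule Lp_norm_tendsto_0_dominated[OF q])
    show "integrable lborel (\<lambda>x. norm (f x) powr q)" using f by (simp add: Lp_fun_def)
    show "AE x in lborel. norm (indicator {x. real n < norm x} x *\<^sub>R f x) powr q \<le> norm (f x) powr q" for n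
      using q by (auto simp: indicator_def)
    show "AE x in lborel. (\<lambda>n. indicator {x. real n < norm x} x *\<^sub>R f x) \<longlonglongrightarrow> 0"
    proof (rule AE_I2)
      fix x :: 'a
      obtain N where N: "norm x \<le> real N" using real_arch_simple by blast
      have "\<forall>\<^sub>F n in sequentially. indicator {x. real n < norm x} x *\<^sub>R f x = 0"
        using eventually_ge_at_top[of N]
      proof eventually_elim
        case (elim n)
        then have "real N \<le> real n" by simp
        then show ?case using N by simp
      qed
      then show "(\<lambda>n. indicator {x. real n < norm x} x *\<^sub>R f x) \<longlonglongrightarrow> 0" by (rule tendsto_eventually)
    qed
  qed measurable
  then have "\<forall>\<^sub>F n in sequentially. Lp_norm q (\<lambda>x. indicator {x. real n < norm x} x *\<^sub>R f x) < e"
    using e by (intro order_tendstoD) auto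
  then obtain n where n: "Lp_norm q (\<lambda>x. indicator {x. real n < norm x} x *\<^sub>R f x) < e"
    by (auto simp: eventually_sequentially)
  have n': "(\<lambda>x. indicator {x. real n < norm x} x *\<^sub>R f x) \<in> Lp_fun q"
    by (rule Lp_fun_mono[OF q _ f, of _ 1]) (auto simp: indicator_def)
  show ?thesis
  proof (rule that)
    fix r assume "real n \<le> r"
    then have "Lp_norm q (\<lambda>x. indicator {x. r < norm x} x *\<^sub>R f x)
       \<le> 1 * Lp_norm q (\<lambda>x. indicator {x. real n < norm x} x *\<^sub>R f x)"
      by (intro Lp_norm_mono'[OF q _ n']) (auto simp: indicator_def)
    then show "Lp_norm q (\<lambda>x. indicator {x. r < norm x} x *\<^sub>R f x) \<le> e" using n by simp
  qed
qed

lemma Lp_norm_tail_uniform: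
  fixes A :: "('a::euclidean_space \<Rightarrow> 'b::{real_normed_field,euclidean_space}) set"
  assumes q: "1 \<le> q" and A: "Lp_totally_bounded q A" and e: "0 < e"
  obtains R where "0 \<le> R"
    "\<And>r f. R \<le> r \<Longrightarrow> f \<in> A \<Longrightarrow> Lp_norm q (\<lambda>x. indicator {x. r < norm x} x *\<^sub>R f x) \<le> e"
proof -
  have e2: "0 < e / 2" using e by simp
  obtain K where K: "finite K" "K \<subseteq> Lp_fun q" "\<And>f. f \<in> A \<Longrightarrow> \<exists>g\<in>K. Lp_norm q (\<lambda>x. f x - g x) < e / 2"
    using A e2 unfolding Lp_totally_bounded_def by meson
  have "\<forall>g\<in>K. \<exists>R. \<forall>r\<ge>R. Lp_norm q (\<lambda>x. indicator {x. r < norm x} x *\<^sub>R g x) \<le> e / 2"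
    using Lp_norm_tail[OF q _ e2] K(2) by (metis subsetD)
  then obtain D where D:
    "\<And>g r. g \<in> K \<Longrightarrow> D g \<le> r \<Longrightarrow> Lp_norm q (\<lambda>x. indicator {x. r < norm x} x *\<^sub>R g x) \<le> e / 2"
    by metis
  define R where "R = Max (insert 0 (D ` K))"
  have R: "0 \<le> R" "\<And>g. g \<in> K \<Longrightarrow> D g \<le> R"
    using K(1) by (auto simp: R_def)
  show ?thesis
  proof (rule that[OF R(1)])
    fix r f assume r: "R \<le> r" and f: "f \<in> A"
    obtain g where g: "g \<in> K" "Lp_norm q (\<lambda>x. f x - g x) < e / 2" using K(3)[OF f] by blast
    have fL: "f \<in> Lp_fun q" using f A by (auto simp: Lp_totally_bounded_def)
    have gL: "g \<in> Lp_fun q" using g K by auto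
    note [measurable] = fL[THEN Lp_fun_borel] gL[THEN Lp_fun_borel]
    have c: "(\<lambda>x. indicator {x. r < norm x} x *\<^sub>R u x) \<in> Lp_fun q"
       "Lp_norm q (\<lambda>x. indicator {x. r < norm x} x *\<^sub>R u x) \<le> 1 * Lp_norm q u" if "u \<in> Lp_fun q" for u :: "'a \<Rightarrow> 'b"
    proof -
      note [measurable] = that[THEN Lp_fun_borel]
      show "(\<lambda>x. indicator {x. r < norm x} x *\<^sub>R u x) \<in> Lp_fun q"
        by (rule Lp_fun_mono[OF q _ that, of _ 1]) (auto simp: indicator_def)
      show "Lp_norm q (\<lambda>x. indicator {x. r < norm x} x *\<^sub>R u x) \<le> 1 * Lp_norm q u"
        by (rule Lp_norm_mono'[OF q _ that, of _ 1]) (auto simp: indicator_def)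
    qed
    have "Lp_norm q (\<lambda>x. indicator {x. r < norm x} x *\<^sub>R f x - indicator {x. r < norm x} x *\<^sub>R g x) \<le> e / 2"
      using c(2)[OF Lp_fun_diff[OF q fL gL]] g(2) by (simp add: scaleR_diff_right)
    moreover have "Lp_norm q (\<lambda>x. indicator {x. r < norm x} x *\<^sub>R g x) \<le> e / 2"
      using D[OF g(1)] R(2)[OF g(1)] r by simp
    ultimately show "Lp_norm q (\<lambda>x. indicator {x. r < norm x} x *\<^sub>R f x) \<le> e"
      using Lp_norm_le_add_diff[OF q c(1)[OF fL] c(1)[OF gL]] by simp
  qed
qed

text \<open>
  The function is the sum of \<open>2\<^sup>-\<^sup>k\<close> times a continuous cutoff that is \<open>1\<close> on the ball of radius \<open>R k\<close>
  and \<open>0\<close> outside the ball of radius \<open>R k + 1\<close>. The condition \<open>k \<le> R k\<close> makes these balls exhaust the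
  space, which gives positivity everywhere.
\<close>

lemma C0_decay_function:
  fixes R :: "nat \<Rightarrow> real"
  assumes R: "\<And>k. real k \<le> R k"
  obtains \<gamma> :: "'a::euclidean_space \<Rightarrow> real" where "\<gamma> \<in> C0" "\<And>x. 0 < \<gamma> x"
    "\<And>k x. norm x \<le> R k \<Longrightarrow> (1/2) ^ k \<le> \<gamma> x"
proof -
  define \<theta> where "\<theta> k x = (1/2) ^ k * max 0 (min 1 (R k + 1 - norm x))" for k and x :: 'a
  define \<gamma> where "\<gamma> x = (\<Sum>k. \<theta> k x)" for x
  have \<theta>0: "0 \<le> \<theta> k x" and \<theta>1: "\<theta> k x \<le> (1/2) ^ k" for k x
    by (auto simp: \<theta>_def intro!: mult_left_le)
  have geo: "summable (\<lambda>k. (1/2 :: real) ^ k)" by (simp add: summable_geometric)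
  have sum\<theta>: "summable (\<lambda>k. \<theta> k x)" for x
    by (rule summable_comparison_test'[OF geo, of 0]) (use \<theta>0 \<theta>1 in auto)
  have lower: "(1/2) ^ k \<le> \<gamma> x" if "norm x \<le> R k" for k x
  proof -
    have "\<theta> k x = (1/2) ^ k" using that by (simp add: \<theta>_def)
    moreover have "sum (\<lambda>k. \<theta> k x) {k} \<le> \<gamma> x"
      unfolding \<gamma>_def by (rule sum_le_suminf[OF sum\<theta>]) (use \<theta>0 in auto)
    ultimately show ?thesis by simp
  qed
  have pos: "0 < \<gamma> x" for x
  proof -
    obtain k where "norm x \<le> real k" using real_arch_simple by blast
    then have "(1/2) ^ k \<le> \<gamma> x" using R[of k] by (intro lower) linarith
    then show ?thesis using zero_less_power[of "1/2 :: real" k] by linarith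
  qed
  have unif: "uniform_limit UNIV (\<lambda>n x. \<Sum>k<n. \<theta> k x) \<gamma> sequentially"
    unfolding \<gamma>_def by (rule Weierstrass_m_test[OF _ geo]) (use \<theta>0 \<theta>1 in auto)
  have cont: "continuous_on UNIV \<gamma>"
    by (rule uniform_limit_theorem[OF _ unif])
      (auto simp: \<theta>_def intro!: always_eventually continuous_intros)
  have "(\<gamma> \<longlongrightarrow> 0) at_infinity"
  proof (rule tendstoI)
    fix e :: real assume e: "0 < e"
    then have "\<forall>\<^sub>F n in sequentially. \<forall>x\<in>UNIV. dist (\<Sum>k<n. \<theta> k x) (\<gamma> x) < e"
      using unif by (simp add: uniform_limit_iff)
    then obtain n where n: "\<And>x. dist (\<Sum>k<n. \<theta> k x) (\<gamma> x) < e"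
      by (auto simp: eventually_sequentially)
    have "dist (\<gamma> x) 0 < e" if x: "(\<Sum>k<n. \<bar>R k\<bar>) + 1 \<le> norm x" for x
    proof -
      have "\<theta> k x = 0" if "k < n" for k
      proof -
        have "\<bar>R k\<bar> \<le> (\<Sum>k<n. \<bar>R k\<bar>)" using that by (intro member_le_sum) auto
        then show ?thesis using x by (simp add: \<theta>_def)
      qed
      then have "(\<Sum>k<n. \<theta> k x) = 0" by simp
      then show ?thesis using n[of x] by (simp add: dist_commute)
    qed
    then show "\<forall>\<^sub>F x in at_infinity. dist (\<gamma> x) 0 < e"
      unfolding eventually_at_infinity by blast
  qed
  with cont have "\<gamma> \<in> C0" by (simp add: C0_def)
  then show ?thesis using that pos lower by blast
qed

text \<open>
  On the shell between \<open>R k\<close> and \<open>R (k + 1)\<close> division by \<open>g\<close> multiplies the norm by at most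
  \<open>2\<^sup>k\<^sup>+\<^sup>1\<close>, while \<open>f\<close> has norm at most \<open>4\<^sup>-\<^sup>k\<close> there. Hence the quotients are approximated,
  uniformly in \<open>f\<close>, by their restrictions to balls, and on a ball division by \<open>g\<close> is Lipschitz.
\<close>

lemma C0_factor:
  fixes A :: "('a::euclidean_space \<Rightarrow> 'b::{real_normed_field,euclidean_space}) set"
  assumes q: "1 \<le> q" and A: "Lp_totally_bounded q A"
  obtains g :: "'a \<Rightarrow> 'b" where "g \<in> C0" "\<And>x. g x \<noteq> 0" "Lp_totally_bounded q ((\<lambda>f x. f x / g x) ` A)"
proof -
  have AL: "f \<in> Lp_fun q" if "f \<in> A" for f using that A by (auto simp: Lp_totally_bounded_def)
  have "\<forall>k. \<exists>\<rho>\<ge>0. \<forall>r\<ge>\<rho>. \<forall>f\<in>A. Lp_norm q (\<lambda>x. indicator {x. r < norm x} x *\<^sub>R f x) \<le> (1/4) ^ k"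
  proof
    fix k :: nat
    obtain \<rho> where "0 \<le> \<rho>"
      "\<And>r f. \<rho> \<le> r \<Longrightarrow> f \<in> A \<Longrightarrow> Lp_norm q (\<lambda>x. indicator {x. r < norm x} x *\<^sub>R f x) \<le> (1/4) ^ k"
      using Lp_norm_tail_uniform[OF q A, of "(1/4) ^ k"] by auto
    then show "\<exists>\<rho>\<ge>0. \<forall>r\<ge>\<rho>. \<forall>f\<in>A. Lp_norm q (\<lambda>x. indicator {x. r < norm x} x *\<^sub>R f x) \<le> (1/4) ^ k"
      by blast
  qed
  then obtain \<rho> where \<rho>: "\<And>k. 0 \<le> \<rho> k"
    "\<And>k r f. \<rho> k \<le> r \<Longrightarrow> f \<in> A \<Longrightarrow> Lp_norm q (\<lambda>x. indicator {x. r < norm x} x *\<^sub>R f x) \<le> (1/4) ^ k"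
    by metis
  \<comment> \<open>Adding up the radii makes them increasing, and the summand \<open>k\<close> makes them unbounded.\<close>
  define R where "R k = real k + (\<Sum>j\<le>k. \<rho> j)" for k
  have R1: "real k \<le> R k" for k using \<rho>(1) by (simp add: R_def sum_nonneg)
  have "\<rho> k \<le> R k" for k
    using member_le_sum[of k "{..k}" \<rho>] \<rho>(1) unfolding R_def by auto
  then have tail: "Lp_norm q (\<lambda>x. indicator {x. R k < norm x} x *\<^sub>R f x) \<le> (1/4) ^ k" if "f \<in> A" for k f
    using \<rho>(2) that by blast
  have RS: "R k \<le> R (Suc k)" for k using \<rho>(1) by (simp add: R_def)
  obtain \<gamma> :: "'a \<Rightarrow> real" where \<gamma>: "\<gamma> \<in> C0" "\<And>x. 0 < \<gamma> x" "\<And>k x. norm x \<le> R k \<Longrightarrow> (1/2) ^ k \<le> \<gamma> x"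
    using C0_decay_function[OF R1] by blast
  define g where "g x = (of_real (\<gamma> x) :: 'b)" for x
  have gC0: "g \<in> C0"
    using \<gamma>(1) tendsto_of_real[of \<gamma> 0 at_infinity, where 'a = 'b]
    by (auto simp: C0_def g_def[abs_def] intro!: continuous_on_of_real)
  have g0: "g x \<noteq> 0" for x using \<gamma>(2)[of x] by (simp add: g_def)
  have ginv: "norm (inverse (g x)) \<le> 2 ^ k" if "norm x \<le> R k" for k x
  proof -
    have "inverse (\<gamma> x) \<le> inverse ((1/2) ^ k)"
      using \<gamma>(3)[OF that] by (intro le_imp_inverse_le) auto
    then show ?thesis using \<gamma>(2)[of x] by (simp add: g_def norm_inverse power_one_over)
  qed
  have [measurable]: "g \<in> borel_measurable borel"
    using gC0 by (auto simp: C0_def intro: borel_measurable_continuous_onI)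
  define T where "T k f x = (indicator {x. norm x \<le> R k} x *\<^sub>R inverse (g x)) * f x" for k f x
  have w: "norm (indicator {x. norm x \<le> R k} x *\<^sub>R inverse (g x)) \<le> 2 ^ k" for k x
    using ginv[of x k] by (simp add: indicator_def)
  have wm: "(\<lambda>x. indicator {x. norm x \<le> R k} x *\<^sub>R inverse (g x)) \<in> borel_measurable borel" for k
    by measurable
  have T_Lp: "T k f \<in> Lp_fun q" if "f \<in> Lp_fun q" for k f
    unfolding T_def by (rule Lp_fun_mult[OF q that wm _ w]) simp
  have T_step: "Lp_norm q (\<lambda>x. T (Suc k) f x - T k f x) \<le> 2 * (1/2) ^ k" if f: "f \<in> A" for f k
  proof -
    note [measurable] = AL[OF f, THEN Lp_fun_borel]
    let ?tail = "\<lambda>x. indicator {x. R k < norm x} x *\<^sub>R f x"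
    have tL: "?tail \<in> Lp_fun q"
      by (rule Lp_fun_mono[OF q _ AL[OF f], of _ 1]) (auto simp: indicator_def)
    have eq: "T (Suc k) f x - T k f x = (indicator {x. norm x \<le> R (Suc k)} x *\<^sub>R inverse (g x)) * ?tail x" for x
      using RS[of k] by (auto simp: T_def indicator_def)
    have "Lp_norm q (\<lambda>x. T (Suc k) f x - T k f x) \<le> 2 ^ Suc k * Lp_norm q ?tail"
      unfolding eq by (rule Lp_norm_mult[OF q tL wm _ w]) simp
    also have "\<dots> \<le> 2 ^ Suc k * (1/4) ^ k"
      by (intro mult_left_mono tail[OF f]) auto
    also have "\<dots> = 2 * (1/2) ^ k"
      by (simp flip: power_mult_distrib)
    finally show ?thesis .
  qed
  define v where "v f x = f x / g x" for f x
  have approx: "(\<lambda>x. v f x - T n f x) \<in> Lp_fun q" "Lp_norm q (\<lambda>x. v f x - T n f x) \<le> 4 * (1/2) ^ n"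
    if f: "f \<in> A" for f n
  proof -
    note fL = AL[OF f]
    note [measurable] = fL[THEN Lp_fun_borel] T_Lp[OF fL, THEN Lp_fun_borel]
    have meas: "(\<lambda>x. v f x - T n f x) \<in> borel_measurable borel"
      unfolding v_def by measurable
    have lim: "AE x in lborel. (\<lambda>k. T (n + k) f x - T n f x) \<longlonglongrightarrow> v f x - T n f x"
    proof (rule AE_I2)
      fix x :: 'a
      obtain N where N: "norm x \<le> real N" using real_arch_simple by blast
      have "\<forall>\<^sub>F k in sequentially. T (n + k) f x - T n f x = v f x - T n f x"
        using eventually_ge_at_top[of N]
      proof eventually_elim
        case (elim k)
        then have "norm x \<le> R (n + k)" using N R1[of "n + k"] by simp
        then show ?case by (simp add: T_def v_def divide_inverse)
      qed
      then show "(\<lambda>k. T (n + k) f x - T n f x) \<longlonglongrightarrow> v f x - T n f x" by (rule tendsto_eventually)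
    qed
    have "Lp_norm q (\<lambda>x. T (n + k) f x - T n f x) \<le> 4 * (1/2) ^ n" for k
    proof -
      have "Lp_norm q (\<lambda>x. T (n + k) f x - T n f x) \<le> 2 * 2 * (1/2) ^ n * (1 - (1/2) ^ k)"
        by (rule Lp_diff_le_geometric[OF q T_Lp[OF fL] T_step[OF f]])
      also have "\<dots> \<le> 2 * 2 * (1/2) ^ n * 1"
        by (intro mult_left_mono) auto
      finally show ?thesis by simp
    qed
    then have ev: "\<forall>\<^sub>F k in sequentially. Lp_norm q (\<lambda>x. T (n + k) f x - T n f x) \<le> 4 * (1/2) ^ n"
      by simp
    note F = Lp_Fatou[OF q Lp_fun_diff[OF q T_Lp[OF fL] T_Lp[OF fL]] meas lim _ ev]
    show "(\<lambda>x. v f x - T n f x) \<in> Lp_fun q" by (rule F(1)) simp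
    show "Lp_norm q (\<lambda>x. v f x - T n f x) \<le> 4 * (1/2) ^ n" by (rule F(2)) simp
  qed
  have "Lp_totally_bounded q (v ` A)"
  proof (rule Lp_totally_bounded_approx[OF q])
    show "v ` A \<subseteq> Lp_fun q"
    proof clarify
      fix f assume f: "f \<in> A"
      from Lp_fun_add[OF q approx(1)[OF f, of 0] T_Lp[OF AL[OF f], of 0]] show "v f \<in> Lp_fun q" by simp
    qed
    fix e :: real assume e: "0 < e"
    have "(\<lambda>n. 4 * (1/2) ^ n :: real) \<longlonglongrightarrow> 4 * 0"
      by (intro tendsto_intros LIMSEQ_power_zero) auto
    then have "\<forall>\<^sub>F n in sequentially. 4 * (1/2) ^ n < e"
      using e by (intro order_tendstoD) auto
    then obtain n where n: "4 * (1/2) ^ n < e"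
      by (auto simp: eventually_sequentially)
    show "\<exists>B. Lp_totally_bounded q B \<and> (\<forall>F\<in>v ` A. \<exists>P\<in>B. Lp_norm q (\<lambda>x. F x - P x) \<le> e)"
    proof (intro exI conjI ballI)
      show "Lp_totally_bounded q (T n ` A)"
      proof (rule Lp_totally_bounded_Lipschitz_image[OF A T_Lp])
        fix f u :: "'a \<Rightarrow> 'b" assume "f \<in> Lp_fun q" "u \<in> Lp_fun q"
        then show "Lp_norm q (\<lambda>x. T n f x - T n u x) \<le> 2 ^ n * Lp_norm q (\<lambda>x. f x - u x)"
          using Lp_norm_mult[OF q Lp_fun_diff[OF q] wm _ w, of f u n]
          by (simp add: T_def right_diff_distrib)
      qed
      fix F assume "F \<in> v ` A"
      then obtain f where f: "f \<in> A" "F = v f" by blast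
      have "Lp_norm q (\<lambda>x. F x - T n f x) \<le> e"
        using approx(2)[OF f(1), of n] n f(2) by simp
      then show "\<exists>P\<in>T n ` A. Lp_norm q (\<lambda>x. F x - P x) \<le> e" using f(1) by blast
    qed
  qed
  then show ?thesis using that[OF gC0 g0] by (simp add: v_def[abs_def])
qed

section \<open>Factoring out a convolution with an integrable kernel\<close>

lemma Lp_norm_convolution_minus:
  fixes h k f :: "'a::euclidean_space \<Rightarrow> 'b::{real_normed_field,euclidean_space}"
  assumes q: "1 \<le> q"
  shows Lp_norm_convolution_diff_right:
      "h \<in> Lp_fun 1 \<Longrightarrow> f \<in> Lp_fun q \<Longrightarrow> f' \<in> Lp_fun q \<Longrightarrow>
       Lp_norm q (\<lambda>x. convolution h f x - convolution h f' x) \<le> Lp_norm 1 h * Lp_norm q (\<lambda>x. f x - f' x)"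
    and Lp_norm_convolution_diff_left:
      "h \<in> Lp_fun 1 \<Longrightarrow> h' \<in> Lp_fun 1 \<Longrightarrow> f \<in> Lp_fun q \<Longrightarrow>
       Lp_norm q (\<lambda>x. convolution h f x - convolution h' f x) \<le> Lp_norm 1 (\<lambda>x. h x - h' x) * Lp_norm q f"
proof -
  assume h: "h \<in> Lp_fun 1"
  {
    assume f: "f \<in> Lp_fun q" "f' \<in> Lp_fun q"
    note C = Lp_fun_convolution[OF q h f(1)] Lp_fun_convolution[OF q h f(2)]
      Lp_fun_convolution[OF q h Lp_fun_diff[OF q f]]
    have "AE x in lborel. convolution h f x - convolution h f' x = convolution h (\<lambda>x. f x - f' x) x"
      using convolution_linear_right[OF q h f, of 1 "-1"] by eventually_elim simp
    then have "Lp_norm q (\<lambda>x. convolution h f x - convolution h f' x) = Lp_norm q (convolution h (\<lambda>x. f x - f' x))"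
      using C[THEN Lp_fun_borel] by (intro Lp_norm_cong_AE) auto
    then show "Lp_norm q (\<lambda>x. convolution h f x - convolution h f' x) \<le> Lp_norm 1 h * Lp_norm q (\<lambda>x. f x - f' x)"
      using Lp_norm_convolution[OF q h Lp_fun_diff[OF q f]] by simp
  next
    assume h': "h' \<in> Lp_fun 1" and f: "f \<in> Lp_fun q"
    note d = Lp_fun_diff[OF order_refl h h']
    note C = Lp_fun_convolution[OF q h f] Lp_fun_convolution[OF q h' f] Lp_fun_convolution[OF q d f]
    have "AE x in lborel. convolution h f x - convolution h' f x = convolution (\<lambda>x. h x - h' x) f x"
      using convolution_linear_left[OF q h h' f, of 1 "-1"] by eventually_elim simp
    then have "Lp_norm q (\<lambda>x. convolution h f x - convolution h' f x) = Lp_norm q (convolution (\<lambda>x. h x - h' x) f)"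
      using C[THEN Lp_fun_borel] by (intro Lp_norm_cong_AE) auto
    then show "Lp_norm q (\<lambda>x. convolution h f x - convolution h' f x) \<le> Lp_norm 1 (\<lambda>x. h x - h' x) * Lp_norm q f"
      using Lp_norm_convolution[OF q d f] by simp
  }
qed

text \<open>
  The equation says that \<open>1/2 + r\<close> is inverse to \<open>2 - e\<close> for the convolution product. The right-hand
  side is a contraction in \<open>r\<close> with factor \<open>1/2\<close>, so iteration from \<open>0\<close>, that is, summation of the
  geometric series, converges to a solution.
\<close>

lemma convolution_resolvent:
  fixes e :: "'a::euclidean_space \<Rightarrow> 'b::{real_normed_field,euclidean_space}"
  assumes e: "e \<in> Lp_fun 1" and norm_e: "Lp_norm 1 e \<le> 1"
  obtains r where "r \<in> Lp_fun 1" "Lp_norm 1 r \<le> 1/2"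
    "AE x in lborel. r x = (1/4) *\<^sub>R e x + (1/2) *\<^sub>R convolution r e x"
proof -
  note one = order_refl[of "1::real"]
  define \<Phi> where "\<Phi> u x = (1/4) *\<^sub>R e x + (1/2) *\<^sub>R convolution u e x" for u x
  have \<Phi>_L: "\<Phi> u \<in> Lp_fun 1" if "u \<in> Lp_fun 1" for u
    unfolding \<Phi>_def by (intro Lp_fun_add Lp_fun_scaleR Lp_fun_convolution one e that)
  have \<Phi>_lip: "Lp_norm 1 (\<lambda>x. \<Phi> u x - \<Phi> v x) \<le> (1/2) * Lp_norm 1 (\<lambda>x. u x - v x)"
    if u: "u \<in> Lp_fun 1" and v: "v \<in> Lp_fun 1" for u v
  proof -
    have "Lp_norm 1 (\<lambda>x. \<Phi> u x - \<Phi> v x) = Lp_norm 1 (\<lambda>x. (1/2) *\<^sub>R (convolution u e x - convolution v e x))"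
      by (simp add: \<Phi>_def scaleR_diff_right)
    also have "\<dots> = (1/2) * Lp_norm 1 (\<lambda>x. convolution u e x - convolution v e x)"
      by (subst Lp_norm_scaleR[OF one Lp_fun_diff[OF one Lp_fun_convolution[OF one u e] Lp_fun_convolution[OF one v e]]]) simp
    also have "\<dots> \<le> (1/2) * (Lp_norm 1 (\<lambda>x. u x - v x) * Lp_norm 1 e)"
      by (intro mult_left_mono Lp_norm_convolution_diff_left one u v e) auto
    also have "\<dots> \<le> (1/2) * (Lp_norm 1 (\<lambda>x. u x - v x) * 1)"
      by (intro mult_left_mono norm_e) auto
    finally show ?thesis by simp
  qed
  define s where "s n = (\<Phi> ^^ n) (\<lambda>x. 0)" for n
  have s_L: "s n \<in> Lp_fun 1" for n
    by (induction n) (auto simp: s_def \<Phi>_L)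
  have inc: "Lp_norm 1 (\<lambda>x. s (Suc n) x - s n x) \<le> Lp_norm 1 (s 1) * (1/2) ^ n" for n
  proof (induction n)
    case 0 show ?case by (simp add: s_def)
  next
    case (Suc n)
    have "Lp_norm 1 (\<lambda>x. s (Suc (Suc n)) x - s (Suc n) x) \<le> (1/2) * Lp_norm 1 (\<lambda>x. s (Suc n) x - s n x)"
      using \<Phi>_lip[OF s_L s_L, of "Suc n" n] by (simp add: s_def)
    then show ?case using Suc by simp
  qed
  obtain r where r: "r \<in> Lp_fun 1" and lim: "(\<lambda>n. Lp_norm 1 (\<lambda>x. s n x - r x)) \<longlonglongrightarrow> 0"
    using Lp_geometric_limit[OF one s_L inc] by blast
  have bound: "Lp_norm 1 (\<lambda>x. r x - \<Phi> r x) \<le> Lp_norm 1 (\<lambda>x. s (Suc n) x - r x) + (1/2) * Lp_norm 1 (\<lambda>x. s n x - r x)" for n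
    using Lp_norm_triangle3[OF one r s_L[of "Suc n"] \<Phi>_L[OF r]] \<Phi>_lip[OF s_L r, of n]
    by (simp add: s_def Lp_norm_minus_commute[of 1 r])
  have "(\<lambda>n. Lp_norm 1 (\<lambda>x. s (Suc n) x - r x) + (1/2) * Lp_norm 1 (\<lambda>x. s n x - r x)) \<longlonglongrightarrow> 0 + (1/2) * 0"
    by (intro tendsto_intros lim LIMSEQ_Suc[OF lim])
  then have "Lp_norm 1 (\<lambda>x. r x - \<Phi> r x) \<le> 0"
    using LIMSEQ_le_const[of _ 0 "Lp_norm 1 (\<lambda>x. r x - \<Phi> r x)"] bound by simp
  then have "Lp_norm 1 (\<lambda>x. r x - \<Phi> r x) = 0" by (simp add: antisym)
  then have "AE x in lborel. r x - \<Phi> r x = 0"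
    using Lp_norm_eq_0_iff[OF one Lp_fun_diff[OF one r \<Phi>_L[OF r]]] by simp
  then have fixpt: "AE x in lborel. r x = \<Phi> r x" by simp
  have "Lp_norm 1 r = Lp_norm 1 (\<Phi> r)"
    by (rule Lp_norm_cong_AE[OF r[THEN Lp_fun_borel] \<Phi>_L[OF r, THEN Lp_fun_borel] fixpt])
  also have "\<dots> \<le> (1/4) * Lp_norm 1 e + (1/2) * Lp_norm 1 (convolution r e)"
    using Lp_norm_triangle[OF one Lp_fun_scaleR[OF one e, of "1/4"] Lp_fun_scaleR[OF one Lp_fun_convolution[OF one r e], of "1/2"]]
    unfolding \<Phi>_def by (simp add: Lp_norm_scaleR[OF one e] Lp_norm_scaleR[OF one Lp_fun_convolution[OF one r e]])
  also have "\<dots> \<le> (1/4) * 1 + (1/2) * (Lp_norm 1 r * 1)"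
    by (intro add_mono mult_left_mono norm_e order_trans[OF Lp_norm_convolution[OF one r e]]) auto
  finally have "Lp_norm 1 r \<le> 1/2" by simp
  with r fixpt show ?thesis using that unfolding \<Phi>_def by blast
qed

text \<open>
  The stage reached after finitely many factors \<open>2 - e\<close>: the map \<open>T\<close> is their product, its inverse is
  \<open>c\<close> times the identity plus convolution with \<open>h\<close>.
\<close>

definition partial_factorization ::
    "real \<Rightarrow> ('a::euclidean_space \<Rightarrow> 'b::{real_normed_field,euclidean_space}) set \<Rightarrow> real
      \<Rightarrow> (('a \<Rightarrow> 'b) \<Rightarrow> 'a \<Rightarrow> 'b) \<Rightarrow> ('a \<Rightarrow> 'b) \<Rightarrow> bool"
  where "partial_factorization q A c T h \<longleftrightarrow> h \<in> Lp_fun 1 \<and> Lp_totally_bounded q (T ` A) \<and>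
    (\<forall>f\<in>A. AE x in lborel. f x = c *\<^sub>R T f x + convolution h (T f) x)"

text \<open>
  The inverse \<open>1/2 + r\<close> of \<open>2 - e\<close> recovers \<open>u\<close> from \<open>u' = 2 u - e * u\<close>.
\<close>

lemma resolvent_inverse:
  fixes e r u :: "'a::euclidean_space \<Rightarrow> 'b::{real_normed_field,euclidean_space}"
  assumes q: "1 \<le> q" and e: "e \<in> Lp_fun 1" and r: "r \<in> Lp_fun 1" and u: "u \<in> Lp_fun q"
    and res: "AE x in lborel. r x = (1/4) *\<^sub>R e x + (1/2) *\<^sub>R convolution r e x"
    and u': "\<And>x. u' x = 2 *\<^sub>R u x - convolution e u x"
  shows "AE x in lborel. u x = (1/2) *\<^sub>R u' x + convolution r u' x"
proof -
  note re = Lp_fun_convolution[OF order_refl r e] and eu = Lp_fun_convolution[OF q e u]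
  note rhs = Lp_fun_add[OF order_refl Lp_fun_scaleR[OF order_refl e] Lp_fun_scaleR[OF order_refl re]]
  have ru: "convolution r u x = convolution (\<lambda>x. (1/4) *\<^sub>R e x + (1/2) *\<^sub>R convolution r e x) u x" for x
    by (rule convolution_cong_AE[OF r[THEN Lp_fun_borel] rhs[THEN Lp_fun_borel]
          u[THEN Lp_fun_borel] u[THEN Lp_fun_borel] res]) simp
  have ru': "convolution r u' = convolution r (\<lambda>x. 2 *\<^sub>R u x + (- 1) *\<^sub>R convolution e u x)"
    by (simp add: u'[abs_def])
  show ?thesis
    using convolution_linear_left[OF q e re u, of "1/4" "1/2"] convolution_assoc[OF q r e u]
      convolution_linear_right[OF q r u eu, of 2 "-1"]
  proof eventually_elim
    case (elim x)
    have "convolution r u' x = 2 *\<^sub>R convolution r u x - convolution r (convolution e u) x"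
      using elim(3) by (simp add: ru')
    also have "\<dots> = (1/2) *\<^sub>R convolution e u x"
      using elim(1,2) by (simp add: ru scaleR_add_right)
    finally show ?case by (simp add: u' scaleR_diff_right)
  qed
qed

text \<open>
  If \<open>e\<close> hardly changes \<open>h\<close>, then \<open>e\<close> acts on \<open>h\<close> like the identity, and so does the inverse
  \<open>1/2 + r\<close> of \<open>2 - e\<close>. For the error \<open>s = h * r - h / 2\<close> the resolvent equation reads
  \<open>s = s * e / 2 + (h * e - h) / 2\<close>, so its norm is at most half of itself plus \<open>\<delta> / 2\<close>.
\<close>

lemma resolvent_almost_half:
  fixes e r h :: "'a::euclidean_space \<Rightarrow> 'b::{real_normed_field,euclidean_space}"
  assumes e: "e \<in> Lp_fun 1" "Lp_norm 1 e \<le> 1" and r: "r \<in> Lp_fun 1" and h: "h \<in> Lp_fun 1"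
    and res: "AE x in lborel. r x = (1/4) *\<^sub>R e x + (1/2) *\<^sub>R convolution r e x"
    and close: "Lp_norm 1 (\<lambda>x. h x - convolution h e x) \<le> \<delta>"
  shows "Lp_norm 1 (\<lambda>x. convolution h r x - (1/2) *\<^sub>R h x) \<le> \<delta>"
proof -
  note one = order_refl[of "1::real"]
  note re = Lp_fun_convolution[OF one r e(1)] and hr = Lp_fun_convolution[OF one h r]
    and he = Lp_fun_convolution[OF one h e(1)]
  note rhs = Lp_fun_add[OF one Lp_fun_scaleR[OF one e(1)] Lp_fun_scaleR[OF one re]]
  define s where "s x = convolution h r x - (1/2) *\<^sub>R h x" for x
  have s: "s \<in> Lp_fun 1"
    unfolding s_def by (intro Lp_fun_diff Lp_fun_scaleR one hr h)
  note se = Lp_fun_convolution[OF one s e(1)]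
  have hr_eq: "convolution h r x = convolution h (\<lambda>x. (1/4) *\<^sub>R e x + (1/2) *\<^sub>R convolution r e x) x" for x
    by (rule convolution_cong_AE[OF h[THEN Lp_fun_borel] h[THEN Lp_fun_borel]
          r[THEN Lp_fun_borel] rhs[THEN Lp_fun_borel] _ res]) simp
  have hr_s: "convolution (convolution h r) e = convolution (\<lambda>x. 1 *\<^sub>R s x + (1/2) *\<^sub>R h x) e"
    by (simp add: s_def)
  have s_eq: "AE x in lborel. s x = (1/2) *\<^sub>R convolution s e x + (1/2) *\<^sub>R (convolution h e x - h x)"
    using convolution_linear_right[OF one h e(1) re, of "1/4" "1/2"] convolution_assoc[OF one h r e(1)]
      convolution_linear_left[OF one s h e(1), of 1 "1/2"]
  proof eventually_elim
    case (elim x)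
    have "s x = (1/4) *\<^sub>R convolution h e x + (1/2) *\<^sub>R convolution (convolution h r) e x - (1/2) *\<^sub>R h x"
      unfolding s_def hr_eq elim(1) elim(2) ..
    also have "convolution (convolution h r) e x = convolution s e x + (1/2) *\<^sub>R convolution h e x"
      using elim(3) by (simp add: hr_s)
    also have "(1/4) *\<^sub>R convolution h e x
        + (1/2) *\<^sub>R (convolution s e x + (1/2) *\<^sub>R convolution h e x) - (1/2) *\<^sub>R h x
        = (1/2) *\<^sub>R convolution s e x + (1/4 + 1/4) *\<^sub>R convolution h e x - (1/2) *\<^sub>R h x"
      by (simp only: scaleR_add_right scaleR_add_left scaleR_scaleR) simp
    finally show ?case by (simp add: scaleR_diff_right)
  qed
  note d = Lp_fun_diff[OF one he h]
  note parts = Lp_fun_scaleR[OF one se, of "1/2"] Lp_fun_scaleR[OF one d, of "1/2"]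
  have "Lp_norm 1 s = Lp_norm 1 (\<lambda>x. (1/2) *\<^sub>R convolution s e x + (1/2) *\<^sub>R (convolution h e x - h x))"
    by (rule Lp_norm_cong_AE[OF s[THEN Lp_fun_borel] Lp_fun_add[OF one parts, THEN Lp_fun_borel] s_eq])
  also have "\<dots> \<le> (1/2) * Lp_norm 1 (convolution s e) + (1/2) * Lp_norm 1 (\<lambda>x. convolution h e x - h x)"
    using Lp_norm_triangle[OF one parts] Lp_norm_scaleR[OF one se, of "1/2"] Lp_norm_scaleR[OF one d, of "1/2"]
    by simp
  also have "\<dots> \<le> (1/2) * (Lp_norm 1 s * 1) + (1/2) * \<delta>"
    using close Lp_norm_convolution[OF one s e(1)] mult_left_mono[OF e(2), of "Lp_norm 1 s"]
    by (simp add: Lp_norm_minus_commute[of 1 h])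
  finally show ?thesis by (simp add: s_def[abs_def])
qed

text \<open>
  One more factor \<open>2 - e\<close>, with \<open>e\<close> an average over a ball so small that it moves both the functions
  \<open>T f\<close> and the kernel \<open>h\<close> by at most \<open>\<delta>\<close>. Multiplying \<open>c + h\<close> by \<open>1/2 + r\<close> yields
  \<open>c / 2 + (c r + h / 2 + h * r)\<close>; the bracket is the new kernel.
\<close>

lemma partial_factorization_step:
  fixes A :: "('a::euclidean_space \<Rightarrow> 'b::{real_normed_field,euclidean_space}) set"
  assumes q: "1 \<le> q" and c: "0 \<le> c" and fac: "partial_factorization q A c T h" and \<delta>: "0 < \<delta>"
  obtains T' h' where "partial_factorization q A (c / 2) T' h'"
    "\<And>f. f \<in> A \<Longrightarrow> Lp_norm q (\<lambda>x. T' f x - T f x) \<le> \<delta>"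
    "Lp_norm 1 (\<lambda>x. h' x - h x) \<le> c + \<delta>"
proof -
  note one = order_refl[of "1::real"]
  have h: "h \<in> Lp_fun 1" and TB: "Lp_totally_bounded q (T ` A)"
    and f_eq: "\<And>f. f \<in> A \<Longrightarrow> AE x in lborel. f x = c *\<^sub>R T f x + convolution h (T f) x"
    using fac by (auto simp: partial_factorization_def)
  have T: "T f \<in> Lp_fun q" if "f \<in> A" for f
    using TB that by (auto simp: Lp_totally_bounded_def)
  obtain d1 where d1: "0 < d1" "\<And>\<rho> u. 0 < \<rho> \<Longrightarrow> \<rho> \<le> d1 \<Longrightarrow> u \<in> T ` A \<Longrightarrow>
      Lp_norm q (\<lambda>x. u x - convolution (ball_average \<rho>) u x) \<le> \<delta>"
    using convolution_ball_average_approx_uniform[OF q TB \<delta>] by blast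
  obtain d2 where d2: "0 < d2" "\<And>\<rho>. 0 < \<rho> \<Longrightarrow> \<rho> \<le> d2 \<Longrightarrow>
      Lp_norm 1 (\<lambda>x. h x - convolution (ball_average \<rho>) h x) \<le> \<delta>"
    using convolution_ball_average_approx[OF one h \<delta>] by blast
  define \<rho> where "\<rho> = min d1 d2"
  have \<rho>: "0 < \<rho>" "\<rho> \<le> d1" "\<rho> \<le> d2" using d1(1) d2(1) by (auto simp: \<rho>_def)
  define e :: "'a \<Rightarrow> 'b" where "e = ball_average \<rho>"
  have e: "e \<in> Lp_fun 1" "Lp_norm 1 e \<le> 1"
    unfolding e_def by (simp_all add: ball_average_Lp_fun[OF \<rho>(1)] ball_average_norm[OF \<rho>(1)])
  have e_T: "Lp_norm q (\<lambda>x. T f x - convolution e (T f) x) \<le> \<delta>" if "f \<in> A" for f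
    using d1(2)[OF \<rho>(1,2)] that by (simp add: e_def)
  have e_h: "Lp_norm 1 (\<lambda>x. h x - convolution h e x) \<le> \<delta>"
    using d2(2)[OF \<rho>(1,3)] convolution_commute[OF h[THEN Lp_fun_borel] e(1)[THEN Lp_fun_borel]]
    by (simp add: e_def)
  obtain r where r: "r \<in> Lp_fun 1" "Lp_norm 1 r \<le> 1/2"
    and res: "AE x in lborel. r x = (1/4) *\<^sub>R e x + (1/2) *\<^sub>R convolution r e x"
    using convolution_resolvent[OF e] by blast
  define S where "S u x = 2 *\<^sub>R u x - convolution e u x" for u x
  define T' where "T' f = S (T f)" for f
  note hr = Lp_fun_convolution[OF one h r(1)]
  define k where "k x = (1/2) *\<^sub>R h x + 1 *\<^sub>R convolution h r x" for x
  have k: "k \<in> Lp_fun 1" unfolding k_def by (intro Lp_fun_add Lp_fun_scaleR one h hr)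
  define h' where "h' x = c *\<^sub>R r x + 1 *\<^sub>R k x" for x
  have h': "h' \<in> Lp_fun 1" unfolding h'_def by (intro Lp_fun_add Lp_fun_scaleR one r k)
  have S: "S u \<in> Lp_fun q" if "u \<in> Lp_fun q" for u
    unfolding S_def by (intro Lp_fun_diff Lp_fun_scaleR Lp_fun_convolution q e that)
  show ?thesis
  proof
    fix f assume f: "f \<in> A"
    have "T' f x - T f x = T f x - convolution e (T f) x" for x
      by (simp add: T'_def S_def scaleR_2)
    then show "Lp_norm q (\<lambda>x. T' f x - T f x) \<le> \<delta>" using e_T[OF f] by simp
  next
    note s = Lp_fun_diff[OF one hr Lp_fun_scaleR[OF one h, of "1/2"]]
    have "h' x - h x = c *\<^sub>R r x + (convolution h r x - (1/2) *\<^sub>R h x)" for x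
    proof -
      have "h x = (1/2 + 1/2) *\<^sub>R h x" by simp
      then have "h x = (1/2) *\<^sub>R h x + (1/2) *\<^sub>R h x" by (simp only: scaleR_add_left)
      then show ?thesis unfolding h'_def k_def by (simp add: algebra_simps)
    qed
    then have "Lp_norm 1 (\<lambda>x. h' x - h x) \<le> c * Lp_norm 1 r + Lp_norm 1 (\<lambda>x. convolution h r x - (1/2) *\<^sub>R h x)"
      using Lp_norm_triangle[OF one Lp_fun_scaleR[OF one r(1), of c] s] Lp_norm_scaleR[OF one r(1), of c] c
      by simp
    also have "\<dots> \<le> c * 1 + \<delta>"
      using r(2) c by (intro add_mono mult_left_mono resolvent_almost_half[OF e r(1) h res e_h]) auto
    finally show "Lp_norm 1 (\<lambda>x. h' x - h x) \<le> c + \<delta>" by simp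
  next
    show "partial_factorization q A (c / 2) T' h'"
      unfolding partial_factorization_def
    proof (intro conjI ballI h')
      have "Lp_totally_bounded q (S ` T ` A)"
      proof (rule Lp_totally_bounded_Lipschitz_image[OF TB S])
        fix u v :: "'a \<Rightarrow> 'b" assume u: "u \<in> Lp_fun q" and v: "v \<in> Lp_fun q"
        note C = Lp_fun_convolution[OF q e(1) u] Lp_fun_convolution[OF q e(1) v]
        have eq: "S u x - S v x = 2 *\<^sub>R (u x - v x) - (convolution e u x - convolution e v x)" for x
          by (simp add: S_def algebra_simps)
        have "Lp_norm q (\<lambda>x. S u x - S v x)
          \<le> Lp_norm q (\<lambda>x. 2 *\<^sub>R (u x - v x)) + Lp_norm q (\<lambda>x. convolution e u x - convolution e v x)"
          unfolding eq by (intro Lp_norm_diff_le Lp_fun_diff Lp_fun_scaleR q u v C)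
        also have "\<dots> \<le> 2 * Lp_norm q (\<lambda>x. u x - v x) + 1 * Lp_norm q (\<lambda>x. u x - v x)"
        proof (intro add_mono)
          show "Lp_norm q (\<lambda>x. 2 *\<^sub>R (u x - v x)) \<le> 2 * Lp_norm q (\<lambda>x. u x - v x)"
            by (simp add: Lp_norm_scaleR[OF q Lp_fun_diff[OF q u v]])
          show "Lp_norm q (\<lambda>x. convolution e u x - convolution e v x) \<le> 1 * Lp_norm q (\<lambda>x. u x - v x)"
            by (rule order_trans[OF Lp_norm_convolution_diff_right[OF q e(1) u v]
                  mult_right_mono[OF e(2) Lp_norm_nonneg]])
        qed
        finally show "Lp_norm q (\<lambda>x. S u x - S v x) \<le> 3 * Lp_norm q (\<lambda>x. u x - v x)" by simp
      qed
      then show "Lp_totally_bounded q (T' ` A)" by (simp add: T'_def[abs_def] image_image)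
    next
      fix f assume f: "f \<in> A"
      note Tf = T[OF f]
      have T'f: "T' f \<in> Lp_fun q" unfolding T'_def by (rule S[OF Tf])
      note rT' = Lp_fun_convolution[OF q r(1) T'f]
      have inv: "AE x in lborel. T f x = (1/2) *\<^sub>R T' f x + 1 *\<^sub>R convolution r (T' f) x"
        using resolvent_inverse[OF q e(1) r(1) Tf res, of "T' f"] by (simp add: T'_def S_def)
      note T_rhs = Lp_fun_add[OF q Lp_fun_scaleR[OF q T'f] Lp_fun_scaleR[OF q rT']]
      have hT: "convolution h (T f) x = convolution h (\<lambda>x. (1/2) *\<^sub>R T' f x + 1 *\<^sub>R convolution r (T' f) x) x" for x
        by (rule convolution_cong_AE[OF h[THEN Lp_fun_borel] h[THEN Lp_fun_borel]
              Tf[THEN Lp_fun_borel] T_rhs[THEN Lp_fun_borel] _ inv]) simp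
      show "AE x in lborel. f x = (c / 2) *\<^sub>R T' f x + convolution h' (T' f) x"
        using f_eq[OF f] inv convolution_linear_right[OF q h T'f rT', of "1/2" 1]
          convolution_linear_left[OF q r(1) k T'f, of c 1]
          convolution_linear_left[OF q h hr T'f, of "1/2" 1] convolution_assoc[OF q h r(1) T'f]
      proof eventually_elim
        case (elim x)
        have "convolution h' (T' f) x = c *\<^sub>R convolution r (T' f) x + convolution k (T' f) x"
          using elim(4) by (simp add: h'_def[abs_def])
        also have "convolution k (T' f) x = convolution h (T f) x"
          using elim(3,5,6) by (simp add: k_def[abs_def] hT)
        finally have "(c / 2) *\<^sub>R T' f x + convolution h' (T' f) x
            = c *\<^sub>R ((1/2) *\<^sub>R T' f x + 1 *\<^sub>R convolution r (T' f) x) + convolution h (T f) x"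
          by (simp add: scaleR_add_right)
        then show ?case using elim(1,2) by simp
      qed
    qed
  qed
qed

lemma partial_factorization_sequence:
  fixes A :: "('a::euclidean_space \<Rightarrow> 'b::{real_normed_field,euclidean_space}) set"
  assumes q: "1 \<le> q" and A: "Lp_totally_bounded q A"
  obtains T h where "\<And>n. partial_factorization q A ((1/2) ^ n) (T n) (h n)"
    "\<And>f. T 0 f = f"
    "\<And>n f. f \<in> A \<Longrightarrow> Lp_norm q (\<lambda>x. T (Suc n) f x - T n f x) \<le> (1/2) ^ n"
    "\<And>n. Lp_norm 1 (\<lambda>x. h (Suc n) x - h n x) \<le> 2 * (1/2) ^ n"
proof -
  have "\<exists>s. (\<forall>n. (partial_factorization q A ((1/2) ^ n) (fst (s n)) (snd (s n)) \<and> (n = 0 \<longrightarrow> fst (s n) = (\<lambda>f. f))) \<and>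
      ((\<forall>f\<in>A. Lp_norm q (\<lambda>x. fst (s (Suc n)) f x - fst (s n) f x) \<le> (1/2) ^ n) \<and>
       Lp_norm 1 (\<lambda>x. snd (s (Suc n)) x - snd (s n) x) \<le> 2 * (1/2) ^ n))"
  proof (rule dependent_nat_choice)
    \<comment> \<open>The empty product: the identity map with kernel \<open>0\<close>.\<close>
    have "partial_factorization q A 1 (\<lambda>f. f) (\<lambda>x. 0)"
      using A by (simp add: partial_factorization_def convolution_def)
    then show "\<exists>s. partial_factorization q A ((1/2) ^ 0) (fst s) (snd s) \<and> (0 = (0::nat) \<longrightarrow> fst s = (\<lambda>f. f))"
      by (intro exI[of _ "(\<lambda>f. f, \<lambda>x. 0)"]) simp
    fix s :: "(('a \<Rightarrow> 'b) \<Rightarrow> 'a \<Rightarrow> 'b) \<times> ('a \<Rightarrow> 'b)" and n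
    assume "partial_factorization q A ((1/2) ^ n) (fst s) (snd s) \<and> (n = 0 \<longrightarrow> fst s = (\<lambda>f. f))"
    then obtain T' h' where "partial_factorization q A ((1/2) ^ n / 2) T' h'"
      "\<And>f. f \<in> A \<Longrightarrow> Lp_norm q (\<lambda>x. T' f x - fst s f x) \<le> (1/2) ^ n"
      "Lp_norm 1 (\<lambda>x. h' x - snd s x) \<le> (1/2) ^ n + (1/2) ^ n"
      using partial_factorization_step[OF q, of "(1/2) ^ n" A "fst s" "snd s" "(1/2) ^ n"] by auto
    then show "\<exists>s'. (partial_factorization q A ((1/2) ^ Suc n) (fst s') (snd s') \<and> (Suc n = 0 \<longrightarrow> fst s' = (\<lambda>f. f))) \<and>
      (\<forall>f\<in>A. Lp_norm q (\<lambda>x. fst s' f x - fst s f x) \<le> (1/2) ^ n) \<and>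
       Lp_norm 1 (\<lambda>x. snd s' x - snd s x) \<le> 2 * (1/2) ^ n"
      by (intro exI[of _ "(T', h')"]) simp
  qed
  then obtain s where "\<And>n. partial_factorization q A ((1/2) ^ n) (fst (s n)) (snd (s n))"
    "fst (s 0) = (\<lambda>f. f)"
    "\<And>n f. f \<in> A \<Longrightarrow> Lp_norm q (\<lambda>x. fst (s (Suc n)) f x - fst (s n) f x) \<le> (1/2) ^ n"
    "\<And>n. Lp_norm 1 (\<lambda>x. snd (s (Suc n)) x - snd (s n) x) \<le> 2 * (1/2) ^ n"
    by blast
  then show ?thesis
    by (intro that[of "\<lambda>n. fst (s n)" "\<lambda>n. snd (s n)"]) auto
qed

text \<open>
  The sequences \<open>T n f\<close> and \<open>h n\<close> converge geometrically, and in
  \<open>f = (1/2) ^ n T n f + h n * T n f\<close> the first term tends to \<open>0\<close> because the \<open>T n f\<close> are bounded.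
\<close>

lemma L1_factor:
  fixes A :: "('a::euclidean_space \<Rightarrow> 'b::{real_normed_field,euclidean_space}) set"
  assumes q: "1 \<le> q" and A: "Lp_totally_bounded q A"
  obtains h where "h \<in> Lp_fun 1"
    "\<And>f. f \<in> A \<Longrightarrow> \<exists>u\<in>Lp_ball q. AE x in lborel. f x = convolution h u x"
proof -
  note one = order_refl[of "1::real"]
  obtain T h where fac: "\<And>n. partial_factorization q A ((1/2) ^ n) (T n) (h n)"
    and T0: "\<And>f. T 0 f = f"
    and T_step: "\<And>n f. f \<in> A \<Longrightarrow> Lp_norm q (\<lambda>x. T (Suc n) f x - T n f x) \<le> (1/2) ^ n"
    and h_step: "\<And>n. Lp_norm 1 (\<lambda>x. h (Suc n) x - h n x) \<le> 2 * (1/2) ^ n"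
    using partial_factorization_sequence[OF q A] by blast
  have h: "h n \<in> Lp_fun 1" for n using fac by (simp add: partial_factorization_def)
  have T: "T n f \<in> Lp_fun q" if "f \<in> A" for n f
    using fac[of n] that by (auto simp: partial_factorization_def Lp_totally_bounded_def)
  obtain M where M: "0 < M" "\<And>f. f \<in> A \<Longrightarrow> Lp_norm q f \<le> M"
    using Lp_totally_bounded_imp_bounded[OF q A] by blast
  define L where "L = M + 2"
  have L: "0 < L" using M by (simp add: L_def)
  have T_bound: "Lp_norm q (T n f) \<le> L" if f: "f \<in> A" for n f
  proof -
    have "Lp_norm q (\<lambda>x. T (0 + n) f x - T 0 f x) \<le> 2 * 1 * (1/2) ^ 0 * (1 - (1/2) ^ n)"
      by (rule Lp_diff_le_geometric[OF q T[OF f]]) (simp add: T_step[OF f])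
    also have "\<dots> \<le> 2" by simp
    finally have "Lp_norm q (\<lambda>x. T n f x - f x) \<le> 2" by (simp add: T0)
    then show ?thesis
      using Lp_norm_le_add_diff[OF q T[OF f, of n] T[OF f, of 0]] M(2)[OF f] by (simp add: T0 L_def)
  qed
  obtain H where H: "H \<in> Lp_fun 1" "(\<lambda>n. Lp_norm 1 (\<lambda>x. h n x - H x)) \<longlonglongrightarrow> 0"
    using Lp_geometric_limit[OF one h h_step] by blast
  have factor: "\<exists>u\<in>Lp_fun q. Lp_norm q u \<le> L \<and> (AE x in lborel. f x = convolution H u x)" if f: "f \<in> A" for f
  proof -
    have fL: "f \<in> Lp_fun q" using T[OF f, of 0] by (simp add: T0)
    obtain u where u: "u \<in> Lp_fun q" "(\<lambda>n. Lp_norm q (\<lambda>x. T n f x - u x)) \<longlonglongrightarrow> 0"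
      using Lp_geometric_limit[OF q, of "\<lambda>n. T n f" 1] T[OF f] T_step[OF f] by auto
    have "Lp_norm q u \<le> L + Lp_norm q (\<lambda>x. T n f x - u x)" for n
      using Lp_norm_le_add_diff[OF q u(1) T[OF f, of n]] T_bound[OF f, of n]
      by (simp add: Lp_norm_minus_commute[of q u])
    moreover have "(\<lambda>n. L + Lp_norm q (\<lambda>x. T n f x - u x)) \<longlonglongrightarrow> L + 0"
      by (intro tendsto_intros u(2))
    ultimately have uL: "Lp_norm q u \<le> L"
      using LIMSEQ_le_const[of "\<lambda>n. L + Lp_norm q (\<lambda>x. T n f x - u x)" L "Lp_norm q u"] by simp
    note Hu = Lp_fun_convolution[OF q H(1) u(1)]
    have "Lp_norm q (\<lambda>x. f x - convolution H u x)
       \<le> (1/2) ^ n * L + Lp_norm 1 (\<lambda>x. h n x - H x) * L + Lp_norm 1 H * Lp_norm q (\<lambda>x. T n f x - u x)" for n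
    proof -
      note Tn = T[OF f, of n]
      note C = Lp_fun_convolution[OF q h[of n] Tn] Lp_fun_convolution[OF q H(1) Tn]
      have "AE x in lborel. f x = (1/2) ^ n *\<^sub>R T n f x + convolution (h n) (T n f) x"
        using fac[of n] f by (simp add: partial_factorization_def)
      then have "AE x in lborel. f x - convolution (h n) (T n f) x = (1/2) ^ n *\<^sub>R T n f x"
        by eventually_elim simp
      then have "Lp_norm q (\<lambda>x. f x - convolution (h n) (T n f) x) = Lp_norm q (\<lambda>x. (1/2) ^ n *\<^sub>R T n f x)"
        by (intro Lp_norm_cong_AE Lp_fun_borel[where q = q] Lp_fun_diff Lp_fun_scaleR q fL C Tn)
      also have "\<dots> \<le> (1/2) ^ n * L"
        using T_bound[OF f, of n] by (simp add: Lp_norm_scaleR[OF q Tn] mult_left_mono)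
      finally have 1: "Lp_norm q (\<lambda>x. f x - convolution (h n) (T n f) x) \<le> (1/2) ^ n * L" .
      have 2: "Lp_norm q (\<lambda>x. convolution (h n) (T n f) x - convolution H (T n f) x) \<le> Lp_norm 1 (\<lambda>x. h n x - H x) * L"
        by (rule order_trans[OF Lp_norm_convolution_diff_left[OF q h H(1) Tn]
              mult_left_mono[OF T_bound[OF f] Lp_norm_nonneg]])
      have 3: "Lp_norm q (\<lambda>x. convolution H (T n f) x - convolution H u x) \<le> Lp_norm 1 H * Lp_norm q (\<lambda>x. T n f x - u x)"
        by (rule Lp_norm_convolution_diff_right[OF q H(1) Tn u(1)])
      show ?thesis
        using Lp_norm_triangle3[OF q fL C(1) Hu] Lp_norm_triangle3[OF q C(1) C(2) Hu] 1 2 3 by linarith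
    qed
    moreover have "(\<lambda>n. (1/2) ^ n * L + Lp_norm 1 (\<lambda>x. h n x - H x) * L
        + Lp_norm 1 H * Lp_norm q (\<lambda>x. T n f x - u x)) \<longlonglongrightarrow> 0 * L + 0 * L + Lp_norm 1 H * 0"
      by (intro tendsto_intros H(2) u(2) LIMSEQ_power_zero) auto
    ultimately have "Lp_norm q (\<lambda>x. f x - convolution H u x) \<le> 0"
      using LIMSEQ_le_const[of _ 0 "Lp_norm q (\<lambda>x. f x - convolution H u x)"] by simp
    then have "Lp_norm q (\<lambda>x. f x - convolution H u x) = 0" by (simp add: antisym)
    then have "AE x in lborel. f x = convolution H u x"
      using Lp_norm_eq_0_iff[OF q Lp_fun_diff[OF q fL Hu]] by simp
    then show ?thesis using u(1) uL by blast
  qed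
  show ?thesis
  \<comment> \<open>The bound \<open>L\<close> for \<open>u\<close> is moved into the kernel, which puts \<open>u\<close> into the unit ball.\<close>
  proof (rule that[of "\<lambda>x. L *\<^sub>R H x"])
    show "(\<lambda>x. L *\<^sub>R H x) \<in> Lp_fun 1" by (rule Lp_fun_scaleR[OF one H(1)])
    fix f assume "f \<in> A"
    then obtain u where u: "u \<in> Lp_fun q" "Lp_norm q u \<le> L" "AE x in lborel. f x = convolution H u x"
      using factor by blast
    have "convolution (\<lambda>x. L *\<^sub>R H x) (\<lambda>x. inverse L *\<^sub>R u x) x = convolution H u x" for x
      using L by (simp add: convolution_def)
    moreover have "(\<lambda>x. inverse L *\<^sub>R u x) \<in> Lp_ball q"
      using u L by (simp add: Lp_ball_def Lp_fun_scaleR[OF q] Lp_norm_scaleR[OF q] field_simps)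
    ultimately show "\<exists>u\<in>Lp_ball q. AE x in lborel. f x = convolution (\<lambda>x. L *\<^sub>R H x) u x"
      using u(3) by (intro bexI[of _ "\<lambda>x. inverse L *\<^sub>R u x"]) auto
  qed
qed

section \<open>Relatively compact sets and factorizations\<close>

theorem proposition17:
  fixes q :: real
    and C :: "('a::euclidean_space \<Rightarrow> 'b::{real_normed_field,euclidean_space}) set set"
  assumes "1 \<le> q" and "C \<subseteq> Lp q"
  shows "compactin (Lp_topology q) (Lp_topology q closure_of C) \<longleftrightarrow>
    (\<exists>g \<in> (C0 :: ('a \<Rightarrow> 'b) set). \<exists>h \<in> (Lp_fun 1 :: ('a \<Rightarrow> 'b) set).
       C \<subseteq> (\<lambda>f. ae_rel q `` {\<lambda>x. g x * convolution h f x}) ` Lp_ball q)"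
proof -
  note q = \<open>1 \<le> q\<close>
  have CL: "f \<in> Lp_fun q \<and> F = Lp_class q f" if "F \<in> C" "f \<in> F" for F f
  proof -
    obtain u where u: "u \<in> Lp_fun q" "F = Lp_class q u"
      using \<open>F \<in> C\<close> assms(2) Lp_class_cases by blast
    then have "f \<in> Lp_fun q" "AE x in lborel. u x = f x" using \<open>f \<in> F\<close> by (auto simp: mem_Lp_class)
    then show ?thesis using u by (simp add: Lp_class_eq_iff)
  qed
  show ?thesis
    unfolding compactin_closure_iff_Lp_totally_bounded[OF assms] Lp_class_def[symmetric]
  proof
    assume TB: "Lp_totally_bounded q (\<Union>C)"
    obtain g :: "'a \<Rightarrow> 'b" where g: "g \<in> C0" "\<And>x. g x \<noteq> 0"
      and TBg: "Lp_totally_bounded q ((\<lambda>f x. f x / g x) ` \<Union>C)"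
      using C0_factor[OF q TB] by blast
    obtain h where h: "h \<in> Lp_fun 1"
      and hf: "\<And>v. v \<in> (\<lambda>f x. f x / g x) ` \<Union>C \<Longrightarrow> \<exists>u\<in>Lp_ball q. AE x in lborel. v x = convolution h u x"
      using L1_factor[OF q TBg] by blast
    have "F \<in> (\<lambda>f. Lp_class q (\<lambda>x. g x * convolution h f x)) ` Lp_ball q" if F: "F \<in> C" for F
    proof -
      obtain f where f: "f \<in> Lp_fun q" "F = Lp_class q f"
        using F assms(2) Lp_class_cases by blast
      then have fF: "f \<in> F" by (simp add: mem_Lp_class)
      then obtain u where u: "u \<in> Lp_ball q" "AE x in lborel. f x / g x = convolution h u x"
        using hf[of "\<lambda>x. f x / g x"] F by blast
      have AE: "AE x in lborel. f x = g x * convolution h u x"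
        using u(2) by eventually_elim (simp add: g(2) field_simps)
      obtain G where G: "0 < G" "\<And>x. norm (g x) \<le> G" using C0_bounded[OF g(1)] by blast
      have gm: "g \<in> borel_measurable borel" using g(1) by (auto simp: C0_def intro: borel_measurable_continuous_onI)
      have "(\<lambda>x. g x * convolution h u x) \<in> Lp_fun q"
        using u(1) G(1) by (intro Lp_fun_mult[OF q Lp_fun_convolution[OF q h] gm _ G(2)]) (auto simp: Lp_ball_def)
      then have "F = Lp_class q (\<lambda>x. g x * convolution h u x)"
        using f AE by (simp add: Lp_class_eq_iff)
      then show ?thesis using u(1) by blast
    qed
    then show "\<exists>g\<in>(C0 :: ('a \<Rightarrow> 'b) set). \<exists>h\<in>(Lp_fun 1 :: ('a \<Rightarrow> 'b) set).
        C \<subseteq> (\<lambda>f. Lp_class q (\<lambda>x. g x * convolution h f x)) ` Lp_ball q"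
      using g(1) h by blast
  next
    assume "\<exists>g\<in>(C0 :: ('a \<Rightarrow> 'b) set). \<exists>h\<in>(Lp_fun 1 :: ('a \<Rightarrow> 'b) set).
        C \<subseteq> (\<lambda>f. Lp_class q (\<lambda>x. g x * convolution h f x)) ` Lp_ball q"
    then obtain g h :: "'a \<Rightarrow> 'b" where g: "g \<in> C0" and h: "h \<in> Lp_fun 1"
      and sub: "C \<subseteq> (\<lambda>f. Lp_class q (\<lambda>x. g x * convolution h f x)) ` Lp_ball q" by blast
    let ?B = "(\<lambda>f x. g x * convolution h f x) ` Lp_ball q"
    show "Lp_totally_bounded q (\<Union>C)"
    proof (rule Lp_totally_bounded_approx[OF q])
      show "\<Union>C \<subseteq> Lp_fun q" using CL by blast
      fix e :: real assume e: "0 < e"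
      have "\<exists>P\<in>?B. Lp_norm q (\<lambda>x. f x - P x) \<le> e" if "f \<in> \<Union>C" for f
      proof -
        obtain F where F: "F \<in> C" "f \<in> F" using \<open>f \<in> \<Union>C\<close> by blast
        then obtain u where u: "u \<in> Lp_ball q" "F = Lp_class q (\<lambda>x. g x * convolution h u x)"
          using sub by blast
        define P where "P = (\<lambda>x. g x * convolution h u x)"
        have P: "P \<in> Lp_fun q" "f \<in> Lp_fun q" "AE x in lborel. P x = f x"
          using F(2) u(2) by (auto simp: P_def mem_Lp_class)
        have "AE x in lborel. f x - P x = 0" using P(3) by eventually_elim simp
        then have "Lp_norm q (\<lambda>x. f x - P x) = 0"
          using Lp_norm_eq_0_iff[OF q Lp_fun_diff[OF q P(2,1)]] by simp
        then show ?thesis using u(1) e by (intro bexI[of _ P]) (auto simp: P_def)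
      qed
      then show "\<exists>B. Lp_totally_bounded q B \<and> (\<forall>f\<in>\<Union>C. \<exists>P\<in>B. Lp_norm q (\<lambda>x. f x - P x) \<le> e)"
        using Lp_totally_bounded_multiplier_convolution[OF q g h] by blast
    qed
  qed
qed

end
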